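(* Let $\Omega$ be a bounded domain, $\alpha\in(0,1)$, $\rho\in\mathbb{C}$, $T>0$, let $U$ be bounded in $\bar\Omega$, and let $G_0\in L^2(\Omega)$. Let $G(x_0,\rho,t)$ be the solution of $$ {}^C_0D^{\alpha,x_0}_t G=\Delta G\ \text{ in }\Omega\times(0,T],\qquad G(x_0,\rho,0)=G_0(x_0)\ \text{ in }\Omega,\qquad G=0\ \text{ on }\partial\Omega\times(0,T].$$ Let $\tau=T/N$, $N\in\mathbb{N}$, $t_n=n\tau$, and let $G^n$ be the solution of the second-order backward difference scheme: $G^0=G_0$, $G^n=0$ on $\partial\Omega$ for $n=1,\dots,N$, and in $\Omega$ $$d^{\alpha,2}_0G^{1}+AG^{1}+\tfrac12A\big(e^{-t_1\rho U(x_0)}G^0\big)=e^{-t_1\rho U(x_0)}d^{\alpha,2}_0G^0,$$ $$\sum_{i=0}^{n-1}d^{\alpha,2}_i e^{-t_i\rho U(x_0)}G^{n-i}+AG^n=e^{-t_n\rho U(x_0)}\sum_{i=0}^{n-1}d_i^{\alpha,2}G^0,\quad n=2,\dots,N,$$ where the coefficients are defined by $\left(\frac{(1-\zeta)+(1-\zeta)^2/2}{\tau}\right)^{\alpha}=\sum_{i=0}^\infty d_i^{\alpha,2}\zeta^i$. Then there is a constant $C>0$, independent of $\tau$, $n$ and $G_0$, such that for $n=1,\dots,N$ $$\|G(\cdot,\rho,t_n)-G^n\|_{L^2(\Omega)}\le C\,t_n^{-2}\,\tau^2\,\|G_0\|_{L^2(\Omega)}.$$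
   Context: All functions are complex valued. $A=-\Delta$ with zero Dirichlet boundary condition on $\Omega$. Since $G_0$ is only in $L^2(\Omega)$, the term $A(e^{-t_1\rho U}G^0)$ (and so the equation for $G^1$) is understood with $A$ extended by duality to an operator on $L^2(\Omega)$ with values in the dual of $D(A)$; thus $(d_0^{\alpha,2}+A)^{-1}A$ denotes the bounded operator $I-d_0^{\alpha,2}(d_0^{\alpha,2}+A)^{-1}$ on $L^2(\Omega)$. ${}^C_0D^{\alpha,x_0}_t$ is the Caputo fractional substantial derivative: ${}^C_0D^{\alpha,x_0}_tG(x_0,\rho,t)=e^{-t\rho U(x_0)}\;{}^C_0D^{\alpha}_t\big(e^{t\rho U(x_0)}G(x_0,\rho,t)\big)$, where ${}^C_0D^\alpha_t g(t)=\frac{1}{\Gamma(1-\alpha)}\int_0^t(t-\xi)^{-\alpha}g'(\xi)\,d\xi$. Meaning of the solution: put $\beta(z)=\beta(z,x_0)=z+\rho U(x_0)$; $\beta(z)$ and its (principal) powers act as multiplication operators in $x_0$. The Laplace transform in time of the solution is $\tilde G(z)=((\beta(z))^{\alpha}+A)^{-1}(\beta(z))^{\alpha-1}G_0$, i.e. $$G(t)=\frac{1}{2\pi\mathbf i}\int_{\Gamma_{\theta,\kappa}}e^{zt}((\beta(z))^{\alpha}+A)^{-1}(\beta(z))^{\alpha-1}G_0\,dz,$$ where $\Gamma_{\theta,\kappa}=\{|z|=\kappa,|\arg z|\le\theta\}\cup\{z=re^{\pm\mathbf i\theta}:r\ge\kappa\}$, oriented with increasing imaginary part, with $\theta\in(\pi/2,\pi)$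 sufficiently close to $\pi/2$ and $\kappa>0$ sufficiently large (depending on $|\rho|\,\|U\|_{L^\infty(\bar\Omega)}$). *)

theory Defs
  imports "HOL-Complex_Analysis.Complex_Analysis"
begin

(* Elements of L^2(Omega) are represented by functions on the whole space; only their
   values on Omega matter, up to null sets. *)

definition L2 :: "'a::euclidean_space set \<Rightarrow> ('a \<Rightarrow> complex) set" where
  "L2 \<Omega> = {f. f \<in> borel_measurable (lebesgue_on \<Omega>) \<and>
               integrable (lebesgue_on \<Omega>) (\<lambda>x. (norm (f x))\<^sup>2)}"

definition l2_norm :: "'a::euclidean_space set \<Rightarrow> ('a \<Rightarrow> complex) \<Rightarrow> real" where
  "l2_norm \<Omega> f = sqrt (\<integral>x. (norm (f x))\<^sup>2 \<partial>lebesgue_on \<Omega>)"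

definition l2_inner ::
    "'a::euclidean_space set \<Rightarrow> ('a \<Rightarrow> complex) \<Rightarrow> ('a \<Rightarrow> complex) \<Rightarrow> complex" where
  "l2_inner \<Omega> f g = (\<integral>x. f x * cnj (g x) \<partial>lebesgue_on \<Omega>)"

definition partial :: "'a::euclidean_space \<Rightarrow> ('a \<Rightarrow> complex) \<Rightarrow> 'a \<Rightarrow> complex" where
  "partial b f x = frechet_derivative f (at x) b"

definition laplacian :: "('a::euclidean_space \<Rightarrow> complex) \<Rightarrow> 'a \<Rightarrow> complex" where
  "laplacian f x = (\<Sum>b\<in>Basis. partial b (partial b f) x)"

primrec C_k :: "nat \<Rightarrow> ('a::euclidean_space \<Rightarrow> complex) \<Rightarrow> bool" where
  "C_k 0 f \<longleftrightarrow> continuous_on UNIV f"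
| "C_k (Suc k) f \<longleftrightarrow> (\<forall>x. f differentiable (at x)) \<and> (\<forall>b\<in>Basis. C_k k (partial b f))"

definition test_functions :: "'a::euclidean_space set \<Rightarrow> ('a \<Rightarrow> complex) set" where
  "test_functions \<Omega> =
     {\<phi>. (\<forall>k. C_k k \<phi>) \<and> (\<exists>K. compact K \<and> K \<subseteq> \<Omega> \<and> (\<forall>x. x \<notin> K \<longrightarrow> \<phi> x = 0))}"

(* The conjugation inside l2_inner is harmless here and in dirichlet_laplacian:
   the test functions are closed under conjugation. *)
definition weak_partial ::
    "'a::euclidean_space set \<Rightarrow> 'a \<Rightarrow> ('a \<Rightarrow> complex) \<Rightarrow> ('a \<Rightarrow> complex) \<Rightarrow> bool" where
  "weak_partial \<Omega> b u v \<longleftrightarrow>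
     v \<in> L2 \<Omega> \<and> (\<forall>\<phi>\<in>test_functions \<Omega>. l2_inner \<Omega> u (partial b \<phi>) = - l2_inner \<Omega> v \<phi>)"

(* The closure of the test functions in the Sobolev space H^1(Omega). *)
definition H1_0 :: "'a::euclidean_space set \<Rightarrow> ('a \<Rightarrow> complex) set" where
  "H1_0 \<Omega> = {u \<in> L2 \<Omega>. \<exists>Du \<phi>.
      (\<forall>b\<in>Basis. weak_partial \<Omega> b u (Du b)) \<and>
      (\<forall>k::nat. \<phi> k \<in> test_functions \<Omega>) \<and>
      (\<lambda>k. l2_norm \<Omega> (\<lambda>x. u x - \<phi> k x)) \<longlonglongrightarrow> 0 \<and>
      (\<forall>b\<in>Basis. (\<lambda>k. l2_norm \<Omega> (\<lambda>x. Du b x - partial b (\<phi> k) x)) \<longlonglongrightarrow> 0)}"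

(* The graph of A = -Laplacian with zero Dirichlet boundary condition, as an unbounded operator
   on L^2(Omega): u is in D(A) and A u = f. Here D(A) consists of the u in H^1_0(Omega)
   whose distributional Laplacian lies in L^2(Omega). *)
definition dirichlet_laplacian ::
    "'a::euclidean_space set \<Rightarrow> ('a \<Rightarrow> complex) \<Rightarrow> ('a \<Rightarrow> complex) \<Rightarrow> bool" where
  "dirichlet_laplacian \<Omega> u f \<longleftrightarrow>
     u \<in> H1_0 \<Omega> \<and> f \<in> L2 \<Omega> \<and>
     (\<forall>\<phi>\<in>test_functions \<Omega>. - l2_inner \<Omega> u (laplacian \<phi>) = l2_inner \<Omega> f \<phi>)"

(* u = (m + A)^{-1} f, where m acts as a multiplication operator. *)
definition resolvent_eq ::
    "'a::euclidean_space set \<Rightarrow> ('a \<Rightarrow> complex) \<Rightarrow> ('a \<Rightarrow> complex) \<Rightarrow> ('a \<Rightarrow> complex) \<Rightarrow> bool" where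
  "resolvent_eq \<Omega> m f u \<longleftrightarrow>
     (\<exists>Au. dirichlet_laplacian \<Omega> u Au \<and> (AE x in lebesgue_on \<Omega>. m x * u x + Au x = f x))"

definition Gamma_set :: "real \<Rightarrow> real \<Rightarrow> complex set" where
  "Gamma_set \<theta> \<kappa> = {z. norm z = \<kappa> \<and> \<bar>Arg z\<bar> \<le> \<theta>} \<union>
                 {z. \<exists>r\<ge>\<kappa>. z = rcis r \<theta> \<or> z = rcis r (- \<theta>)}"

(* The integral of F along Gamma_set, oriented with increasing imaginary part, exists and
   equals I; the three pieces are the incoming lower ray, the arc and the upper ray. *)
definition has_Gamma_integral ::
    "real \<Rightarrow> real \<Rightarrow> (complex \<Rightarrow> complex) \<Rightarrow> complex \<Rightarrow> bool" where
  "has_Gamma_integral \<theta> \<kappa> F I \<longleftrightarrow>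
     set_integrable lborel {\<kappa>..} (\<lambda>r. F (rcis r (- \<theta>)) * cis (- \<theta>)) \<and>
     F contour_integrable_on part_circlepath 0 \<kappa> (- \<theta>) \<theta> \<and>
     set_integrable lborel {\<kappa>..} (\<lambda>r. F (rcis r \<theta>) * cis \<theta>) \<and>
     I = - (LINT r:{\<kappa>..}|lborel. F (rcis r (- \<theta>)) * cis (- \<theta>))
         + contour_integral (part_circlepath 0 \<kappa> (- \<theta>) \<theta>) F
         + (LINT r:{\<kappa>..}|lborel. F (rcis r \<theta>) * cis \<theta>)"

definition beta :: "complex \<Rightarrow> ('a \<Rightarrow> complex) \<Rightarrow> complex \<Rightarrow> 'a \<Rightarrow> complex" where
  "beta \<rho> U z x = z + \<rho> * U x"

(* G is the solution of the time-fractional substantial diffusion problem with initial value G0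
   on (0,T], represented through its Laplace transform
     Gt z = (beta(z)^alpha + A)^{-1} beta(z)^{alpha-1} G0.
   The L^2(Omega)-valued integral
     G t = 1/(2 pi i) * integral of exp(z t) * Gt z over Gamma_set
   is a vector-valued integral in the weak sense, i.e. tested against all phi in L^2(Omega).
   The boundary condition is part of the domain of A. *)
definition substantial_solution ::
    "'a::euclidean_space set \<Rightarrow> real \<Rightarrow> complex \<Rightarrow> ('a \<Rightarrow> complex) \<Rightarrow> real \<Rightarrow> real \<Rightarrow> real \<Rightarrow>
     ('a \<Rightarrow> complex) \<Rightarrow> (real \<Rightarrow> 'a \<Rightarrow> complex) \<Rightarrow> bool" where
  "substantial_solution \<Omega> \<alpha> \<rho> U T \<theta> \<kappa> G0 G \<longleftrightarrow>
     (AE x in lebesgue_on \<Omega>. G 0 x = G0 x) \<and>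
     (\<exists>Gt.
        (\<forall>z\<in>Gamma_set \<theta> \<kappa>.
           resolvent_eq \<Omega> (\<lambda>x. beta \<rho> U z x powr of_real \<alpha>)
             (\<lambda>x. beta \<rho> U z x powr of_real (\<alpha> - 1) * G0 x) (Gt z)) \<and>
        (\<forall>t\<in>{0<..T}. G t \<in> L2 \<Omega> \<and>
           (\<forall>\<phi>\<in>L2 \<Omega>. has_Gamma_integral \<theta> \<kappa>
              (\<lambda>z. exp (z * of_real t) * l2_inner \<Omega> (Gt z) \<phi>)
              (2 * of_real pi * \<i> * l2_inner \<Omega> (G t) \<phi>))))"

definition bdf2_symbol :: "real \<Rightarrow> real \<Rightarrow> complex \<Rightarrow> complex" where
  "bdf2_symbol \<alpha> \<tau> \<zeta> = (((1 - \<zeta>) + (1 - \<zeta>)\<^sup>2 / 2) / of_real \<tau>) powr of_real \<alpha>"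

definition bdf2_coeff :: "real \<Rightarrow> real \<Rightarrow> nat \<Rightarrow> complex" where
  "bdf2_coeff \<alpha> \<tau> i = fps_nth (fps_expansion (bdf2_symbol \<alpha> \<tau>) 0) i"

lemma bdf2_coeff_sums:
  assumes "\<tau> > 0" and "norm \<zeta> < 1"
  shows "(\<lambda>i. bdf2_coeff \<alpha> \<tau> i * \<zeta> ^ i) sums bdf2_symbol \<alpha> \<tau> \<zeta>"
proof -
  have nonpos: "((1 - w) + (1 - w)\<^sup>2 / 2) / of_real \<tau> \<notin> \<real>\<^sub>\<le>\<^sub>0" if "norm w < 1" for w :: complex
  proof
    assume asm: "((1 - w) + (1 - w)\<^sup>2 / 2) / of_real \<tau> \<in> \<real>\<^sub>\<le>\<^sub>0"
    define a where "a = Re (2 - w)"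
    define b where "b = Im (2 - w)"
    have a: "a > 1"
      using that abs_Re_le_cmod[of w] by (simp add: a_def)
    have eq: "((1 - w) + (1 - w)\<^sup>2 / 2) / of_real \<tau> = of_real (1 / (2 * \<tau>)) * ((2 - w)\<^sup>2 - 1)"
      using assms(1) by (simp add: field_simps power2_eq_square)
    have im: "Im ((2 - w)\<^sup>2) = 2 * a * b" and re: "Re ((2 - w)\<^sup>2) = a\<^sup>2 - b\<^sup>2"
      by (simp_all add: a_def b_def power2_eq_square)
    define c where "c = 1 / (2 * \<tau>)"
    have c: "c > 0" using assms(1) by (simp add: c_def)
    have "of_real c * ((2 - w)\<^sup>2 - 1) \<in> \<real>\<^sub>\<le>\<^sub>0"
      using asm unfolding eq c_def .
    hence "Im (of_real c * ((2 - w)\<^sup>2 - 1)) = 0" and "Re (of_real c * ((2 - w)\<^sup>2 - 1)) \<le> 0"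
      by (simp_all only: complex_nonpos_Reals_iff)
    hence "c * Im ((2 - w)\<^sup>2) = 0" and "c * (Re ((2 - w)\<^sup>2) - 1) \<le> 0"
      by simp_all
    hence "a * b = 0" and *: "a\<^sup>2 - b\<^sup>2 - 1 \<le> 0"
      unfolding im re using c by (simp_all add: mult_le_0_iff)
    hence "a\<^sup>2 \<le> 1" using a by simp
    moreover have "1 < a\<^sup>2" using a by (rule one_less_power) simp
    ultimately show False by linarith
  qed
  have "bdf2_symbol \<alpha> \<tau> holomorphic_on ball 0 1"
    unfolding bdf2_symbol_def using nonpos assms(1)
    by (intro holomorphic_intros) auto
  from holomorphic_power_series[OF this, of \<zeta>] show ?thesis
    using assms(2) by (simp add: bdf2_coeff_def fps_expansion_def)
qed

(* The damping factor exp(- t rho U), acting by multiplication. *)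
definition damp :: "complex \<Rightarrow> ('a \<Rightarrow> complex) \<Rightarrow> real \<Rightarrow> 'a \<Rightarrow> complex" where
  "damp \<rho> U t x = exp (- (of_real t * \<rho> * U x))"

(* In the first step, exp(- t_1 rho U) G^0 is only in L^2(Omega), so the equation holds in the
   dual of D(A): A w acts on v in D(A) by the pairing of w with A v. The boundary
   condition for G^1 is contained in testing against all of D(A). From the second
   step on, Gs n lies in D(A) and the equation holds in L^2(Omega). *)
definition bdf2_solution ::
    "'a::euclidean_space set \<Rightarrow> real \<Rightarrow> complex \<Rightarrow> ('a \<Rightarrow> complex) \<Rightarrow> real \<Rightarrow> nat \<Rightarrow>
     ('a \<Rightarrow> complex) \<Rightarrow> (nat \<Rightarrow> 'a \<Rightarrow> complex) \<Rightarrow> bool" where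
  "bdf2_solution \<Omega> \<alpha> \<rho> U \<tau> N G0 Gs \<longleftrightarrow>
     (AE x in lebesgue_on \<Omega>. Gs 0 x = G0 x) \<and>
     (\<forall>n\<in>{1..N}. Gs n \<in> L2 \<Omega>) \<and>
     (\<forall>v Av. dirichlet_laplacian \<Omega> v Av \<longrightarrow>
        l2_inner \<Omega> (\<lambda>x. bdf2_coeff \<alpha> \<tau> 0 * Gs 1 x) v
        + l2_inner \<Omega> (Gs 1) Av
        + 1/2 * l2_inner \<Omega> (\<lambda>x. damp \<rho> U \<tau> x * Gs 0 x) Av
        = l2_inner \<Omega> (\<lambda>x. damp \<rho> U \<tau> x * bdf2_coeff \<alpha> \<tau> 0 * Gs 0 x) v) \<and>
     (\<forall>n\<in>{2..N}. \<exists>AG. dirichlet_laplacian \<Omega> (Gs n) AG \<and>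
        (AE x in lebesgue_on \<Omega>.
           (\<Sum>i<n. bdf2_coeff \<alpha> \<tau> i * damp \<rho> U (real i * \<tau>) x * Gs (n - i) x) + AG x
           = damp \<rho> U (real n * \<tau>) x * (\<Sum>i<n. bdf2_coeff \<alpha> \<tau> i * Gs 0 x)))"

definition bounded_domain :: "'a::euclidean_space set \<Rightarrow> bool" where
  "bounded_domain \<Omega> \<longleftrightarrow> open \<Omega> \<and> connected \<Omega> \<and> \<Omega> \<noteq> {} \<and> bounded \<Omega>"

end

(* Multiplying by powers of the damping factor w(x) = z e^{-tau rho U(x)} turns the scheme into
   (D(w) + A) sum_n W^n z^n = D(w) (w/(1-w) + w/2) G0 with D = bdf2_symbol, where W^1 = G^1 + e^{-tau rho U} G0 / 2
   and W^n = G^n for n >= 2. Reading off the n-th coefficient and deforming the contour writes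
   W^n as an integral of e^{z t_n} over the part of Gamma in a strip of height 2 pi / tau, the
   integrand being the solution v(z) of (beta_tau^alpha + A) v = beta_tau^alpha tau (w/(1-w) + w/2) G0
   with beta_tau = ((1-w) + (1-w)^2/2) / tau and z replaced by e^{-z tau}. Second-order consistency of the
   symbol gives a difference of order tau^2 |z| from the Laplace transform of G on the contour,
   and integrating tau^2 |z| |e^{z t}| gives tau^2 t^{-2}.

   The resolvent of A plus a complex multiplier m is bounded by 1 / inf Re m as soon as Re m > 0,
   because A is nonnegative. For alpha < 1 and theta near pi/2 this applies to the alpha-th power of
   beta and, by A-stability of the backward difference formula, to that of beta_tau. *)
theory Submission
  imports Defs
begin

section \<open>The space of square integrable functions\<close>

text \<open>The multiplier depends on the space point and does not commute with A, so no
  eigenfunction expansion is at hand; A enters through its accretivity, its symmetry and the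
  solvability of the resolvent equation. Every contour integral is paired with a fixed \<phi> in L2,
  which makes holomorphy, primitives and limits scalar matters; at the end \<phi> is the error
  itself. Two obstacles shape the discrete side. Only N steps are given, so the generating function
  is a polynomial solving the resolvent equation up to order w^(N+1). The exact solution v(z) is
  therefore a separate object, and the n-th step is recovered from it as Re z tends to infinity,
  where the defect is harmless for n \<le> N. Moreover, the consistency estimates need \<tau> small
  against 1/\<kappa> and |\<rho>| |U|. For larger steps \<tau> / t_n is bounded below, so separate
  stability bounds for both solutions suffice. Undoing the shift of the first step costs a term of
  order one, but \<tau>^2 t_n^(-2) = 1 for n = 1.\<close>

lemma L2D:
  assumes "f \<in> L2 \<Omega>"
  shows "f \<in> borel_measurable (lebesgue_on \<Omega>)" "integrable (lebesgue_on \<Omega>) (\<lambda>x. (norm (f x))\<^sup>2)"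
  using assms by (auto simp: L2_def)

lemma L2_dominated:
  assumes "f \<in> borel_measurable (lebesgue_on \<Omega>)" "integrable (lebesgue_on \<Omega>) g"
    "\<And>x. (norm (f x))\<^sup>2 \<le> g x"
  shows "f \<in> L2 \<Omega>"
proof -
  have "integrable (lebesgue_on \<Omega>) (\<lambda>x. (norm (f x))\<^sup>2)"
    by (rule Bochner_Integration.integrable_bound[OF assms(2)])
       (use assms in \<open>auto intro: order_trans[OF assms(3) abs_ge_self]\<close>)
  then show ?thesis using assms by (simp add: L2_def)
qed

lemma L2_zero [simp]: "(\<lambda>x. 0) \<in> L2 \<Omega>"
  by (simp add: L2_def)

lemma norm_add_square_le: "(norm (a + b))\<^sup>2 \<le> 2 * (norm a)\<^sup>2 + 2 * (norm (b::complex))\<^sup>2"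
proof -
  have "(norm (a + b))\<^sup>2 \<le> (norm a + norm b)\<^sup>2"
    by (intro power_mono norm_triangle_ineq) auto
  also have "\<dots> \<le> 2 * (norm a)\<^sup>2 + 2 * (norm b)\<^sup>2"
    using sum_squares_bound[of "norm a" "norm b"] by (simp add: power2_sum)
  finally show ?thesis .
qed

lemma L2_add [simp]:
  assumes "f \<in> L2 \<Omega>" "g \<in> L2 \<Omega>"
  shows "(\<lambda>x. f x + g x) \<in> L2 \<Omega>"
  using assms norm_add_square_le
  by (intro L2_dominated[where g = "\<lambda>x. 2 * (norm (f x))\<^sup>2 + 2 * (norm (g x))\<^sup>2"])
     (auto simp: L2_def)

lemma L2_mult:
  assumes "m \<in> borel_measurable (lebesgue_on \<Omega>)" "\<And>x. norm (m x) \<le> B" "f \<in> L2 \<Omega>"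
  shows "(\<lambda>x. m x * f x) \<in> L2 \<Omega>"
proof (rule L2_dominated[where g = "\<lambda>x. B\<^sup>2 * (norm (f x))\<^sup>2"])
  show "(norm (m x * f x))\<^sup>2 \<le> B\<^sup>2 * (norm (f x))\<^sup>2" for x
    using assms(2)[of x] by (auto simp: norm_mult power_mult_distrib intro!: mult_right_mono power_mono)
qed (use assms in \<open>auto simp: L2_def\<close>)

lemma L2_scale [simp]: "f \<in> L2 \<Omega> \<Longrightarrow> (\<lambda>x. c * f x) \<in> L2 \<Omega>"
  by (rule L2_mult[where B = "norm c"]) auto

lemma L2_uminus [simp]: "f \<in> L2 \<Omega> \<Longrightarrow> (\<lambda>x. - f x) \<in> L2 \<Omega>"
  using L2_scale[of f \<Omega> "-1"] by simp

lemma L2_diff [simp]: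
  "f \<in> L2 \<Omega> \<Longrightarrow> g \<in> L2 \<Omega> \<Longrightarrow> (\<lambda>x. f x - g x) \<in> L2 \<Omega>"
  using L2_add[of f \<Omega> "\<lambda>x. - g x"] by simp

lemma L2_sum [simp]:
  "(\<And>i. i \<in> I \<Longrightarrow> f i \<in> L2 \<Omega>) \<Longrightarrow> (\<lambda>x. \<Sum>i\<in>I. f i x) \<in> L2 \<Omega>"
  by (induction I rule: infinite_finite_induct) auto

lemma l2_inner_integrable [simp]:
  assumes "f \<in> L2 \<Omega>" "g \<in> L2 \<Omega>"
  shows "integrable (lebesgue_on \<Omega>) (\<lambda>x. f x * cnj (g x))"
proof (rule Bochner_Integration.integrable_bound)
  show "integrable (lebesgue_on \<Omega>) (\<lambda>x. (norm (f x))\<^sup>2 + (norm (g x))\<^sup>2)"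
    using assms by (simp add: L2_def)
  show "(\<lambda>x. f x * cnj (g x)) \<in> borel_measurable (lebesgue_on \<Omega>)"
    by (intro borel_measurable_times L2D(1)[OF assms(1)] measurable_compose[OF L2D(1)[OF assms(2)]]
        borel_measurable_continuous_onI continuous_intros)
  have "norm (f x * cnj (g x)) \<le> (norm (f x))\<^sup>2 + (norm (g x))\<^sup>2" for x
    using sum_squares_bound[of "norm (f x)" "norm (g x)"]
      mult_nonneg_nonneg[OF norm_ge_zero norm_ge_zero, of "f x" "g x"]
    unfolding norm_mult complex_mod_cnj by linarith
  then show "AE x in lebesgue_on \<Omega>. norm (f x * cnj (g x)) \<le> norm ((norm (f x))\<^sup>2 + (norm (g x))\<^sup>2)"
    by (auto intro: order_trans)
qed

lemma l2_inner_add_left: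
  "f \<in> L2 \<Omega> \<Longrightarrow> g \<in> L2 \<Omega> \<Longrightarrow> h \<in> L2 \<Omega> \<Longrightarrow>
    l2_inner \<Omega> (\<lambda>x. f x + g x) h = l2_inner \<Omega> f h + l2_inner \<Omega> g h"
  by (simp add: l2_inner_def distrib_right)

lemma l2_inner_diff_left:
  "f \<in> L2 \<Omega> \<Longrightarrow> g \<in> L2 \<Omega> \<Longrightarrow> h \<in> L2 \<Omega> \<Longrightarrow>
    l2_inner \<Omega> (\<lambda>x. f x - g x) h = l2_inner \<Omega> f h - l2_inner \<Omega> g h"
  by (simp add: l2_inner_def left_diff_distrib)

lemma l2_inner_scale_left: "l2_inner \<Omega> (\<lambda>x. c * f x) h = c * l2_inner \<Omega> f h"
  by (simp add: l2_inner_def mult.assoc)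

lemma l2_inner_cnj: "cnj (l2_inner \<Omega> f g) = l2_inner \<Omega> g f"
  unfolding l2_inner_def
  by (subst Bochner_Integration.integral_cnj[symmetric]) (simp add: mult.commute)

lemma l2_inner_add_right:
  "f \<in> L2 \<Omega> \<Longrightarrow> g \<in> L2 \<Omega> \<Longrightarrow> h \<in> L2 \<Omega> \<Longrightarrow>
    l2_inner \<Omega> h (\<lambda>x. f x + g x) = l2_inner \<Omega> h f + l2_inner \<Omega> h g"
  by (simp add: l2_inner_def distrib_left)

lemma l2_inner_scale_right: "l2_inner \<Omega> h (\<lambda>x. c * f x) = cnj c * l2_inner \<Omega> h f"
  using arg_cong[OF l2_inner_scale_left[of \<Omega> c f h], of cnj] by (simp add: l2_inner_cnj)

lemma l2_inner_sum_left:
  "(\<And>i. i \<in> I \<Longrightarrow> f i \<in> L2 \<Omega>) \<Longrightarrow> h \<in> L2 \<Omega> \<Longrightarrow>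
    l2_inner \<Omega> (\<lambda>x. \<Sum>i\<in>I. f i x) h = (\<Sum>i\<in>I. l2_inner \<Omega> (f i) h)"
proof (induction I rule: infinite_finite_induct)
  case (insert i I)
  then show ?case using l2_inner_add_left[of "f i" \<Omega> "\<lambda>x. \<Sum>i\<in>I. f i x" h] by simp
qed (auto simp: l2_inner_def)

lemma l2_inner_sum_right:
  "(\<And>i. i \<in> I \<Longrightarrow> f i \<in> L2 \<Omega>) \<Longrightarrow> h \<in> L2 \<Omega> \<Longrightarrow>
    l2_inner \<Omega> h (\<lambda>x. \<Sum>i\<in>I. f i x) = (\<Sum>i\<in>I. l2_inner \<Omega> h (f i))"
  using arg_cong[OF l2_inner_sum_left[of I f \<Omega> h], of cnj] by (simp add: l2_inner_cnj)

lemma l2_inner_cong_AE: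
  assumes "AE x in lebesgue_on \<Omega>. f x = f' x" "AE x in lebesgue_on \<Omega>. g x = g' x"
    "f \<in> L2 \<Omega>" "f' \<in> L2 \<Omega>" "g \<in> L2 \<Omega>" "g' \<in> L2 \<Omega>"
  shows "l2_inner \<Omega> f g = l2_inner \<Omega> f' g'"
  unfolding l2_inner_def
  by (rule integral_cong_AE) (use assms in \<open>auto intro!: borel_measurable_integrable\<close>)

lemma l2_norm_cong_AE:
  assumes "AE x in lebesgue_on \<Omega>. f x = g x" "f \<in> L2 \<Omega>" "g \<in> L2 \<Omega>"
  shows "l2_norm \<Omega> f = l2_norm \<Omega> g"
  unfolding l2_norm_def
  by (intro arg_cong[of _ _ sqrt] integral_cong_AE)
     (use assms in \<open>auto intro!: borel_measurable_integrable simp: L2_def\<close>)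

lemma l2_norm_nonneg [simp]: "0 \<le> l2_norm \<Omega> f"
  by (simp add: l2_norm_def)

lemma l2_norm_square: "(l2_norm \<Omega> f)\<^sup>2 = (\<integral>x. (norm (f x))\<^sup>2 \<partial>lebesgue_on \<Omega>)"
  by (simp add: l2_norm_def)

lemma l2_inner_self: "l2_inner \<Omega> f f = of_real ((l2_norm \<Omega> f)\<^sup>2)"
proof -
  have "l2_inner \<Omega> f f = (\<integral>x. of_real ((norm (f x))\<^sup>2) \<partial>lebesgue_on \<Omega>)"
    unfolding l2_inner_def complex_norm_square ..
  then show ?thesis unfolding l2_norm_square by (simp only: integral_complex_of_real)
qed

lemma l2_norm_mult_le:
  assumes "m \<in> borel_measurable (lebesgue_on \<Omega>)" "\<And>x. norm (m x) \<le> B" "f \<in> L2 \<Omega>"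
  shows "l2_norm \<Omega> (\<lambda>x. m x * f x) \<le> B * l2_norm \<Omega> f"
proof -
  have B: "0 \<le> B" using assms(2) norm_ge_zero order_trans by blast
  have "(l2_norm \<Omega> (\<lambda>x. m x * f x))\<^sup>2 \<le> (\<integral>x. B\<^sup>2 * (norm (f x))\<^sup>2 \<partial>lebesgue_on \<Omega>)"
    unfolding l2_norm_square
  proof (rule integral_mono)
    show "integrable (lebesgue_on \<Omega>) (\<lambda>x. (norm (m x * f x))\<^sup>2)"
      using L2_mult[OF assms] by (simp add: L2_def)
    show "(norm (m x * f x))\<^sup>2 \<le> B\<^sup>2 * (norm (f x))\<^sup>2" for x
      using assms(2)[of x] by (auto simp: norm_mult power_mult_distrib intro!: mult_right_mono power_mono)
  qed (use assms in \<open>auto simp: L2_def\<close>)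
  also have "\<dots> = (B * l2_norm \<Omega> f)\<^sup>2"
    by (simp add: power_mult_distrib l2_norm_square)
  finally show ?thesis using B by (simp add: power2_le_iff_abs_le)
qed

lemma l2_norm_scale: "l2_norm \<Omega> (\<lambda>x. c * f x) = norm c * l2_norm \<Omega> f"
  by (simp add: l2_norm_def norm_mult power_mult_distrib real_sqrt_mult)

lemma l2_norm_uminus: "l2_norm \<Omega> (\<lambda>x. - f x) = l2_norm \<Omega> f"
  by (simp add: l2_norm_def)

lemma l2_norm_minus_commute: "l2_norm \<Omega> (\<lambda>x. f x - g x) = l2_norm \<Omega> (\<lambda>x. g x - f x)"
  by (simp add: l2_norm_def norm_minus_commute)

lemma l2_norm_add_square:
  assumes "f \<in> L2 \<Omega>" "g \<in> L2 \<Omega>"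
  shows "(l2_norm \<Omega> (\<lambda>x. f x + g x))\<^sup>2 =
    (l2_norm \<Omega> f)\<^sup>2 + 2 * Re (l2_inner \<Omega> f g) + (l2_norm \<Omega> g)\<^sup>2"
proof -
  have "complex_of_real ((l2_norm \<Omega> (\<lambda>x. f x + g x))\<^sup>2) =
     l2_inner \<Omega> f f + (l2_inner \<Omega> f g + cnj (l2_inner \<Omega> f g)) + l2_inner \<Omega> g g"
    unfolding l2_inner_self[symmetric] using assms
    by (simp add: l2_inner_add_left l2_inner_add_right l2_inner_cnj)
  also have "\<dots> = of_real ((l2_norm \<Omega> f)\<^sup>2 + 2 * Re (l2_inner \<Omega> f g) + (l2_norm \<Omega> g)\<^sup>2)"
    by (simp add: l2_inner_self complex_add_cnj)
  finally show ?thesis using of_real_eq_iff by blast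
qed

text \<open>The discriminant argument serves twice: for the Cauchy-Schwarz inequality and, with
  \<open>a = 0\<close>, for the vanishing first variation in the Dirichlet principle.\<close>

lemma quadratic_nonneg_imp:
  fixes a b c :: real
  assumes "\<And>t. 0 \<le> a + 2 * t * b + t\<^sup>2 * c" "0 \<le> c"
  shows "b\<^sup>2 \<le> a * c"
proof (cases "c = 0")
  case True
  have "b = 0"
  proof (rule ccontr)
    assume "b \<noteq> 0"
    \<comment> \<open>This choice turns \<open>a + 2 * t * b\<close> into -1.\<close>
    then show False using assms(1)[of "- (a + 1) / (2 * b)"] True by (simp add: field_simps)
  qed
  with True show ?thesis by simp
next
  case False
  then have "0 < c" using assms(2) by simp
  then show ?thesis using assms(1)[of "- b / c"]
    by (simp add: field_simps power2_eq_square)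
qed

lemma l2_Re_inner_le:
  assumes "f \<in> L2 \<Omega>" "g \<in> L2 \<Omega>"
  shows "\<bar>Re (l2_inner \<Omega> f g)\<bar> \<le> l2_norm \<Omega> f * l2_norm \<Omega> g"
proof -
  have "0 \<le> (l2_norm \<Omega> f)\<^sup>2 + 2 * t * Re (l2_inner \<Omega> f g) + t\<^sup>2 * (l2_norm \<Omega> g)\<^sup>2" for t
    using zero_le_power2[of "l2_norm \<Omega> (\<lambda>x. f x + of_real t * g x)"]
      l2_norm_add_square[of f \<Omega> "\<lambda>x. of_real t * g x"] assms
    by (simp add: l2_inner_scale_right l2_norm_scale power_mult_distrib)
  from quadratic_nonneg_imp[OF this]
  have "(Re (l2_inner \<Omega> f g))\<^sup>2 \<le> (l2_norm \<Omega> f * l2_norm \<Omega> g)\<^sup>2"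
    by (simp add: power_mult_distrib)
  then show ?thesis by (subst (asm) power2_le_iff_abs_le) auto
qed

lemma l2_Cauchy_Schwarz:
  assumes "f \<in> L2 \<Omega>" "g \<in> L2 \<Omega>"
  shows "norm (l2_inner \<Omega> f g) \<le> l2_norm \<Omega> f * l2_norm \<Omega> g"
proof -
  \<comment> \<open>Rotating \<open>f\<close> by a unimodular factor makes the inner product real
    and nonnegative, which reduces the claim to real parts.\<close>
  define c where "c = cis (- Arg (l2_inner \<Omega> f g))"
  have "norm (l2_inner \<Omega> f g) = Re (c * l2_inner \<Omega> f g)"
    unfolding c_def by (subst (2) rcis_cmod_Arg[symmetric]) (simp add: rcis_def cis_mult mult.left_commute)
  also have "\<dots> = Re (l2_inner \<Omega> (\<lambda>x. c * f x) g)"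
    by (simp add: l2_inner_scale_left)
  also have "\<dots> \<le> l2_norm \<Omega> (\<lambda>x. c * f x) * l2_norm \<Omega> g"
    using l2_Re_inner_le[of "\<lambda>x. c * f x" \<Omega> g] assms by simp
  also have "\<dots> = l2_norm \<Omega> f * l2_norm \<Omega> g"
    by (simp add: l2_norm_scale c_def)
  finally show ?thesis .
qed

lemma l2_norm_triangle:
  assumes "f \<in> L2 \<Omega>" "g \<in> L2 \<Omega>"
  shows "l2_norm \<Omega> (\<lambda>x. f x + g x) \<le> l2_norm \<Omega> f + l2_norm \<Omega> g"
proof -
  have "(l2_norm \<Omega> (\<lambda>x. f x + g x))\<^sup>2 \<le> (l2_norm \<Omega> f + l2_norm \<Omega> g)\<^sup>2"
    unfolding l2_norm_add_square[OF assms] using l2_Re_inner_le[OF assms] by (simp add: power2_sum)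
  then show ?thesis by (simp add: power2_le_iff_abs_le)
qed

lemma l2_norm_triangle_diff:
  assumes "f \<in> L2 \<Omega>" "g \<in> L2 \<Omega>"
  shows "l2_norm \<Omega> (\<lambda>x. f x - g x) \<le> l2_norm \<Omega> f + l2_norm \<Omega> g"
  using l2_norm_triangle[of f \<Omega> "\<lambda>x. - g x"] assms by (simp add: l2_norm_uminus)

lemma l2_norm_triangle3:
  assumes "f \<in> L2 \<Omega>" "g \<in> L2 \<Omega>" "h \<in> L2 \<Omega>"
  shows "l2_norm \<Omega> (\<lambda>x. f x - h x) \<le> l2_norm \<Omega> (\<lambda>x. f x - g x) + l2_norm \<Omega> (\<lambda>x. g x - h x)"
  using l2_norm_triangle[of "\<lambda>x. f x - g x" \<Omega> "\<lambda>x. g x - h x"] assms by simp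

lemma l2_norm_sum_le:
  "(\<And>i. i \<in> I \<Longrightarrow> f i \<in> L2 \<Omega>) \<Longrightarrow> l2_norm \<Omega> (\<lambda>x. \<Sum>i\<in>I. f i x) \<le> (\<Sum>i\<in>I. l2_norm \<Omega> (f i))"
proof (induction I rule: infinite_finite_induct)
  case (insert i I)
  then show ?case using l2_norm_triangle[of "f i" \<Omega> "\<lambda>x. \<Sum>i\<in>I. f i x"] by simp
qed (auto simp: l2_norm_def)

lemma l2_norm_eq_0_AE:
  assumes "l2_norm \<Omega> f = 0" "f \<in> L2 \<Omega>"
  shows "AE x in lebesgue_on \<Omega>. f x = 0"
proof -
  have "(\<integral>x. (norm (f x))\<^sup>2 \<partial>lebesgue_on \<Omega>) = 0"
    using assms by (simp flip: l2_norm_square)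
  then show ?thesis
    using integral_nonneg_eq_0_iff_AE[of "lebesgue_on \<Omega>" "\<lambda>x. (norm (f x))\<^sup>2"] L2D[OF assms(2)] by simp
qed

lemma tendsto_l2_inner_left:
  assumes "\<And>k. f k \<in> L2 \<Omega>" "F \<in> L2 \<Omega>" "h \<in> L2 \<Omega>"
    and "(\<lambda>k. l2_norm \<Omega> (\<lambda>x. F x - f k x)) \<longlonglongrightarrow> 0"
  shows "(\<lambda>k. l2_inner \<Omega> (f k) h) \<longlonglongrightarrow> l2_inner \<Omega> F h"
proof -
  have "(\<lambda>k. l2_inner \<Omega> (f k) h - l2_inner \<Omega> F h) \<longlonglongrightarrow> 0"
  proof (rule Lim_null_comparison)
    show "\<forall>\<^sub>F k in sequentially. norm (l2_inner \<Omega> (f k) h - l2_inner \<Omega> F h)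
        \<le> l2_norm \<Omega> (\<lambda>x. F x - f k x) * l2_norm \<Omega> h"
      using assms l2_Cauchy_Schwarz[of "\<lambda>x. F x - f _ x" \<Omega> h]
      by (auto simp: l2_inner_diff_left norm_minus_commute)
    show "(\<lambda>k. l2_norm \<Omega> (\<lambda>x. F x - f k x) * l2_norm \<Omega> h) \<longlonglongrightarrow> 0"
      using tendsto_mult_right[OF assms(4), of "l2_norm \<Omega> h"] by simp
  qed
  then show ?thesis by (simp add: LIM_zero_cancel)
qed

lemma tendsto_l2_inner_right:
  assumes "\<And>k. f k \<in> L2 \<Omega>" "F \<in> L2 \<Omega>" "h \<in> L2 \<Omega>"
    and "(\<lambda>k. l2_norm \<Omega> (\<lambda>x. F x - f k x)) \<longlonglongrightarrow> 0"
  shows "(\<lambda>k. l2_inner \<Omega> h (f k)) \<longlonglongrightarrow> l2_inner \<Omega> h F"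
  using tendsto_cnj[OF tendsto_l2_inner_left[OF assms]] by (simp add: l2_inner_cnj)

lemma l2_norm_diff_tendsto_add:
  assumes "\<And>k. f k \<in> L2 \<Omega>" "F \<in> L2 \<Omega>" "\<And>k. g k \<in> L2 \<Omega>" "G \<in> L2 \<Omega>"
    and "(\<lambda>k. l2_norm \<Omega> (\<lambda>x. F x - f k x)) \<longlonglongrightarrow> 0" "(\<lambda>k. l2_norm \<Omega> (\<lambda>x. G x - g k x)) \<longlonglongrightarrow> 0"
  shows "(\<lambda>k. l2_norm \<Omega> (\<lambda>x. (F x + G x) - (f k x + g k x))) \<longlonglongrightarrow> 0"
proof (rule Lim_null_comparison)
  show "\<forall>\<^sub>F k in sequentially. norm (l2_norm \<Omega> (\<lambda>x. (F x + G x) - (f k x + g k x)))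
      \<le> l2_norm \<Omega> (\<lambda>x. F x - f k x) + l2_norm \<Omega> (\<lambda>x. G x - g k x)"
    using l2_norm_triangle[of "\<lambda>x. F x - f _ x" \<Omega> "\<lambda>x. G x - g _ x"] assms
    by (auto simp: algebra_simps)
  show "(\<lambda>k. l2_norm \<Omega> (\<lambda>x. F x - f k x) + l2_norm \<Omega> (\<lambda>x. G x - g k x)) \<longlonglongrightarrow> 0"
    using tendsto_add[OF assms(5,6)] by simp
qed

text \<open>Riesz-Fischer: a subsequence with geometrically small increments converges almost
  everywhere, and Fatou's lemma turns the Cauchy estimate into a bound for the distance to the
  pointwise limit.\<close>

lemma L2_complete:
  fixes f :: "nat \<Rightarrow> 'a::euclidean_space \<Rightarrow> complex"
  assumes f: "\<And>k. f k \<in> L2 \<Omega>"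
    and Cauchy: "\<And>e. e > 0 \<Longrightarrow> \<exists>N. \<forall>m\<ge>N. \<forall>n\<ge>N. l2_norm \<Omega> (\<lambda>x. f m x - f n x) < e"
  shows "\<exists>g\<in>L2 \<Omega>. (\<lambda>n. l2_norm \<Omega> (\<lambda>x. g x - f n x)) \<longlonglongrightarrow> 0"
proof -
  let ?M = "lebesgue_on \<Omega>"
  have "\<exists>N. \<forall>k. \<forall>m\<ge>N k. \<forall>n\<ge>N k. l2_norm \<Omega> (\<lambda>x. f m x - f n x) < (1/2)^k"
    using Cauchy by (intro choice allI) simp
  then obtain N where N: "\<And>k m n. m \<ge> N k \<Longrightarrow> n \<ge> N k \<Longrightarrow> l2_norm \<Omega> (\<lambda>x. f m x - f n x) < (1/2)^k"
    by blast
  \<comment> \<open>A sum dominates each of its terms, so this one formula gives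
    \<open>N k \<le> r l\<close> for all \<open>k \<le> l\<close>.\<close>
  define r where "r k = (\<Sum>i\<le>k. N i)" for k :: nat
  have r: "N k \<le> r l" if "k \<le> l" for k l
    unfolding r_def using that by (intro member_le_sum) auto
  have meas [measurable]: "f k \<in> borel_measurable ?M" for k
    using L2D(1)[OF f] .
  define a where "a k x = (norm (f (r (Suc k)) x - f (r k) x))\<^sup>2" for k x
  have a_meas [measurable]: "a k \<in> borel_measurable ?M" for k
    unfolding a_def by measurable
  have a_int: "(\<integral>\<^sup>+x. ennreal (a k x) \<partial>?M) \<le> ennreal ((1/4)^k)" for k
  proof -
    have int: "integrable ?M (a k)"
      unfolding a_def using L2D(2)[OF L2_diff[OF f f]] .
    have "(\<integral>\<^sup>+x. ennreal (a k x) \<partial>?M) = ennreal (\<integral>x. a k x \<partial>?M)"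
      by (rule nn_integral_eq_integral[OF int]) (simp add: a_def)
    also have "(\<integral>x. a k x \<partial>?M) = (l2_norm \<Omega> (\<lambda>x. f (r (Suc k)) x - f (r k) x))\<^sup>2"
      unfolding l2_norm_square a_def ..
    also have "\<dots> \<le> ((1/2)^k)\<^sup>2"
      by (intro power_mono less_imp_le[OF N] r) auto
    also have "\<dots> = (1/4)^k"
      by (simp add: power2_eq_square flip: power_mult_distrib)
    finally show ?thesis by (simp add: ennreal_leI)
  qed
  have "(\<integral>\<^sup>+x. (\<Sum>k. ennreal (2^k * a k x)) \<partial>?M) = (\<Sum>k. \<integral>\<^sup>+x. ennreal (2^k * a k x) \<partial>?M)"
    by (rule nn_integral_suminf) measurable
  also have "\<dots> \<le> (\<Sum>k. ennreal ((1/2)^k))"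
  proof (rule suminf_le)
    fix k
    have "(\<integral>\<^sup>+x. ennreal (2^k * a k x) \<partial>?M) = ennreal (2^k) * (\<integral>\<^sup>+x. ennreal (a k x) \<partial>?M)"
      by (simp add: ennreal_mult a_def nn_integral_cmult)
    also have "\<dots> \<le> ennreal (2^k) * ennreal ((1/4)^k)"
      by (intro mult_left_mono a_int) auto
    also have "\<dots> = ennreal (2^k * (1/4)^k)"
      by (rule ennreal_mult[symmetric]) auto
    also have "2^k * (1/4)^k = (1/2::real)^k"
      unfolding power_mult_distrib[symmetric] by simp
    finally show "(\<integral>\<^sup>+x. ennreal (2^k * a k x) \<partial>?M) \<le> ennreal ((1/2)^k)" .
  qed auto
  also have "\<dots> = ennreal 2"
  proof -
    have "(\<Sum>k. ennreal ((1/2)^k)) = ennreal (\<Sum>k. (1/2)^k)"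
      by (rule suminf_ennreal2) (auto intro: summable_geometric)
    also have "(\<Sum>k. (1/2::real)^k) = 2"
      by (subst suminf_geometric) auto
    finally show ?thesis .
  qed
  finally have "(\<integral>\<^sup>+x. (\<Sum>k. ennreal (2^k * a k x)) \<partial>?M) \<noteq> \<infinity>"
    by (auto simp: top_unique)
  \<comment> \<open>The squared increments have integrals at most 4^(-k); the weight 2^k keeps the
    series integrable. Where the weighted series is finite, it forces the increments below a
    constant times 2^(-k/2), which is summable.\<close>
  then have "AE x in ?M. (\<Sum>k. ennreal (2^k * a k x)) \<noteq> \<infinity>"
    by (intro nn_integral_noteq_infinite) measurable
  then have conv: "AE x in ?M. convergent (\<lambda>k. f (r k) x)"
  proof eventually_elim
    fix x assume fin: "(\<Sum>k. ennreal (2^k * a k x)) \<noteq> \<infinity>"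
    then obtain C where C: "(\<Sum>k. ennreal (2^k * a k x)) = ennreal C" "0 \<le> C"
      by (cases "(\<Sum>k. ennreal (2^k * a k x))") auto
    have step: "norm (f (r (Suc k)) x - f (r k) x) \<le> sqrt C * (sqrt (1/2))^k" for k
    proof -
      have "(\<Sum>i\<in>{k}. ennreal (2^i * a i x)) \<le> (\<Sum>k. ennreal (2^k * a k x))"
        by (rule sum_le_suminf) auto
      then have "2^k * a k x \<le> C" using C by simp
      then have "(norm (f (r (Suc k)) x - f (r k) x))\<^sup>2 \<le> C * (1/2)^k"
        unfolding a_def by (simp add: field_simps power_divide)
      then have "norm (f (r (Suc k)) x - f (r k) x) \<le> sqrt (C * (1/2)^k)"
        by (rule real_le_rsqrt)
      then show ?thesis by (simp add: real_sqrt_mult real_sqrt_power)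
    qed
    have "summable (\<lambda>k. f (r (Suc k)) x - f (r k) x)"
      by (rule summable_comparison_test'[where N = 0 and g = "\<lambda>k. sqrt C * (sqrt (1/2))^k"])
         (auto intro!: summable_mult summable_geometric step)
    then have "convergent (\<lambda>n. \<Sum>k<n. f (r (Suc k)) x - f (r k) x)"
      by (simp add: summable_iff_convergent)
    then have "convergent (\<lambda>n. (f (r n) x - f (r 0) x) + f (r 0) x)"
      unfolding sum_lessThan_telescope[of "\<lambda>k. f (r k) x"] by (intro convergent_add convergent_const)
    then show "convergent (\<lambda>k. f (r k) x)" by simp
  qed
  define g where "g x = lim (\<lambda>k. f (r k) x)" for x
  have g_meas [measurable]: "g \<in> borel_measurable ?M"
    unfolding g_def by measurable
  \<comment> \<open>Fatou along the subsequence: for \<open>k \<ge> j\<close> both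
    \<open>r k\<close> and \<open>n\<close> lie beyond \<open>N j\<close>, so \<open>f (r k)\<close>
    is within 2^(-j) of \<open>f n\<close>, and so is the limit.\<close>
  have key: "(\<lambda>x. g x - f n x) \<in> L2 \<Omega> \<and> l2_norm \<Omega> (\<lambda>x. g x - f n x) \<le> (1/2)^j"
    if n: "n \<ge> N j" for n j
  proof -
    let ?u = "\<lambda>k x. ennreal ((norm (f (r k) x - f n x))\<^sup>2)"
    have "(\<integral>\<^sup>+x. ennreal ((norm (g x - f n x))\<^sup>2) \<partial>?M) = (\<integral>\<^sup>+x. liminf (\<lambda>k. ?u k x) \<partial>?M)"
    proof (rule nn_integral_cong_AE)
      show "AE x in ?M. ennreal ((norm (g x - f n x))\<^sup>2) = liminf (\<lambda>k. ?u k x)"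
        using conv
      proof eventually_elim
        fix x assume "convergent (\<lambda>k. f (r k) x)"
        then have "(\<lambda>k. f (r k) x) \<longlonglongrightarrow> g x"
          by (simp add: g_def convergent_LIMSEQ_iff)
        then have "(\<lambda>k. ?u k x) \<longlonglongrightarrow> ennreal ((norm (g x - f n x))\<^sup>2)"
          by (intro tendsto_intros)
        then show "ennreal ((norm (g x - f n x))\<^sup>2) = liminf (\<lambda>k. ?u k x)"
          by (intro lim_imp_Liminf[symmetric]) auto
      qed
    qed
    also have "\<dots> \<le> liminf (\<lambda>k. \<integral>\<^sup>+x. ?u k x \<partial>?M)"
      by (rule nn_integral_liminf) measurable
    also have "\<dots> \<le> limsup (\<lambda>k. \<integral>\<^sup>+x. ?u k x \<partial>?M)"
      by (rule Liminf_le_Limsup) simp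
    also have "\<dots> \<le> ennreal ((1/4)^j)"
    proof (rule Limsup_bounded)
      show "\<forall>\<^sub>F k in sequentially. (\<integral>\<^sup>+x. ?u k x \<partial>?M) \<le> ennreal ((1/4)^j)"
        using eventually_ge_at_top[of j]
      proof eventually_elim
        case (elim k)
        have "(\<integral>\<^sup>+x. ?u k x \<partial>?M) = ennreal (\<integral>x. (norm (f (r k) x - f n x))\<^sup>2 \<partial>?M)"
          by (rule nn_integral_eq_integral[OF L2D(2)[OF L2_diff[OF f f]]]) simp
        also have "\<dots> = ennreal ((l2_norm \<Omega> (\<lambda>x. f (r k) x - f n x))\<^sup>2)"
          unfolding l2_norm_square ..
        also have "\<dots> \<le> ennreal (((1/2)^j)\<^sup>2)"
          using elim n using n by (intro ennreal_leI power_mono less_imp_le[OF N] r elim) auto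
        also have "\<dots> = ennreal ((1/4)^j)"
          by (simp add: power2_eq_square flip: power_mult_distrib)
        finally show ?case .
      qed
    qed
    finally have le: "(\<integral>\<^sup>+x. ennreal ((norm (g x - f n x))\<^sup>2) \<partial>?M) \<le> ennreal ((1/4)^j)" .
    have int: "integrable ?M (\<lambda>x. (norm (g x - f n x))\<^sup>2)"
      using le by (intro integrableI_bounded) (auto simp: le_less_trans)
    have "ennreal ((l2_norm \<Omega> (\<lambda>x. g x - f n x))\<^sup>2) \<le> ennreal ((1/4)^j)"
      unfolding l2_norm_square using nn_integral_eq_integral[OF int] le by simp
    then have "(l2_norm \<Omega> (\<lambda>x. g x - f n x))\<^sup>2 \<le> (1/4)^j"
      by simp
    also have "(1/4)^j = ((1/2::real)^j)\<^sup>2"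
      by (simp add: power2_eq_square flip: power_mult_distrib)
    finally have "l2_norm \<Omega> (\<lambda>x. g x - f n x) \<le> (1/2)^j"
      by (simp add: power2_le_iff_abs_le)
    with int show ?thesis by (simp add: L2_def)
  qed
  have "g \<in> L2 \<Omega>"
    using L2_add[OF conjunct1[OF key[OF order_refl]] f, of 0 "N 0"] by simp
  moreover have "(\<lambda>n. l2_norm \<Omega> (\<lambda>x. g x - f n x)) \<longlonglongrightarrow> 0"
  proof (rule LIMSEQ_I)
    fix e :: real assume "0 < e"
    then obtain j where j: "(1/2)^j < e" using real_arch_pow_inv[of e "1/2"] by auto
    show "\<exists>no. \<forall>n\<ge>no. norm (l2_norm \<Omega> (\<lambda>x. g x - f n x) - 0) < e"
      using key[of j] j by (intro exI[of _ "N j"]) force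
  qed
  ultimately show ?thesis by blast
qed

section \<open>Directional derivatives and test functions\<close>

lemma partial_eq: "(f has_derivative f') (at x) \<Longrightarrow> partial b f x = f' b"
  unfolding partial_def using frechet_derivative_at by metis

lemma has_derivative_partial:
  "f differentiable at x \<Longrightarrow> (f has_derivative (\<lambda>h. partial h f x)) (at x)"
  unfolding partial_def using frechet_derivative_works by auto

lemma partial_add:
  "f differentiable at x \<Longrightarrow> g differentiable at x \<Longrightarrow>
    partial b (\<lambda>x. f x + g x) x = partial b f x + partial b g x"
  by (rule partial_eq) (intro has_derivative_add has_derivative_partial)

lemma partial_scale:
  "f differentiable at x \<Longrightarrow> partial b (\<lambda>x. c * f x) x = c * partial b f x"
  by (rule partial_eq) (intro has_derivative_mult_right has_derivative_partial)

lemma C_k_add: "C_k k f \<Longrightarrow> C_k k g \<Longrightarrow> C_k k (\<lambda>x. f x + g x)"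
proof (induction k arbitrary: f g)
  case 0
  then show ?case by (auto intro: continuous_on_add)
next
  case (Suc k)
  then have "partial b (\<lambda>x. f x + g x) = (\<lambda>x. partial b f x + partial b g x)" for b
    by (intro ext partial_add) auto
  with Suc show ?case by simp
qed

lemma C_k_scale: "C_k k f \<Longrightarrow> C_k k (\<lambda>x. c * f x)"
proof (induction k arbitrary: f)
  case 0
  then show ?case by (auto intro: continuous_intros)
next
  case (Suc k)
  then have "partial b (\<lambda>x. c * f x) = (\<lambda>x. c * partial b f x)" for b
    by (intro ext partial_scale) auto
  with Suc show ?case by simp
qed

lemma test_add [simp]:
  assumes "\<phi> \<in> test_functions \<Omega>" "\<psi> \<in> test_functions \<Omega>"
  shows "(\<lambda>x. \<phi> x + \<psi> x) \<in> test_functions \<Omega>"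
proof -
  obtain K L where "compact K" "K \<subseteq> \<Omega>" "\<forall>x. x \<notin> K \<longrightarrow> \<phi> x = 0"
    "compact L" "L \<subseteq> \<Omega>" "\<forall>x. x \<notin> L \<longrightarrow> \<psi> x = 0"
    using assms by (auto simp: test_functions_def)
  then have "\<exists>K. compact K \<and> K \<subseteq> \<Omega> \<and> (\<forall>x. x \<notin> K \<longrightarrow> \<phi> x + \<psi> x = 0)"
    by (intro exI[of _ "K \<union> L"]) auto
  moreover have "C_k k (\<lambda>x. \<phi> x + \<psi> x)" for k
    using assms by (intro C_k_add) (simp_all add: test_functions_def)
  ultimately show ?thesis by (simp add: test_functions_def)
qed

lemma test_scale [simp]:
  assumes "\<phi> \<in> test_functions \<Omega>" shows "(\<lambda>x. c * \<phi> x) \<in> test_functions \<Omega>"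
proof -
  obtain K where "compact K" "K \<subseteq> \<Omega>" "\<forall>x. x \<notin> K \<longrightarrow> \<phi> x = 0"
    using assms by (auto simp: test_functions_def)
  then have "\<exists>K. compact K \<and> K \<subseteq> \<Omega> \<and> (\<forall>x. x \<notin> K \<longrightarrow> c * \<phi> x = 0)"
    by auto
  moreover have "C_k k (\<lambda>x. c * \<phi> x)" for k
    using assms by (intro C_k_scale) (simp add: test_functions_def)
  ultimately show ?thesis by (simp add: test_functions_def)
qed

lemma test_zero [simp]: "(\<lambda>x. 0) \<in> test_functions \<Omega>"
proof -
  have "C_k k (\<lambda>x::'a. 0)" for k
  proof (induction k)
    case (Suc k)
    have "partial b (\<lambda>x::'a. 0) = (\<lambda>x. 0)" for b
      by (rule ext) (rule partial_eq[of _ "\<lambda>x. 0"], simp)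
    with Suc show ?case by simp
  qed simp
  then show ?thesis unfolding test_functions_def by (intro CollectI conjI allI exI[of _ "{}"]) auto
qed

lemma test_differentiable:
  assumes "\<phi> \<in> test_functions \<Omega>" shows "\<phi> differentiable at x"
proof -
  have "C_k (Suc 0) \<phi>" using assms by (auto simp: test_functions_def simp del: C_k.simps)
  then show ?thesis by simp
qed

lemma test_continuous: "\<phi> \<in> test_functions \<Omega> \<Longrightarrow> continuous_on UNIV \<phi>"
  by (auto simp: test_functions_def dest: spec[of _ 0])

lemma partial_eq_0_outside:
  assumes "closed K" "\<And>x. x \<notin> K \<Longrightarrow> f x = 0" "x \<notin> K"
  shows "partial b f x = 0"
proof (rule partial_eq[of _ "\<lambda>h. 0"])
  have "((\<lambda>x. 0) has_derivative (\<lambda>h. 0)) (at x)" by simp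
  then show "(f has_derivative (\<lambda>h. 0)) (at x)"
    by (rule has_derivative_transform_within_open[of _ _ _ _ "- K"]) (use assms in auto)
qed

lemma test_partial [simp]:
  assumes "\<phi> \<in> test_functions \<Omega>" "b \<in> Basis"
  shows "partial b \<phi> \<in> test_functions \<Omega>"
proof -
  obtain K where "compact K" "K \<subseteq> \<Omega>" "\<And>x. x \<notin> K \<Longrightarrow> \<phi> x = 0"
    using assms by (auto simp: test_functions_def)
  moreover have "C_k k (partial b \<phi>)" for k
  proof -
    have "C_k (Suc k) \<phi>" using assms by (auto simp: test_functions_def simp del: C_k.simps)
    then show ?thesis using assms by simp
  qed
  ultimately show ?thesis
    unfolding test_functions_def using partial_eq_0_outside[OF compact_imp_closed[of K], of \<phi> _ b]
    by blast
qed

lemma test_support: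
  assumes "\<phi> \<in> test_functions \<Omega>"
  obtains K where "compact K" "K \<subseteq> \<Omega>" "\<And>x. x \<notin> K \<Longrightarrow> \<phi> x = 0"
  using assms by (auto simp: test_functions_def)

lemma integrable_compact_support:
  fixes h :: "'a::euclidean_space \<Rightarrow> 'b::{banach, second_countable_topology}"
  assumes "continuous_on UNIV h" "compact K" "\<And>x. x \<notin> K \<Longrightarrow> h x = 0"
  shows "integrable lborel h"
proof -
  have "integrable lborel (\<lambda>x. indicator K x *\<^sub>R h x)"
    using borel_integrable_compact[OF assms(2) continuous_on_subset[OF assms(1)]] by simp
  also have "(\<lambda>x. indicator K x *\<^sub>R h x) = h"
    using assms(3) by (auto simp: indicator_def)
  finally show ?thesis .
qed

text \<open>Moves integrals of compactly supported functions from
  \<open>lebesgue_on \<Omega>\<close> to \<open>lborel\<close>, where translation invariance can be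
  applied.\<close>

lemma lebesgue_on_compact_support:
  fixes h :: "'a::euclidean_space \<Rightarrow> 'b::{banach, second_countable_topology}"
  assumes "open \<Omega>" "continuous_on UNIV h" "compact K" "K \<subseteq> \<Omega>" "\<And>x. x \<notin> K \<Longrightarrow> h x = 0"
  shows "integrable (lebesgue_on \<Omega>) h" "integral\<^sup>L (lebesgue_on \<Omega>) h = integral\<^sup>L lborel h"
proof -
  have ind: "(\<lambda>x. indicator \<Omega> x *\<^sub>R h x) = h"
  proof
    show "indicator \<Omega> x *\<^sub>R h x = h x" for x
      using assms(4,5) by (cases "x \<in> \<Omega>") auto
  qed
  have meas: "h \<in> borel_measurable lborel"
    using borel_measurable_continuous_onI[OF assms(2)] by simp
  have \<Omega>: "\<Omega> \<inter> space lebesgue \<in> sets lebesgue" using assms(1) by auto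
  have "integrable lebesgue h"
    using integrable_compact_support[OF assms(2,3,5)] meas integrable_completion by blast
  then show "integrable (lebesgue_on \<Omega>) h"
    unfolding integrable_restrict_space[OF \<Omega>] ind .
  show "integral\<^sup>L (lebesgue_on \<Omega>) h = integral\<^sup>L lborel h"
    unfolding integral_restrict_space[OF \<Omega>] ind by (rule integral_completion[OF meas])
qed

lemma test_L2 [simp]:
  assumes "open \<Omega>" "\<phi> \<in> test_functions \<Omega>"
  shows "\<phi> \<in> L2 \<Omega>"
proof -
  obtain K where K: "compact K" "K \<subseteq> \<Omega>" "\<And>x. x \<notin> K \<Longrightarrow> \<phi> x = 0"
    using assms test_support by blast
  have "\<phi> \<in> borel_measurable (lebesgue_on \<Omega>)"
    using borel_measurable_continuous_onI[OF test_continuous[OF assms(2)]]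
    by (intro measurable_restrict_space1 measurable_completion) simp
  moreover have "integrable (lebesgue_on \<Omega>) (\<lambda>x. (norm (\<phi> x))\<^sup>2)"
    using K test_continuous[OF assms(2)] assms(1)
    by (intro lebesgue_on_compact_support(1)[where K = K] continuous_intros) auto
  ultimately show ?thesis by (simp add: L2_def)
qed

lemma lborel_integral_translate:
  fixes h :: "'a::euclidean_space \<Rightarrow> 'b::{banach, second_countable_topology}"
  assumes "h \<in> borel_measurable borel"
  shows "(\<integral>x. h (c + x) \<partial>lborel) = integral\<^sup>L lborel h"
proof -
  have "integral\<^sup>L lborel h = integral\<^sup>L (distr lborel borel ((+) c)) h"
    by (simp only: lborel_distr_plus)
  also have "\<dots> = (\<integral>x. h (c + x) \<partial>lborel)"
    using assms by (intro integral_distr) auto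
  finally show ?thesis ..
qed

text \<open>The integral of the difference quotients of \<open>h\<close> vanishes by translation invariance.\<close>
lemma integral_partial_eq_0:
  fixes h :: "'a::euclidean_space \<Rightarrow> complex"
  assumes diff: "\<And>x. h differentiable at x" and cont: "continuous_on UNIV (partial b h)"
    and K: "compact K" "\<And>x. x \<notin> K \<Longrightarrow> h x = 0"
  shows "integral\<^sup>L lborel (partial b h) = 0"
proof -
  have hcont: "continuous_on UNIV h"
    using diff differentiable_imp_continuous_within by (auto simp: continuous_on_eq_continuous_within)
  have [measurable]: "h \<in> borel_measurable borel" "partial b h \<in> borel_measurable borel"
    using hcont cont borel_measurable_continuous_onI by blast+
  have hint: "integrable lborel h"
    using integrable_compact_support[OF hcont K] .
  obtain R where R: "K \<subseteq> cball 0 R" "0 < R"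
    using bounded_subset_ballD[OF compact_imp_bounded[OF K(1)], of 0] ball_subset_cball by blast
  have p0: "partial b h x = 0" if "x \<notin> K" for x
    using partial_eq_0_outside[OF compact_imp_closed[OF K(1)], of h] K(2) that by blast
  obtain L where L: "\<And>x. norm (partial b h x) \<le> L" "0 \<le> L"
  proof -
    have "compact (partial b h ` K)"
      using compact_continuous_image[OF continuous_on_subset[OF cont] K(1)] by simp
    then have "bounded (partial b h ` K)" by (rule compact_imp_bounded)
    then obtain L where L: "\<forall>x\<in>K. norm (partial b h x) \<le> L"
      by (auto simp: bounded_iff)
    show ?thesis
    proof (rule that[of "max L 0"])
      show "norm (partial b h x) \<le> max L 0" for x
        using L p0[of x] by (cases "x \<in> K") auto
    qed simp
  qed
  \<comment> \<open>The mean value inequality in direction \<open>b\<close> bounds all difference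
    quotients by the same \<open>L\<close>.\<close>
  have mvt: "norm (h (t *\<^sub>R b + x) - h x) \<le> L * t" if "0 \<le> t" for t x
  proof -
    have "norm (h (t *\<^sub>R b + x) - h (0 *\<^sub>R b + x)) \<le> L * norm (t - 0)"
    proof (rule differentiable_bound[where S = "{0..t}" and f = "\<lambda>t. h (t *\<^sub>R b + x)"
          and f' = "\<lambda>s r. partial (r *\<^sub>R b) h (s *\<^sub>R b + x)"])
      fix s assume "s \<in> {0..t}"
      have "((h \<circ> (\<lambda>t. t *\<^sub>R b + x)) has_derivative (\<lambda>r. partial r h (s *\<^sub>R b + x)) \<circ> (\<lambda>r. r *\<^sub>R b)) (at s within {0..t})"
        by (intro diff_chain_within has_derivative_at_withinI[OF has_derivative_partial[OF diff]])
           (auto intro!: derivative_eq_intros)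
      then show "((\<lambda>t. h (t *\<^sub>R b + x)) has_derivative (\<lambda>r. partial (r *\<^sub>R b) h (s *\<^sub>R b + x))) (at s within {0..t})"
        by (simp add: o_def)
      have lin: "linear (\<lambda>r. partial r h (s *\<^sub>R b + x))"
        using has_derivative_linear[OF has_derivative_partial[OF diff]] .
      show "onorm (\<lambda>r. partial (r *\<^sub>R b) h (s *\<^sub>R b + x)) \<le> L"
      proof (rule onorm_le)
        fix r :: real
        have "partial (r *\<^sub>R b) h (s *\<^sub>R b + x) = r *\<^sub>R partial b h (s *\<^sub>R b + x)"
          using linear_scale[OF lin] .
        then show "norm (partial (r *\<^sub>R b) h (s *\<^sub>R b + x)) \<le> L * norm r"
          using mult_left_mono[OF L(1)[of "s *\<^sub>R b + x"], of "\<bar>r\<bar>"] by (simp add: mult.commute)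
      qed
    qed (use that in auto)
    then show ?thesis using that by simp
  qed
  \<comment> \<open>The step lengths 1/(n+1) are at most 1, so every quotient vanishes outside the
    ball of radius \<open>R + norm b\<close>; together with \<open>L\<close> this ball gives the
    dominating function.\<close>
  define q where "q n x = of_nat (Suc n) * (h ((1 / Suc n) *\<^sub>R b + x) - h x)" for n x
  have "(\<lambda>n. integral\<^sup>L lborel (q n)) \<longlonglongrightarrow> integral\<^sup>L lborel (partial b h)"
  proof (rule integral_dominated_convergence[where w = "\<lambda>x. L * indicator (cball 0 (R + norm b)) x"])
    show "q n \<in> borel_measurable lborel" for n
      unfolding q_def by measurable
    show "integrable lborel (\<lambda>x. L * indicator (cball (0::'a) (R + norm b)) x)"
      by (intro integrable_mult_right integrable_real_indicator) (use emeasure_bounded_finite[OF bounded_cball, of "0::'a" "R + norm b"] in auto)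
    show "AE x in lborel. (\<lambda>n. q n x) \<longlonglongrightarrow> partial b h x"
    proof (rule AE_I2)
      fix x
      have "((\<lambda>t. h (t *\<^sub>R b + x)) has_vector_derivative partial b h x) (at 0)"
      proof -
        have "((h \<circ> (\<lambda>t. t *\<^sub>R b + x)) has_derivative (\<lambda>r. partial r h x) \<circ> (\<lambda>r. r *\<^sub>R b)) (at 0)"
          by (rule diff_chain_at) (auto intro!: derivative_eq_intros has_derivative_partial diff)
        moreover have "(\<lambda>r. partial r h x) \<circ> (\<lambda>r. r *\<^sub>R b) = (\<lambda>r. r *\<^sub>R partial b h x)"
          using linear_scale[OF has_derivative_linear[OF has_derivative_partial[OF diff]]] by auto
        ultimately show ?thesis by (simp add: has_vector_derivative_def o_def)
      qed
      then have "((\<lambda>t. (1 / t) *\<^sub>R (h (t *\<^sub>R b + x) - h x)) \<longlongrightarrow> partial b h x) (at 0)"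
      proof -
        assume "((\<lambda>t. h (t *\<^sub>R b + x)) has_vector_derivative partial b h x) (at 0)"
        then have lim: "((\<lambda>t. norm (h (t *\<^sub>R b + x) - h x - t *\<^sub>R partial b h x) / \<bar>t\<bar>) \<longlongrightarrow> 0) (at 0)"
          by (simp add: has_vector_derivative_def has_derivative_iff_norm)
        have "((\<lambda>t. (1 / t) *\<^sub>R (h (t *\<^sub>R b + x) - h x) - partial b h x) \<longlongrightarrow> 0) (at 0)"
        proof (rule Lim_null_comparison[OF _ lim])
          show "\<forall>\<^sub>F t in at 0. norm ((1 / t) *\<^sub>R (h (t *\<^sub>R b + x) - h x) - partial b h x)
              \<le> norm (h (t *\<^sub>R b + x) - h x - t *\<^sub>R partial b h x) / \<bar>t\<bar>"
            unfolding eventually_at_filter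
          proof (intro always_eventually allI impI)
            fix t :: real assume "t \<noteq> 0"
            then have "(1 / t) *\<^sub>R (h (t *\<^sub>R b + x) - h x) - partial b h x
                = (1 / t) *\<^sub>R (h (t *\<^sub>R b + x) - h x - t *\<^sub>R partial b h x)"
              by (simp add: scaleR_diff_right)
            then show "norm ((1 / t) *\<^sub>R (h (t *\<^sub>R b + x) - h x) - partial b h x)
              \<le> norm (h (t *\<^sub>R b + x) - h x - t *\<^sub>R partial b h x) / \<bar>t\<bar>"
              by simp
          qed
        qed
        then show ?thesis by (rule LIM_zero_cancel)
      qed
      then have "((\<lambda>n. (1 / (1 / Suc n)) *\<^sub>R (h ((1 / Suc n) *\<^sub>R b + x) - h x)) \<longlonglongrightarrow> partial b h x)"
        by (rule filterlim_compose) (use LIMSEQ_Suc[OF lim_inverse_n'] in \<open>auto simp: filterlim_at\<close>)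
      then show "(\<lambda>n. q n x) \<longlonglongrightarrow> partial b h x"
        by (simp add: q_def scaleR_conv_of_real)
    qed
    show "AE x in lborel. norm (q n x) \<le> L * indicator (cball 0 (R + norm b)) x" for n
    proof (rule AE_I2)
      fix x
      show "norm (q n x) \<le> L * indicator (cball 0 (R + norm b)) x"
      proof (cases "x \<in> cball 0 (R + norm b)")
        case True
        have "norm (q n x) = Suc n * norm (h ((1 / Suc n) *\<^sub>R b + x) - h x)"
          unfolding q_def norm_mult norm_of_nat ..
        also have "\<dots> \<le> Suc n * (L * (1 / Suc n))"
          by (intro mult_left_mono mvt) auto
        finally show ?thesis using True by (simp del: of_nat_Suc)
      next
        case False
        then have x: "R + norm b < norm x" by simp
        have "norm ((1 / Suc n) *\<^sub>R b) \<le> norm b"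
          using mult_left_mono[of 1 "1 + real n" "norm b"] by (simp add: divide_le_eq)
        then have "R < norm ((1 / Suc n) *\<^sub>R b + x)"
          using x norm_diff_ineq[of x "(1 / Suc n) *\<^sub>R b"] by (simp add: add.commute)
        moreover have "R < norm x" using x norm_ge_zero[of b] by linarith
        ultimately have "(1 / Suc n) *\<^sub>R b + x \<notin> K" "x \<notin> K"
          using R(1) by (fastforce dest!: subsetD)+
        then show ?thesis using False K(2) by (simp add: q_def)
      qed
    qed
  qed measurable
  moreover have "integral\<^sup>L lborel (q n) = 0" for n
  proof -
    have "integrable (distr lborel borel ((+) ((1 / Suc n) *\<^sub>R b))) h"
      unfolding lborel_distr_plus by (rule hint)
    then have int: "integrable lborel (\<lambda>x. h ((1 / Suc n) *\<^sub>R b + x))"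
      by (subst (asm) integrable_distr_eq) measurable
    show ?thesis
      unfolding q_def using int hint lborel_integral_translate[of h] by simp
  qed
  ultimately show ?thesis
    by (simp add: LIMSEQ_const_iff)
qed

section \<open>The Dirichlet Laplacian\<close>

text \<open>The integral of the derivative of \<phi> times the conjugate of \<psi> vanishes, and the
  product rule splits it; conjugation commutes with real directional derivatives.\<close>

lemma weak_partial_test:
  assumes "open \<Omega>" "\<phi> \<in> test_functions \<Omega>" "b \<in> Basis"
  shows "weak_partial \<Omega> b \<phi> (partial b \<phi>)"
  unfolding weak_partial_def
proof (intro conjI ballI)
  show "partial b \<phi> \<in> L2 \<Omega>" using assms by simp
next
  fix \<psi> assume \<psi>: "\<psi> \<in> test_functions \<Omega>"
  define h where "h x = \<phi> x * cnj (\<psi> x)" for x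
  obtain K where K: "compact K" "K \<subseteq> \<Omega>" "\<And>x. x \<notin> K \<Longrightarrow> \<phi> x = 0"
    using assms(2) test_support by blast
  have h': "(h has_derivative (\<lambda>v. \<phi> x * cnj (partial v \<psi> x) + partial v \<phi> x * cnj (\<psi> x))) (at x)" for x
    unfolding h_def using assms \<psi>
    by (intro has_derivative_mult has_derivative_cnj has_derivative_partial test_differentiable)
  then have ph: "partial b h = (\<lambda>x. \<phi> x * cnj (partial b \<psi> x) + partial b \<phi> x * cnj (\<psi> x))"
    by (intro ext partial_eq)
  have cont: "continuous_on UNIV (partial b h)"
    unfolding ph using assms \<psi> by (intro continuous_intros test_continuous test_partial)
  have "integral\<^sup>L lborel (partial b h) = 0"
    by (rule integral_partial_eq_0[where K = K])
       (use h' cont K in \<open>auto simp: differentiable_def h_def\<close>)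
  moreover have "integral\<^sup>L (lebesgue_on \<Omega>) (partial b h) = integral\<^sup>L lborel (partial b h)"
    by (rule lebesgue_on_compact_support[OF assms(1) cont K(1,2)])
       (rule partial_eq_0_outside[OF compact_imp_closed[OF K(1)]], auto simp: h_def K)
  moreover have "integral\<^sup>L (lebesgue_on \<Omega>) (partial b h) = l2_inner \<Omega> \<phi> (partial b \<psi>) + l2_inner \<Omega> (partial b \<phi>) \<psi>"
    unfolding ph l2_inner_def using assms \<psi> by simp
  ultimately show "l2_inner \<Omega> \<phi> (partial b \<psi>) = - l2_inner \<Omega> (partial b \<phi>) \<psi>"
    by (simp add: eq_neg_iff_add_eq_0)
qed

text \<open>Both sides of the defining identity are continuous for the L2 norm, so a limit of
  classical derivatives is automatically a weak derivative.\<close>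

lemma weak_partial_limit:
  assumes "open \<Omega>" "b \<in> Basis" "u \<in> L2 \<Omega>" "v \<in> L2 \<Omega>" "\<And>k. \<phi> k \<in> test_functions \<Omega>"
    and "(\<lambda>k. l2_norm \<Omega> (\<lambda>x. u x - \<phi> k x)) \<longlonglongrightarrow> 0"
    and "(\<lambda>k. l2_norm \<Omega> (\<lambda>x. v x - partial b (\<phi> k) x)) \<longlonglongrightarrow> 0"
  shows "weak_partial \<Omega> b u v"
  unfolding weak_partial_def
proof (intro conjI ballI)
  fix \<psi> assume \<psi>: "\<psi> \<in> test_functions \<Omega>"
  have "(\<lambda>k. l2_inner \<Omega> (\<phi> k) (partial b \<psi>)) \<longlonglongrightarrow> l2_inner \<Omega> u (partial b \<psi>)"
    using assms \<psi> by (intro tendsto_l2_inner_left) auto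
  moreover have "(\<lambda>k. - l2_inner \<Omega> (partial b (\<phi> k)) \<psi>) \<longlonglongrightarrow> - l2_inner \<Omega> v \<psi>"
    using assms \<psi> by (intro tendsto_minus tendsto_l2_inner_left) auto
  moreover have "l2_inner \<Omega> (\<phi> k) (partial b \<psi>) = - l2_inner \<Omega> (partial b (\<phi> k)) \<psi>" for k
    using weak_partial_test[OF assms(1,5,2), of k] \<psi> by (simp add: weak_partial_def)
  ultimately show "l2_inner \<Omega> u (partial b \<psi>) = - l2_inner \<Omega> v \<psi>"
    using LIMSEQ_unique by simp
qed fact

lemma H1_0_L2: "u \<in> H1_0 \<Omega> \<Longrightarrow> u \<in> L2 \<Omega>"
  by (simp add: H1_0_def)

text \<open>The witnesses hidden in \<open>H1_0\<close>, made explicit so that sums and multiples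
  can be formed on the gradient and on the approximating sequence at once. Weak differentiability is
  replaced by convergence, from which it follows.\<close>

definition H1_0_approx ::
    "'a::euclidean_space set \<Rightarrow> ('a \<Rightarrow> complex) \<Rightarrow> ('a \<Rightarrow> 'a \<Rightarrow> complex) \<Rightarrow> (nat \<Rightarrow> 'a \<Rightarrow> complex) \<Rightarrow> bool" where
  "H1_0_approx \<Omega> u Du \<phi> \<longleftrightarrow> u \<in> L2 \<Omega> \<and> (\<forall>b\<in>Basis. Du b \<in> L2 \<Omega>) \<and>
     (\<forall>k. \<phi> k \<in> test_functions \<Omega>) \<and> (\<lambda>k. l2_norm \<Omega> (\<lambda>x. u x - \<phi> k x)) \<longlonglongrightarrow> 0 \<and>
     (\<forall>b\<in>Basis. (\<lambda>k. l2_norm \<Omega> (\<lambda>x. Du b x - partial b (\<phi> k) x)) \<longlonglongrightarrow> 0)"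

lemma H1_0_approxD:
  assumes "H1_0_approx \<Omega> u Du \<phi>"
  shows "u \<in> L2 \<Omega>" "\<And>b. b \<in> Basis \<Longrightarrow> Du b \<in> L2 \<Omega>" "\<phi> k \<in> test_functions \<Omega>"
    "(\<lambda>k. l2_norm \<Omega> (\<lambda>x. u x - \<phi> k x)) \<longlonglongrightarrow> 0"
    "\<And>b. b \<in> Basis \<Longrightarrow> (\<lambda>k. l2_norm \<Omega> (\<lambda>x. Du b x - partial b (\<phi> k) x)) \<longlonglongrightarrow> 0"
  using assms unfolding H1_0_approx_def by blast+

lemma H1_0_approx_weak_partial:
  assumes "open \<Omega>" "H1_0_approx \<Omega> u Du \<phi>" "b \<in> Basis"
  shows "weak_partial \<Omega> b u (Du b)"
  using weak_partial_limit[OF assms(1,3)] H1_0_approxD[OF assms(2)] assms(3) by blast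

lemma H1_0_iff_approx:
  assumes "open \<Omega>"
  shows "u \<in> H1_0 \<Omega> \<longleftrightarrow> (\<exists>Du \<phi>. H1_0_approx \<Omega> u Du \<phi>)"
proof
  assume "u \<in> H1_0 \<Omega>"
  then show "\<exists>Du \<phi>. H1_0_approx \<Omega> u Du \<phi>"
    unfolding H1_0_def H1_0_approx_def weak_partial_def by blast
next
  assume "\<exists>Du \<phi>. H1_0_approx \<Omega> u Du \<phi>"
  then obtain Du \<phi> where *: "H1_0_approx \<Omega> u Du \<phi>" by blast
  then have "\<forall>b\<in>Basis. weak_partial \<Omega> b u (Du b)"
    using H1_0_approx_weak_partial[OF assms] by blast
  with * show "u \<in> H1_0 \<Omega>"
    unfolding H1_0_def H1_0_approx_def by blast
qed

lemma H1_0_approx_add: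
  assumes \<Omega>: "open \<Omega>" and u: "H1_0_approx \<Omega> u Du \<phi>" and v: "H1_0_approx \<Omega> v Dv \<psi>"
  shows "H1_0_approx \<Omega> (\<lambda>x. u x + v x) (\<lambda>b x. Du b x + Dv b x) (\<lambda>k x. \<phi> k x + \<psi> k x)"
proof -
  have p: "partial b (\<lambda>x. \<phi> k x + \<psi> k x) = (\<lambda>x. partial b (\<phi> k) x + partial b (\<psi> k) x)" for k b
    using H1_0_approxD(3)[OF u] H1_0_approxD(3)[OF v]
    by (intro ext partial_add test_differentiable) auto
  note D = H1_0_approxD[OF u] H1_0_approxD[OF v]
  show ?thesis
    unfolding H1_0_approx_def p using D \<Omega>
    by (intro conjI ballI allI l2_norm_diff_tendsto_add L2_add test_add) auto
qed

lemma H1_0_approx_scale: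
  assumes \<Omega>: "open \<Omega>" and u: "H1_0_approx \<Omega> u Du \<phi>"
  shows "H1_0_approx \<Omega> (\<lambda>x. c * u x) (\<lambda>b x. c * Du b x) (\<lambda>k x. c * \<phi> k x)"
proof -
  have p: "partial b (\<lambda>x. c * \<phi> k x) = (\<lambda>x. c * partial b (\<phi> k) x)" for k b
    using H1_0_approxD(3)[OF u] by (intro ext partial_scale test_differentiable) auto
  have lim: "(\<lambda>k. l2_norm \<Omega> (\<lambda>x. c * F x - c * f k x)) \<longlonglongrightarrow> 0"
    if "(\<lambda>k. l2_norm \<Omega> (\<lambda>x. F x - f k x)) \<longlonglongrightarrow> 0" for F and f :: "nat \<Rightarrow> 'a \<Rightarrow> complex"
    using tendsto_mult_left[OF that, of "norm c"]
    by (simp add: l2_norm_scale flip: right_diff_distrib)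
  show ?thesis
    unfolding H1_0_approx_def p using H1_0_approxD[OF u]
    by (intro conjI ballI allI lim L2_scale test_scale) auto
qed

lemma laplacian_test: "\<phi> \<in> test_functions \<Omega> \<Longrightarrow> open \<Omega> \<Longrightarrow> laplacian \<phi> \<in> L2 \<Omega>"
  unfolding laplacian_def[abs_def] by (intro L2_sum) auto

lemma dirichlet_laplacian_L2:
  assumes "dirichlet_laplacian \<Omega> u f" shows "u \<in> L2 \<Omega>" "f \<in> L2 \<Omega>"
  using assms by (auto simp: dirichlet_laplacian_def H1_0_L2)

lemma dirichlet_laplacian_add:
  assumes \<Omega>: "open \<Omega>" and "dirichlet_laplacian \<Omega> u f" "dirichlet_laplacian \<Omega> v g"
  shows "dirichlet_laplacian \<Omega> (\<lambda>x. u x + v x) (\<lambda>x. f x + g x)"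
proof -
  have "(\<lambda>x. u x + v x) \<in> H1_0 \<Omega>"
    using assms H1_0_approx_add[OF \<Omega>] unfolding dirichlet_laplacian_def H1_0_iff_approx[OF \<Omega>] by blast
  then show ?thesis
    using assms laplacian_test[OF _ \<Omega>] dirichlet_laplacian_L2[OF assms(2)] dirichlet_laplacian_L2[OF assms(3)]
    by (simp add: dirichlet_laplacian_def l2_inner_add_left)
qed

lemma dirichlet_laplacian_scale:
  assumes \<Omega>: "open \<Omega>" and "dirichlet_laplacian \<Omega> u f"
  shows "dirichlet_laplacian \<Omega> (\<lambda>x. c * u x) (\<lambda>x. c * f x)"
proof -
  have "(\<lambda>x. c * u x) \<in> H1_0 \<Omega>"
    using assms H1_0_approx_scale[OF \<Omega>] unfolding dirichlet_laplacian_def H1_0_iff_approx[OF \<Omega>] by blast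
  then show ?thesis
    using assms by (auto simp: dirichlet_laplacian_def l2_inner_scale_left simp flip: mult_minus_right)
qed

lemma dirichlet_laplacian_diff:
  assumes "open \<Omega>" "dirichlet_laplacian \<Omega> u f" "dirichlet_laplacian \<Omega> v g"
  shows "dirichlet_laplacian \<Omega> (\<lambda>x. u x - v x) (\<lambda>x. f x - g x)"
  using dirichlet_laplacian_add[OF assms(1,2) dirichlet_laplacian_scale[OF assms(1,3), of "-1"]] by simp

lemma dirichlet_laplacian_sum:
  assumes "open \<Omega>" "finite I" "I \<noteq> {}" "\<And>i. i \<in> I \<Longrightarrow> dirichlet_laplacian \<Omega> (u i) (f i)"
  shows "dirichlet_laplacian \<Omega> (\<lambda>x. \<Sum>i\<in>I. u i x) (\<lambda>x. \<Sum>i\<in>I. f i x)"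
  using assms(2-) by (induction I rule: finite_ne_induct) (simp_all add: assms(1) dirichlet_laplacian_add)

text \<open>Both sides are continuous in the second argument for the convergence of
  \<open>H1_0_approx\<close>, so Green's formula passes from test functions to their closure. The
  zero boundary values of \<open>v\<close> enter here: no boundary term arises.\<close>

lemma dirichlet_laplacian_weak:
  assumes \<Omega>: "open \<Omega>" and u: "dirichlet_laplacian \<Omega> u f"
    and Du: "\<And>b. b \<in> Basis \<Longrightarrow> weak_partial \<Omega> b u (Du b)" and v: "H1_0_approx \<Omega> v Dv \<psi>"
  shows "l2_inner \<Omega> f v = (\<Sum>b\<in>Basis. l2_inner \<Omega> (Du b) (Dv b))"
proof -
  have L2: "u \<in> L2 \<Omega>" "f \<in> L2 \<Omega>" using dirichlet_laplacian_L2[OF u] .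
  have DuL2: "Du b \<in> L2 \<Omega>" if "b \<in> Basis" for b
    using Du[OF that] by (simp add: weak_partial_def)
  have eq: "l2_inner \<Omega> f \<eta> = (\<Sum>b\<in>Basis. l2_inner \<Omega> (Du b) (partial b \<eta>))"
    if \<eta>: "\<eta> \<in> test_functions \<Omega>" for \<eta>
  proof -
    have "l2_inner \<Omega> f \<eta> = - l2_inner \<Omega> u (\<lambda>x. \<Sum>b\<in>Basis. partial b (partial b \<eta>) x)"
      using u \<eta> unfolding dirichlet_laplacian_def laplacian_def[abs_def] by metis
    also have "\<dots> = - (\<Sum>b\<in>Basis. l2_inner \<Omega> u (partial b (partial b \<eta>)))"
      using \<eta> \<Omega> L2 by (subst l2_inner_sum_right) auto
    also have "\<dots> = (\<Sum>b\<in>Basis. l2_inner \<Omega> (Du b) (partial b \<eta>))"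
      unfolding sum_negf[symmetric]
      by (intro sum.cong refl) (use Du \<eta> in \<open>simp add: weak_partial_def\<close>)
    finally show ?thesis .
  qed
  have "(\<lambda>k. l2_inner \<Omega> f (\<psi> k)) \<longlonglongrightarrow> l2_inner \<Omega> f v"
    using H1_0_approxD[OF v] \<Omega> L2 by (intro tendsto_l2_inner_right) auto
  moreover have "(\<lambda>k. l2_inner \<Omega> f (\<psi> k)) \<longlonglongrightarrow> (\<Sum>b\<in>Basis. l2_inner \<Omega> (Du b) (Dv b))"
    unfolding eq[OF H1_0_approxD(3)[OF v]]
    using H1_0_approxD[OF v] \<Omega> DuL2 by (intro tendsto_sum tendsto_l2_inner_right) auto
  ultimately show ?thesis by (rule LIMSEQ_unique)
qed

lemma dirichlet_laplacian_symmetric: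
  assumes \<Omega>: "open \<Omega>" and "dirichlet_laplacian \<Omega> u f" "dirichlet_laplacian \<Omega> v g"
  shows "l2_inner \<Omega> f v = l2_inner \<Omega> u g"
proof -
  obtain Du \<phi> Dv \<psi> where u: "H1_0_approx \<Omega> u Du \<phi>" and v: "H1_0_approx \<Omega> v Dv \<psi>"
    using assms unfolding dirichlet_laplacian_def H1_0_iff_approx[OF \<Omega>] by blast
  have "l2_inner \<Omega> f v = (\<Sum>b\<in>Basis. l2_inner \<Omega> (Du b) (Dv b))"
    by (rule dirichlet_laplacian_weak[OF assms(1,2) H1_0_approx_weak_partial[OF \<Omega> u] v])
  moreover have "l2_inner \<Omega> g u = (\<Sum>b\<in>Basis. l2_inner \<Omega> (Dv b) (Du b))"
    by (rule dirichlet_laplacian_weak[OF assms(1,3) H1_0_approx_weak_partial[OF \<Omega> v] u])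
  then have "cnj (l2_inner \<Omega> g u) = (\<Sum>b\<in>Basis. l2_inner \<Omega> (Du b) (Dv b))"
    by (simp add: l2_inner_cnj)
  ultimately show ?thesis by (simp add: l2_inner_cnj)
qed

text \<open>Taking \<open>v = u\<close> in the weak form leaves the squared norm of the gradient.
  All later resolvent bounds rest on this inequality.\<close>

lemma dirichlet_laplacian_accretive:
  assumes \<Omega>: "open \<Omega>" and "dirichlet_laplacian \<Omega> u f"
  shows "0 \<le> Re (l2_inner \<Omega> f u)"
proof -
  obtain Du \<phi> where u: "H1_0_approx \<Omega> u Du \<phi>"
    using assms unfolding dirichlet_laplacian_def H1_0_iff_approx[OF \<Omega>] by blast
  have "l2_inner \<Omega> f u = (\<Sum>b\<in>Basis. l2_inner \<Omega> (Du b) (Du b))"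
    by (rule dirichlet_laplacian_weak[OF assms(1,2) H1_0_approx_weak_partial[OF \<Omega> u] u])
  also have "Re \<dots> \<ge> 0"
    by (simp add: l2_inner_self sum_nonneg)
  finally show ?thesis .
qed

text \<open>The Dirichlet principle: the solution minimises
  \<open>\<mu> \<parallel>\<phi>\<parallel>\<^sup>2 + \<parallel>\<nabla>\<phi>\<parallel>\<^sup>2 - 2 Re \<langle>f, \<phi>\<rangle>\<close> over the closure of the test functions.\<close>
lemma dirichlet_laplacian_resolvent_real:
  fixes \<Omega> :: "'a::euclidean_space set"
  assumes \<Omega>: "open \<Omega>" and f: "f \<in> L2 \<Omega>" and "0 < (\<mu>::real)"
  shows "\<exists>u. dirichlet_laplacian \<Omega> u (\<lambda>x. f x - of_real \<mu> * u x)"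
proof -
  let ?T = "test_functions \<Omega>"
  \<comment> \<open>\<open>B\<close> is the sesquilinear form of the energy \<open>Q\<close>. The
    gradient of its first argument is passed separately because the limit of the minimising sequence
    will have a weak gradient only.\<close>
  define B where "B u Du \<psi> = of_real \<mu> * l2_inner \<Omega> u \<psi> + (\<Sum>b\<in>Basis. l2_inner \<Omega> (Du b) (partial b \<psi>))"
    for u and Du :: "'a \<Rightarrow> 'a \<Rightarrow> complex" and \<psi>
  define Q where "Q \<phi> = \<mu> * (l2_norm \<Omega> \<phi>)\<^sup>2 + (\<Sum>b\<in>Basis. (l2_norm \<Omega> (partial b \<phi>))\<^sup>2)" for \<phi>
  define J where "J \<phi> = Q \<phi> - 2 * Re (l2_inner \<Omega> f \<phi>)" for \<phi>
  have Q_nonneg: "0 \<le> Q \<phi>" for \<phi>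
    unfolding Q_def using assms by (auto intro!: add_nonneg_nonneg sum_nonneg)
  have p_add: "partial b (\<lambda>x. \<phi> x + \<psi> x) = (\<lambda>x. partial b \<phi> x + partial b \<psi> x)"
    if "\<phi> \<in> ?T" "\<psi> \<in> ?T" for \<phi> \<psi> b
    using that by (intro ext partial_add test_differentiable)
  have p_scale: "partial b (\<lambda>x. c * \<phi> x) = (\<lambda>x. c * partial b \<phi> x)" if "\<phi> \<in> ?T" for \<phi> b c
    using that by (intro ext partial_scale test_differentiable)
  have Q_add: "Q (\<lambda>x. \<phi> x + \<psi> x) = Q \<phi> + 2 * Re (B \<phi> (\<lambda>b. partial b \<phi>) \<psi>) + Q \<psi>"
    if "\<phi> \<in> ?T" "\<psi> \<in> ?T" for \<phi> \<psi>
    unfolding Q_def B_def p_add[OF that] using that \<Omega>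
    by (simp add: l2_norm_add_square sum.distrib sum_distrib_left algebra_simps)
  have Q_scale: "Q (\<lambda>x. c * \<phi> x) = (norm c)\<^sup>2 * Q \<phi>" if "\<phi> \<in> ?T" for c \<phi>
    unfolding Q_def p_scale[OF that]
    by (simp add: l2_norm_scale power_mult_distrib sum_distrib_left algebra_simps)
  have B_scale: "B u Du (\<lambda>x. c * \<psi> x) = cnj c * B u Du \<psi>" if "\<psi> \<in> ?T" for u Du c \<psi>
    unfolding B_def p_scale[OF that] by (simp add: l2_inner_scale_right sum_distrib_left algebra_simps)
  have J_add: "J (\<lambda>x. \<phi> x + of_real t * \<psi> x)
      = J \<phi> + 2 * t * Re (B \<phi> (\<lambda>b. partial b \<phi>) \<psi> - l2_inner \<Omega> f \<psi>) + t\<^sup>2 * Q \<psi>"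
    if "\<phi> \<in> ?T" "\<psi> \<in> ?T" for \<phi> \<psi> t
    using that \<Omega> f unfolding J_def
    by (simp add: Q_add Q_scale B_scale l2_inner_add_right l2_inner_scale_right algebra_simps)
  \<comment> \<open>Completing the square in the norm of \<phi>.\<close>
  have J_lower: "- (l2_norm \<Omega> f)\<^sup>2 / \<mu> \<le> J \<phi>" if "\<phi> \<in> ?T" for \<phi>
  proof -
    have "Re (l2_inner \<Omega> f \<phi>) \<le> l2_norm \<Omega> f * l2_norm \<Omega> \<phi>"
      using l2_Re_inner_le[of f \<Omega> \<phi>] that \<Omega> f by auto
    moreover have "\<mu> * (l2_norm \<Omega> \<phi>)\<^sup>2 \<le> Q \<phi>"
      unfolding Q_def by (simp add: sum_nonneg)
    moreover have "0 \<le> \<mu> * (l2_norm \<Omega> \<phi> - l2_norm \<Omega> f / \<mu>)\<^sup>2" using assms by simp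
    moreover have "\<mu> * (l2_norm \<Omega> \<phi> - l2_norm \<Omega> f / \<mu>)\<^sup>2
        = \<mu> * (l2_norm \<Omega> \<phi>)\<^sup>2 - 2 * (l2_norm \<Omega> f * l2_norm \<Omega> \<phi>) + (l2_norm \<Omega> f)\<^sup>2 / \<mu>"
      using assms by (simp add: field_simps power2_eq_square)
    ultimately show ?thesis unfolding J_def by simp
  qed
  define j where "j = Inf (J ` ?T)"
  have bdd: "bdd_below (J ` ?T)"
    using J_lower by (intro bdd_belowI2)
  have j_le: "j \<le> J \<phi>" if "\<phi> \<in> ?T" for \<phi>
    unfolding j_def using bdd that by (intro cINF_lower)
  have ne: "?T \<noteq> {}" using test_zero by blast
  have "\<exists>\<phi>\<in>?T. J \<phi> < j + 1 / Suc k" for k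
    using cInf_lessD[of "J ` ?T" "j + 1 / Suc k"] ne unfolding j_def by auto
  then obtain \<phi> where \<phi>: "\<And>k. \<phi> k \<in> ?T" "\<And>k. J (\<phi> k) < j + 1 / Suc k"
    by metis
  \<comment> \<open>Parallelogram law: with the midpoint \<open>w\<close>, the energy of the
    difference is 2 J(\<phi>_k) + 2 J(\<phi>_l) - 4 J(w), and J(w) \<ge> j. Nearly minimal elements
    are therefore close in energy.\<close>
  have Q_diff: "Q (\<lambda>x. \<phi> k x - \<phi> l x) \<le> 2 / Suc k + 2 / Suc l" for k l
  proof -
    define s d w where "s x = \<phi> k x + \<phi> l x" and "d x = \<phi> k x - \<phi> l x" and "w x = (1/2) * s x" for x
    have s: "s \<in> ?T"
      unfolding s_def[abs_def] using \<phi>(1) by (intro test_add)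
    then have w: "w \<in> ?T"
      unfolding w_def[abs_def] by (rule test_scale)
    have "Q (\<lambda>x. \<phi> k x + (-1) * \<phi> l x) + Q s = 2 * Q (\<phi> k) + 2 * Q (\<phi> l)"
      using Q_add[OF \<phi>(1) \<phi>(1), of k l] Q_add[OF \<phi>(1)[of k] test_scale[OF \<phi>(1)[of l], of "-1"]]
        B_scale[OF \<phi>(1)[of l], of _ _ "-1"] Q_scale[OF \<phi>(1)[of l], of "-1"] by (simp add: s_def[abs_def])
    then have "Q d + Q s = 2 * Q (\<phi> k) + 2 * Q (\<phi> l)" by (simp add: d_def[abs_def])
    moreover have "Q w = Q s / 4"
      unfolding w_def[abs_def] by (subst Q_scale[OF s]) (simp add: power2_eq_square)
    moreover have "l2_inner \<Omega> f w = (1/2) * (l2_inner \<Omega> f (\<phi> k) + l2_inner \<Omega> f (\<phi> l))"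
      unfolding w_def[abs_def] s_def[abs_def]
      using \<phi>(1) f \<Omega> by (subst l2_inner_scale_right, subst l2_inner_add_right) auto
    then have "Re (l2_inner \<Omega> f w) = (Re (l2_inner \<Omega> f (\<phi> k)) + Re (l2_inner \<Omega> f (\<phi> l))) / 2"
      by (simp only: times_complex.sel plus_complex.sel) simp
    moreover note j_le[OF w] \<phi>(2)[of k] \<phi>(2)[of l]
    ultimately have "Q d \<le> 2 / Suc k + 2 / Suc l" unfolding J_def by simp
    then show ?thesis by (simp add: d_def[abs_def])
  qed
  \<comment> \<open>Whatever has its squared distances controlled by the energy converges in L2;
    used for the sequence itself with \<open>c = \<mu>\<close> and for each partial derivative with
    \<open>c = 1\<close>.\<close>
  have conv: "\<exists>G\<in>L2 \<Omega>. (\<lambda>k. l2_norm \<Omega> (\<lambda>x. G x - g k x)) \<longlonglongrightarrow> 0"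
    if g: "\<And>k. g k \<in> L2 \<Omega>" "\<And>k l. c * (l2_norm \<Omega> (\<lambda>x. g k x - g l x))\<^sup>2 \<le> Q (\<lambda>x. \<phi> k x - \<phi> l x)" "0 < c"
    for g :: "nat \<Rightarrow> 'a \<Rightarrow> complex" and c
  proof (rule L2_complete[OF g(1)])
    fix e :: real assume e: "0 < e"
    obtain N where N: "4 / (c * e\<^sup>2) < real N" using reals_Archimedean2 by blast
    show "\<exists>N. \<forall>m\<ge>N. \<forall>n\<ge>N. l2_norm \<Omega> (\<lambda>x. g m x - g n x) < e"
    proof (intro exI[of _ N] allI impI)
      fix m n assume mn: "N \<le> m" "N \<le> n"
      have "0 < 4 / (c * e\<^sup>2)" using e g(3) by simp
      then have N0: "0 < real N" using N by linarith
      have le: "2 / real (Suc i) \<le> 2 / real N" if "N \<le> i" for i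
        using that N0 by (intro divide_left_mono) auto
      have "c * (l2_norm \<Omega> (\<lambda>x. g m x - g n x))\<^sup>2 \<le> 4 / real N"
        using order_trans[OF g(2) Q_diff, of m n] le[OF mn(1)] le[OF mn(2)] by linarith
      also have "\<dots> < c * e\<^sup>2"
        using N N0 e g(3) by (simp add: field_simps)
      finally have "(l2_norm \<Omega> (\<lambda>x. g m x - g n x))\<^sup>2 < e\<^sup>2" using g(3) by simp
      then show "l2_norm \<Omega> (\<lambda>x. g m x - g n x) < e" using e by (simp add: power_less_imp_less_base)
    qed
  qed
  have p_diff: "partial b (\<lambda>x. \<phi> k x - \<phi> l x) = (\<lambda>x. partial b (\<phi> k) x - partial b (\<phi> l) x)" for b k l
    using p_add[OF \<phi>(1)[of k] test_scale[OF \<phi>(1)[of l], of "-1"]] p_scale[OF \<phi>(1)[of l], of b "-1"] by simp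
  have "\<exists>u\<in>L2 \<Omega>. (\<lambda>k. l2_norm \<Omega> (\<lambda>x. u x - \<phi> k x)) \<longlonglongrightarrow> 0"
    by (rule conv[where c = \<mu>]) (use \<phi> \<Omega> assms in \<open>auto simp: Q_def sum_nonneg\<close>)
  then obtain u where u: "u \<in> L2 \<Omega>" "(\<lambda>k. l2_norm \<Omega> (\<lambda>x. u x - \<phi> k x)) \<longlonglongrightarrow> 0" by blast
  have "\<forall>b\<in>Basis. \<exists>v\<in>L2 \<Omega>. (\<lambda>k. l2_norm \<Omega> (\<lambda>x. v x - partial b (\<phi> k) x)) \<longlonglongrightarrow> 0"
  proof (intro ballI conv[where c = 1])
    fix b :: 'a and k l assume b: "b \<in> Basis"
    have "(l2_norm \<Omega> (partial b (\<lambda>x. \<phi> k x - \<phi> l x)))\<^sup>2 \<le> (\<Sum>b\<in>Basis. (l2_norm \<Omega> (partial b (\<lambda>x. \<phi> k x - \<phi> l x)))\<^sup>2)"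
      using b by (intro member_le_sum) auto
    also have "\<dots> \<le> Q (\<lambda>x. \<phi> k x - \<phi> l x)"
      unfolding Q_def using assms by simp
    finally show "1 * (l2_norm \<Omega> (\<lambda>x. partial b (\<phi> k) x - partial b (\<phi> l) x))\<^sup>2 \<le> Q (\<lambda>x. \<phi> k x - \<phi> l x)"
      by (simp add: p_diff)
  qed (use \<phi> \<Omega> in auto)
  then obtain Du where Du: "\<And>b. b \<in> Basis \<Longrightarrow> Du b \<in> L2 \<Omega>"
    "\<And>b. b \<in> Basis \<Longrightarrow> (\<lambda>k. l2_norm \<Omega> (\<lambda>x. Du b x - partial b (\<phi> k) x)) \<longlonglongrightarrow> 0"
    by metis
  have approx: "H1_0_approx \<Omega> u Du \<phi>"
    unfolding H1_0_approx_def using u Du \<phi> by blast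
  \<comment> \<open>Vanishing first variation: \<open>\<phi> n\<close> is minimal up to 1/(n+1), so
    the quadratic in \<open>t\<close> is nonnegative up to that defect, and the limit in
    \<open>n\<close> removes the constant term.\<close>
  have Re_eq: "Re (B u Du \<psi> - l2_inner \<Omega> f \<psi>) = 0" if \<psi>: "\<psi> \<in> ?T" for \<psi>
  proof -
    have lim: "(\<lambda>k. B (\<phi> k) (\<lambda>b. partial b (\<phi> k)) \<psi>) \<longlonglongrightarrow> B u Du \<psi>"
      unfolding B_def using u Du \<phi> \<psi> \<Omega>
      by (intro tendsto_add tendsto_mult tendsto_const tendsto_sum tendsto_l2_inner_left) auto
    have "0 \<le> 0 + 2 * t * Re (B u Du \<psi> - l2_inner \<Omega> f \<psi>) + t\<^sup>2 * Q \<psi>" for t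
    proof (rule LIMSEQ_le_const)
      have "(\<lambda>k. 1 / real (Suc k)) \<longlonglongrightarrow> 0" by (rule LIMSEQ_Suc[OF lim_inverse_n'])
      then show "(\<lambda>k. 1 / real (Suc k) + 2 * t * Re (B (\<phi> k) (\<lambda>b. partial b (\<phi> k)) \<psi> - l2_inner \<Omega> f \<psi>) + t\<^sup>2 * Q \<psi>)
         \<longlonglongrightarrow> 0 + 2 * t * Re (B u Du \<psi> - l2_inner \<Omega> f \<psi>) + t\<^sup>2 * Q \<psi>"
        by (intro tendsto_intros lim)
      show "\<exists>N. \<forall>n\<ge>N. 0 \<le> 1 / real (Suc n) + 2 * t * Re (B (\<phi> n) (\<lambda>b. partial b (\<phi> n)) \<psi> - l2_inner \<Omega> f \<psi>) + t\<^sup>2 * Q \<psi>"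
      proof (intro exI allI impI)
        fix n
        have "j \<le> J (\<lambda>x. \<phi> n x + of_real t * \<psi> x)"
          using \<phi> \<psi> by (intro j_le test_add test_scale)
        then show "0 \<le> 1 / real (Suc n) + 2 * t * Re (B (\<phi> n) (\<lambda>b. partial b (\<phi> n)) \<psi> - l2_inner \<Omega> f \<psi>) + t\<^sup>2 * Q \<psi>"
          using \<phi>(2)[of n] unfolding J_add[OF \<phi>(1) \<psi>] by linarith
      qed
    qed
    from quadratic_nonneg_imp[OF this Q_nonneg] show ?thesis by simp
  qed
  have eq: "B u Du \<psi> = l2_inner \<Omega> f \<psi>" if \<psi>: "\<psi> \<in> ?T" for \<psi>
  proof (rule complex_eqI)
    show "Re (B u Du \<psi>) = Re (l2_inner \<Omega> f \<psi>)" using Re_eq[OF \<psi>] by simp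
    \<comment> \<open>Testing with \<i> \<psi> turns the imaginary part into a real part.\<close>
    show "Im (B u Du \<psi>) = Im (l2_inner \<Omega> f \<psi>)"
      using Re_eq[OF test_scale[OF \<psi>, of \<i>]] by (simp add: B_scale[OF \<psi>] l2_inner_scale_right)
  qed
  have "dirichlet_laplacian \<Omega> u (\<lambda>x. f x - of_real \<mu> * u x)"
    unfolding dirichlet_laplacian_def
  proof (intro conjI ballI)
    show "u \<in> H1_0 \<Omega>" using approx unfolding H1_0_iff_approx[OF \<Omega>] by blast
    fix \<psi> assume \<psi>: "\<psi> \<in> ?T"
    have "- l2_inner \<Omega> u (laplacian \<psi>) = - (\<Sum>b\<in>Basis. l2_inner \<Omega> u (partial b (partial b \<psi>)))"
      unfolding laplacian_def[abs_def] using \<psi> \<Omega> u by (subst l2_inner_sum_right) auto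
    also have "\<dots> = (\<Sum>b\<in>Basis. l2_inner \<Omega> (Du b) (partial b \<psi>))"
      unfolding sum_negf[symmetric]
      by (intro sum.cong refl)
         (use H1_0_approx_weak_partial[OF \<Omega> approx] \<psi> in \<open>simp add: weak_partial_def\<close>)
    also have "\<dots> = l2_inner \<Omega> (\<lambda>x. f x - of_real \<mu> * u x) \<psi>"
      using eq[OF \<psi>] f u \<psi> \<Omega> by (simp add: B_def l2_inner_diff_left l2_inner_scale_left algebra_simps)
    finally show "- l2_inner \<Omega> u (laplacian \<psi>) = l2_inner \<Omega> (\<lambda>x. f x - of_real \<mu> * u x) \<psi>" .
  qed (use f u in auto)
  then show ?thesis by blast
qed

section \<open>The resolvent with a variable multiplier\<close>

lemma resolvent_eq_L2: "resolvent_eq \<Omega> m f u \<Longrightarrow> u \<in> L2 \<Omega>"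
  using dirichlet_laplacian_L2 by (auto simp: resolvent_eq_def)

lemma resolvent_eq_cong_AE:
  assumes "resolvent_eq \<Omega> m f u"
    "AE x in lebesgue_on \<Omega>. m x = m' x" "AE x in lebesgue_on \<Omega>. f x = f' x"
  shows "resolvent_eq \<Omega> m' f' u"
proof -
  obtain Au where Au: "dirichlet_laplacian \<Omega> u Au" "AE x in lebesgue_on \<Omega>. m x * u x + Au x = f x"
    using assms(1) unfolding resolvent_eq_def by blast
  have "AE x in lebesgue_on \<Omega>. m' x * u x + Au x = f' x"
    using Au(2) assms(2,3) by eventually_elim simp
  with Au show ?thesis unfolding resolvent_eq_def by blast
qed

lemma resolvent_eq_diff:
  assumes "open \<Omega>" "resolvent_eq \<Omega> m f u" "resolvent_eq \<Omega> m g v"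
  shows "resolvent_eq \<Omega> m (\<lambda>x. f x - g x) (\<lambda>x. u x - v x)"
proof -
  obtain Au Av where A: "dirichlet_laplacian \<Omega> u Au" "AE x in lebesgue_on \<Omega>. m x * u x + Au x = f x"
    "dirichlet_laplacian \<Omega> v Av" "AE x in lebesgue_on \<Omega>. m x * v x + Av x = g x"
    using assms(2,3) unfolding resolvent_eq_def by blast
  have "AE x in lebesgue_on \<Omega>. m x * (u x - v x) + (Au x - Av x) = f x - g x"
    using A(2,4) by eventually_elim (simp add: algebra_simps)
  with dirichlet_laplacian_diff[OF assms(1) A(1,3)] show ?thesis unfolding resolvent_eq_def by blast
qed

lemma resolvent_eq_scale:
  assumes "open \<Omega>" "resolvent_eq \<Omega> m f u"
  shows "resolvent_eq \<Omega> m (\<lambda>x. c * f x) (\<lambda>x. c * u x)"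
proof -
  obtain Au where A: "dirichlet_laplacian \<Omega> u Au" "AE x in lebesgue_on \<Omega>. m x * u x + Au x = f x"
    using assms(2) unfolding resolvent_eq_def by blast
  have "AE x in lebesgue_on \<Omega>. m x * (c * u x) + c * Au x = c * f x"
    using A(2)
  proof eventually_elim
    fix x assume "m x * u x + Au x = f x"
    then show "m x * (c * u x) + c * Au x = c * f x" by (metis distrib_left mult.left_commute)
  qed
  with dirichlet_laplacian_scale[OF assms(1) A(1)] show ?thesis unfolding resolvent_eq_def by blast
qed

text \<open>The resolvent identity in additive form: the difference of the multipliers moves to the
  right-hand side. This is how solutions for different multipliers are compared.\<close>

lemma resolvent_eq_change_mult:
  assumes "resolvent_eq \<Omega> m f u"
  shows "resolvent_eq \<Omega> m' (\<lambda>x. f x + (m' x - m x) * u x) u"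
proof -
  obtain Au where A: "dirichlet_laplacian \<Omega> u Au" "AE x in lebesgue_on \<Omega>. m x * u x + Au x = f x"
    using assms unfolding resolvent_eq_def by blast
  have "AE x in lebesgue_on \<Omega>. m' x * u x + Au x = f x + (m' x - m x) * u x"
    using A(2) by eventually_elim (simp add: algebra_simps)
  with A show ?thesis unfolding resolvent_eq_def by blast
qed

text \<open>Pair the equation with \<open>u\<close> and take real parts: the term with A is
  nonnegative, and the multiplier contributes at least \<open>c\<close> times the squared norm. The
  argument is pointwise in \<open>m\<close> and hence works although \<open>m\<close> and A do not
  commute. Applied to differences it also gives uniqueness up to null sets.\<close>

lemma resolvent_eq_bound:
  assumes \<Omega>: "open \<Omega>" and m: "m \<in> borel_measurable (lebesgue_on \<Omega>)" "\<And>x. norm (m x) \<le> B" "\<And>x. c \<le> Re (m x)"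
    and f: "f \<in> L2 \<Omega>" and u: "resolvent_eq \<Omega> m f u" and c: "0 < c"
  shows "l2_norm \<Omega> u \<le> l2_norm \<Omega> f / c"
proof -
  obtain Au where A: "dirichlet_laplacian \<Omega> u Au" "AE x in lebesgue_on \<Omega>. m x * u x + Au x = f x"
    using u unfolding resolvent_eq_def by blast
  note L2 = dirichlet_laplacian_L2[OF A(1)]
  have mu: "(\<lambda>x. m x * u x) \<in> L2 \<Omega>" using L2_mult[OF m(1,2) L2(1)] .
  have "l2_inner \<Omega> f u = l2_inner \<Omega> (\<lambda>x. m x * u x + Au x) u"
    using A(2) f L2 mu by (intro l2_inner_cong_AE) auto
  also have "\<dots> = l2_inner \<Omega> (\<lambda>x. m x * u x) u + l2_inner \<Omega> Au u"
    using mu L2 by (intro l2_inner_add_left)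
  finally have "Re (l2_inner \<Omega> (\<lambda>x. m x * u x) u) \<le> Re (l2_inner \<Omega> f u)"
    using dirichlet_laplacian_accretive[OF \<Omega> A(1)] by simp
  also have "\<dots> \<le> l2_norm \<Omega> f * l2_norm \<Omega> u"
    using l2_Re_inner_le[OF f L2(1)] by simp
  finally have le: "Re (l2_inner \<Omega> (\<lambda>x. m x * u x) u) \<le> l2_norm \<Omega> f * l2_norm \<Omega> u" .
  have "c * (l2_norm \<Omega> u)\<^sup>2 = (\<integral>x. c * (norm (u x))\<^sup>2 \<partial>lebesgue_on \<Omega>)"
    by (simp add: l2_norm_square)
  also have "\<dots> \<le> (\<integral>x. Re (m x * u x * cnj (u x)) \<partial>lebesgue_on \<Omega>)"
  proof (rule integral_mono)
    show "integrable (lebesgue_on \<Omega>) (\<lambda>x. Re (m x * u x * cnj (u x)))"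
      using l2_inner_integrable[OF mu L2(1)] by (rule integrable_Re)
    have "m x * u x * cnj (u x) = m x * of_real ((norm (u x))\<^sup>2)" for x
      by (simp only: mult.assoc complex_norm_square)
    then have "Re (m x * u x * cnj (u x)) = Re (m x) * (norm (u x))\<^sup>2" for x
      by (simp only: Re_complex_of_real Im_complex_of_real times_complex.sel mult_zero_right diff_zero)
    then show "c * (norm (u x))\<^sup>2 \<le> Re (m x * u x * cnj (u x))" for x
      using mult_right_mono[OF m(3)[of x], of "(norm (u x))\<^sup>2"] by simp
  qed (use L2D(2)[OF L2(1)] in simp)
  also have "\<dots> = Re (l2_inner \<Omega> (\<lambda>x. m x * u x) u)"
    unfolding l2_inner_def by (rule integral_Re[OF l2_inner_integrable[OF mu L2(1)]])
  finally have "l2_norm \<Omega> u * (c * l2_norm \<Omega> u) \<le> l2_norm \<Omega> u * l2_norm \<Omega> f"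
    using le by (simp add: power2_eq_square mult_ac)
  then have "c * l2_norm \<Omega> u \<le> l2_norm \<Omega> f"
    using l2_norm_nonneg[of \<Omega> u] l2_norm_nonneg[of \<Omega> f] by (cases "l2_norm \<Omega> u = 0") auto
  with c show ?thesis by (simp add: field_simps)
qed

text \<open>With \<open>\<mu> = B\<^sup>2 / c\<close> the multiplier \<open>m - \<mu>\<close> is smaller than \<open>\<mu>\<close>, so that
  \<open>u \<mapsto> (\<mu> + A)\<^sup>-\<^sup>1 (f - (m - \<mu>) u)\<close> is a contraction.\<close>
lemma resolvent_exists:
  fixes \<Omega> :: "'a::euclidean_space set"
  assumes \<Omega>: "open \<Omega>" and m: "m \<in> borel_measurable (lebesgue_on \<Omega>)" "\<And>x. norm (m x) \<le> B" "\<And>x. c \<le> Re (m x)"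
    and f: "f \<in> L2 \<Omega>" and c: "0 < c"
  shows "\<exists>u. resolvent_eq \<Omega> m f u"
proof -
  have cB: "c \<le> B" by (rule order_trans[OF m(3) order_trans[OF complex_Re_le_cmod m(2)]])
  define \<mu> where "\<mu> = B\<^sup>2 / c"
  have B: "0 < B" using cB c by simp
  have \<mu>: "0 < \<mu>" using B c by (simp add: \<mu>_def)
  have B\<mu>: "B \<le> \<mu>" using cB B c by (simp add: \<mu>_def field_simps power2_eq_square)
  \<comment> \<open>Pointwise |m - \<mu>|^2 \<le> B^2 - 2 \<mu> c + \<mu>^2 = \<mu>^2 - B^2;
    multiplied by the norm bound 1/\<mu> of the real resolvent, the root of this is the contraction
    factor.\<close>
  define q where "q = sqrt (\<mu>\<^sup>2 - B\<^sup>2) / \<mu>"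
  have \<mu>B: "0 \<le> \<mu>\<^sup>2 - B\<^sup>2" using B\<mu> B by simp
  have q: "0 \<le> q" "q < 1"
  proof -
    show "0 \<le> q" unfolding q_def using \<mu> \<mu>B by simp
    have "sqrt (\<mu>\<^sup>2 - B\<^sup>2) < sqrt (\<mu>\<^sup>2)" using B by (intro real_sqrt_less_mono) simp
    then show "q < 1" unfolding q_def using \<mu> by simp
  qed
  have m\<mu>: "norm (m x - of_real \<mu>) \<le> q * \<mu>" for x
  proof -
    have "(norm (m x - of_real \<mu>))\<^sup>2 = (norm (m x))\<^sup>2 - 2 * \<mu> * Re (m x) + \<mu>\<^sup>2"
      unfolding cmod_power2 by (simp add: power2_eq_square algebra_simps)
    also have "\<dots> \<le> B\<^sup>2 - 2 * \<mu> * c + \<mu>\<^sup>2"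
      using mult_left_mono[OF m(3)[of x], of "2 * \<mu>"] \<mu> power_mono[OF m(2) norm_ge_zero, of x 2]
      by linarith
    also have "\<dots> = \<mu>\<^sup>2 - B\<^sup>2" using c by (simp add: \<mu>_def)
    finally have "norm (m x - of_real \<mu>) \<le> sqrt (\<mu>\<^sup>2 - B\<^sup>2)" by (rule real_le_rsqrt)
    then show ?thesis using \<mu> by (simp add: q_def)
  qed
  have mm: "(\<lambda>x. m x - of_real \<mu>) \<in> borel_measurable (lebesgue_on \<Omega>)" using m(1) by simp
  define R where "R g = (SOME u. dirichlet_laplacian \<Omega> u (\<lambda>x. g x - of_real \<mu> * u x))" for g
  have R: "dirichlet_laplacian \<Omega> (R g) (\<lambda>x. g x - of_real \<mu> * R g x)" if "g \<in> L2 \<Omega>" for g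
    unfolding R_def by (rule someI_ex[OF dirichlet_laplacian_resolvent_real[OF \<Omega> that \<mu>]])
  define F where "F v x = f x - (m x - of_real \<mu>) * v x" for v x
  have F: "F v \<in> L2 \<Omega>" if "v \<in> L2 \<Omega>" for v
    unfolding F_def[abs_def] using L2_mult[OF mm m\<mu> that] f by (intro L2_diff)
  define T where "T v = R (F v)" for v
  have T_L2: "T v \<in> L2 \<Omega>" if "v \<in> L2 \<Omega>" for v
    unfolding T_def using dirichlet_laplacian_L2(1)[OF R[OF F[OF that]]] .
  have T_resolvent: "resolvent_eq \<Omega> (\<lambda>x. of_real \<mu>) (F v) (T v)" if "v \<in> L2 \<Omega>" for v
    unfolding resolvent_eq_def T_def using R[OF F[OF that]] by (intro exI conjI) auto
  have contr: "l2_norm \<Omega> (\<lambda>x. T v x - T w x) \<le> q * l2_norm \<Omega> (\<lambda>x. v x - w x)"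
    if "v \<in> L2 \<Omega>" "w \<in> L2 \<Omega>" for v w
  proof -
    have "l2_norm \<Omega> (\<lambda>x. T v x - T w x) \<le> l2_norm \<Omega> (\<lambda>x. F v x - F w x) / \<mu>"
      by (rule resolvent_eq_bound[where m = "\<lambda>x. of_real \<mu>" and B = \<mu>, OF \<Omega>])
         (use F that \<mu> resolvent_eq_diff[OF \<Omega> T_resolvent T_resolvent] in auto)
    also have "l2_norm \<Omega> (\<lambda>x. F v x - F w x) = l2_norm \<Omega> (\<lambda>x. (m x - of_real \<mu>) * (w x - v x))"
      by (intro arg_cong[of _ _ "l2_norm \<Omega>"]) (auto simp: F_def algebra_simps)
    also have "\<dots> / \<mu> \<le> (q * \<mu>) * l2_norm \<Omega> (\<lambda>x. w x - v x) / \<mu>"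
      using \<mu> that by (intro divide_right_mono l2_norm_mult_le mm m\<mu>) auto
    also have "\<dots> = q * l2_norm \<Omega> (\<lambda>x. v x - w x)"
      using \<mu> l2_norm_minus_commute[of \<Omega> v w] by simp
    finally show ?thesis .
  qed
  define v where "v n = (T ^^ n) (\<lambda>x. 0)" for n
  have v_Suc: "v (Suc n) = T (v n)" for n by (simp add: v_def)
  have v_L2: "v n \<in> L2 \<Omega>" for n
    by (induction n) (auto simp: v_Suc T_L2, simp add: v_def)
  define d where "d = l2_norm \<Omega> (\<lambda>x. v 1 x - v 0 x)"
  \<comment> \<open>The sum of the geometric series d, q d, and so on. As the fixed point of
    \<open>e \<mapsto> q * e + d\<close> it is preserved by the induction below.\<close>
  define E where "E = d / (1 - q)"
  have E: "0 \<le> E" "q * E + d = E"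
    using q by (auto simp: E_def d_def field_simps)
  have step0: "l2_norm \<Omega> (\<lambda>x. v p x - v 0 x) \<le> E" for p
  proof (induction p)
    case 0 then show ?case using E by (simp add: l2_norm_def)
  next
    case (Suc p)
    have "l2_norm \<Omega> (\<lambda>x. v (Suc p) x - v 0 x) \<le>
        l2_norm \<Omega> (\<lambda>x. v (Suc p) x - v (Suc 0) x) + l2_norm \<Omega> (\<lambda>x. v (Suc 0) x - v 0 x)"
      by (intro l2_norm_triangle3 v_L2)
    also have "\<dots> \<le> q * l2_norm \<Omega> (\<lambda>x. v p x - v 0 x) + d"
      using contr[OF v_L2 v_L2, of p 0] by (simp add: v_Suc d_def)
    also have "\<dots> \<le> q * E + d"
      using Suc q by (simp add: mult_left_mono)
    finally show ?case using E by simp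
  qed
  have step: "l2_norm \<Omega> (\<lambda>x. v (n + p) x - v n x) \<le> q ^ n * E" for n p
  proof (induction n)
    case 0 then show ?case using step0 by simp
  next
    case (Suc n)
    have "l2_norm \<Omega> (\<lambda>x. v (Suc n + p) x - v (Suc n) x) \<le> q * l2_norm \<Omega> (\<lambda>x. v (n + p) x - v n x)"
      using contr[OF v_L2 v_L2, of "n + p" n] by (simp add: v_Suc)
    also have "\<dots> \<le> q * (q ^ n * E)" using Suc q by (intro mult_left_mono)
    finally show ?case by (simp add: mult.assoc)
  qed
  have "\<exists>u\<in>L2 \<Omega>. (\<lambda>n. l2_norm \<Omega> (\<lambda>x. u x - v n x)) \<longlonglongrightarrow> 0"
  proof (rule L2_complete[OF v_L2])
    fix e :: real assume e: "0 < e"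
    have "(\<lambda>n. q ^ n * E) \<longlonglongrightarrow> 0"
      using tendsto_mult_right[OF LIMSEQ_realpow_zero[OF q], of E] by simp
    then obtain N where N: "\<And>n. n \<ge> N \<Longrightarrow> q ^ n * E < e"
      using e order_tendstoD(2)[of _ 0 sequentially e] unfolding eventually_sequentially by blast
    show "\<exists>N. \<forall>m\<ge>N. \<forall>n\<ge>N. l2_norm \<Omega> (\<lambda>x. v m x - v n x) < e"
    proof (intro exI[of _ N] allI impI)
      fix k n assume kn: "N \<le> k" "N \<le> n"
      show "l2_norm \<Omega> (\<lambda>x. v k x - v n x) < e"
      proof (cases "n \<le> k")
        case True
        then show ?thesis using step[of n "k - n"] N[OF kn(2)] by simp
      next
        case False
        then show ?thesis using step[of k "n - k"] N[OF kn(1)] l2_norm_minus_commute[of \<Omega> "v k" "v n"] by simp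
      qed
    qed
  qed
  then obtain u where u: "u \<in> L2 \<Omega>" and lim: "(\<lambda>n. l2_norm \<Omega> (\<lambda>x. u x - v n x)) \<longlonglongrightarrow> 0" by blast
  have "l2_norm \<Omega> (\<lambda>x. T u x - u x) \<le> 0"
  proof (rule LIMSEQ_le_const)
    show "(\<lambda>n. q * l2_norm \<Omega> (\<lambda>x. u x - v n x) + l2_norm \<Omega> (\<lambda>x. u x - v (Suc n) x)) \<longlonglongrightarrow> 0"
      using tendsto_add[OF tendsto_mult_left[OF lim, of q] LIMSEQ_Suc[OF lim]] by simp
    have "l2_norm \<Omega> (\<lambda>x. T u x - u x) \<le> q * l2_norm \<Omega> (\<lambda>x. u x - v n x) + l2_norm \<Omega> (\<lambda>x. u x - v (Suc n) x)" for n
      using l2_norm_triangle3[OF T_L2[OF u] v_L2[of "Suc n"] u] contr[OF u v_L2[of n]]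
        l2_norm_minus_commute[of \<Omega> u "v (Suc n)"] by (simp add: v_Suc)
    then show "\<exists>N. \<forall>n\<ge>N. l2_norm \<Omega> (\<lambda>x. T u x - u x) \<le> q * l2_norm \<Omega> (\<lambda>x. u x - v n x) + l2_norm \<Omega> (\<lambda>x. u x - v (Suc n) x)"
      by blast
  qed
  \<comment> \<open>The fixed point is reached only up to a null set, so the equation is exhibited
    for \<open>T u\<close>, which lies in the domain of A by construction.\<close>
  then have "l2_norm \<Omega> (\<lambda>x. T u x - u x) = 0" using l2_norm_nonneg by (metis antisym)
  then have AE: "AE x in lebesgue_on \<Omega>. T u x - u x = 0"
    using T_L2[OF u] u by (intro l2_norm_eq_0_AE) auto
  have "AE x in lebesgue_on \<Omega>. F u x + (m x - of_real \<mu>) * T u x = f x"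
    using AE by eventually_elim (simp add: F_def)
  then have "resolvent_eq \<Omega> m f (T u)"
    using resolvent_eq_cong_AE[OF resolvent_eq_change_mult[OF T_resolvent[OF u], of m]] by simp
  then show ?thesis by blast
qed

section \<open>Holomorphic dependence of resolvent solutions on a parameter\<close>

lemma holomorphic_second_order_bound:
  assumes f: "f holomorphic_on S" and S: "cball z0 (3 * r) \<subseteq> S" and r: "0 < r" and B: "\<And>z. z \<in> S \<Longrightarrow> norm (f z) \<le> B"
    and z: "norm (z - z0) \<le> r"
  shows "norm (deriv f z0) \<le> B / r"
    and "norm (f z - f z0 - (z - z0) * deriv f z0) \<le> 2 * B / r\<^sup>2 * (norm (z - z0))\<^sup>2"
proof -
  have hol: "f holomorphic_on ball z0 (3 * r)"
    using f S by (meson ball_subset_cball holomorphic_on_subset order_trans)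
  \<comment> \<open>Discs of radius \<open>r\<close> around points of \<open>cball z0 r\<close> stay
    inside \<open>S\<close>, so Cauchy's estimates have constants depending on \<open>B\<close> and
    \<open>r\<close> alone. The uniformity matters because \<open>f\<close> will carry the space
    point as a parameter.\<close>
  have cauchy: "norm ((deriv ^^ n) f w) \<le> fact n * B / r ^ n" if "w \<in> cball z0 r" for n w
  proof (rule Cauchy_inequality)
    have sub: "cball w r \<subseteq> S"
    proof
      fix y assume "y \<in> cball w r"
      then have "y \<in> cball z0 (3 * r)" using that dist_triangle[of z0 y w] r by auto
      with S show "y \<in> S" by blast
    qed
    show "f holomorphic_on ball w r" "continuous_on (cball w r) f"
      using holomorphic_on_subset[OF f] holomorphic_on_imp_continuous_on[OF holomorphic_on_subset[OF f sub]] sub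
        ball_subset_cball[of w r] by blast+
    show "norm (f x) \<le> B" if "norm (w - x) = r" for x
      using that sub by (intro B) (auto simp: dist_norm)
  qed (use r in auto)
  show "norm (deriv f z0) \<le> B / r"
    using cauchy[of z0 1] r by simp
  have "norm ((deriv ^^ 0) f z - (\<Sum>i\<le>1. (deriv ^^ i) f z0 * (z - z0) ^ i / fact i)) \<le> (2 * B / r\<^sup>2) * norm (z - z0) ^ Suc 1 / fact 1"
  proof (rule complex_Taylor[where S = "cball z0 r"])
    fix i x assume x: "x \<in> cball z0 r"
    then have "x \<in> ball z0 (3 * r)" using r by auto
    then have "((deriv ^^ i) f has_field_derivative deriv ((deriv ^^ i) f) x) (at x)"
      using holomorphic_higher_deriv[OF hol] by (intro holomorphic_derivI[where S = "ball z0 (3 * r)"]) auto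
    then show "((deriv ^^ i) f has_field_derivative (deriv ^^ Suc i) f x) (at x within cball z0 r)"
      by (simp add: has_field_derivative_at_within)
  next
    show "norm ((deriv ^^ Suc 1) f x) \<le> 2 * B / r\<^sup>2" if "x \<in> cball z0 r" for x
      using cauchy[OF that, of "Suc 1"] by (simp add: numeral_2_eq_2)
  qed (use z r in \<open>auto simp: dist_norm norm_minus_commute\<close>)
  then show "norm (f z - f z0 - (z - z0) * deriv f z0) \<le> 2 * B / r\<^sup>2 * (norm (z - z0))\<^sup>2"
    by (simp add: power2_eq_square algebra_simps)
qed

text \<open>The derivative is the pointwise limit of difference quotients along one fixed null
  sequence, and each quotient is measurable in \<open>x\<close>.\<close>

lemma deriv_param_measurable:
  fixes m :: "complex \<Rightarrow> 'a \<Rightarrow> complex"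
  assumes S: "open S" "z0 \<in> S" and hol: "\<And>x. (\<lambda>z. m z x) holomorphic_on S"
    and meas: "\<And>z. z \<in> S \<Longrightarrow> m z \<in> borel_measurable M"
  shows "(\<lambda>x. deriv (\<lambda>z. m z x) z0) \<in> borel_measurable M"
proof -
  obtain r where r: "0 < r" "ball z0 r \<subseteq> S" using S openE by blast
  \<comment> \<open>The denominator n + 2 keeps every increment strictly inside the ball of radius
    \<open>r\<close>.\<close>
  define h where "h n = complex_of_real (r / (n + 2))" for n :: nat
  have h: "norm (h n) < r" "h n \<noteq> 0" for n
    using r by (auto simp: h_def norm_divide divide_less_eq simp flip: of_real_add of_nat_add) 
  have h0: "h \<longlonglongrightarrow> 0"
  proof -
    have "(\<lambda>n. r / real (n + 2)) \<longlonglongrightarrow> 0"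
      by (rule LIMSEQ_ignore_initial_segment[OF lim_const_over_n])
    then have "(\<lambda>n. complex_of_real (r / real (n + 2))) \<longlonglongrightarrow> of_real 0"
      by (rule tendsto_of_real)
    then show ?thesis unfolding h_def[abs_def] of_real_0 .
  qed
  have hS: "z0 + h n \<in> S" for n
    using r(2) h(1)[of n] by (auto simp: dist_norm)
  show ?thesis
  proof (rule borel_measurable_LIMSEQ_metric)
    show "(\<lambda>x. (m (z0 + h n) x - m z0 x) / h n) \<in> borel_measurable M" for n
      using meas[OF hS] meas[OF S(2)] by measurable
    fix x
    have "((\<lambda>z. m z x) has_field_derivative deriv (\<lambda>z. m z x) z0) (at z0)"
      using holomorphic_derivI[OF hol S] .
    then have "((\<lambda>h. (m (z0 + h) x - m z0 x) / h) \<longlongrightarrow> deriv (\<lambda>z. m z x) z0) (at 0)"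
      by (simp add: DERIV_def)
    moreover have "filterlim h (at 0) sequentially"
      using h0 h(2) by (auto simp: filterlim_at)
    ultimately show "(\<lambda>n. (m (z0 + h n) x - m z0 x) / h n) \<longlonglongrightarrow> deriv (\<lambda>z. m z x) z0"
      by (rule filterlim_compose)
  qed
qed

text \<open>Differentiating the equation formally suggests the derivative \<open>w\<close>, the
  solution of (m(z0) + A) w = k' g - m' u(z0). The solutions \<open>u z\<close> are determined only
  up to null sets, which the pairing with \<phi> does not see.\<close>

lemma resolvent_holomorphic:
  fixes m k :: "complex \<Rightarrow> 'a::euclidean_space \<Rightarrow> complex"
  assumes \<Omega>: "open \<Omega>" and S: "open S"
    and m: "\<And>x. (\<lambda>z. m z x) holomorphic_on S" "\<And>z. z \<in> S \<Longrightarrow> m z \<in> borel_measurable (lebesgue_on \<Omega>)"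
      "\<And>z x. z \<in> S \<Longrightarrow> norm (m z x) \<le> B" "\<And>z x. z \<in> S \<Longrightarrow> c \<le> Re (m z x)"
    and k: "\<And>x. (\<lambda>z. k z x) holomorphic_on S" "\<And>z. z \<in> S \<Longrightarrow> k z \<in> borel_measurable (lebesgue_on \<Omega>)"
      "\<And>z x. z \<in> S \<Longrightarrow> norm (k z x) \<le> B"
    and c: "0 < c" and g: "g \<in> L2 \<Omega>" and \<phi>: "\<phi> \<in> L2 \<Omega>"
    and u: "\<And>z. z \<in> S \<Longrightarrow> resolvent_eq \<Omega> (m z) (\<lambda>x. k z x * g x) (u z)"
  shows "(\<lambda>z. l2_inner \<Omega> (u z) \<phi>) holomorphic_on S"
proof (rule holomorphic_onI)
  fix z0 assume z0: "z0 \<in> S"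
  obtain R where R: "0 < R" "cball z0 R \<subseteq> S" using S z0 open_contains_cball by blast
  define r where "r = R / 3"
  have r: "0 < r" "cball z0 (3 * r) \<subseteq> S" using R by (auto simp: r_def)
  define m' where "m' x = deriv (\<lambda>z. m z x) z0" for x
  define k' where "k' x = deriv (\<lambda>z. k z x) z0" for x
  have m'_meas: "m' \<in> borel_measurable (lebesgue_on \<Omega>)" and k'_meas: "k' \<in> borel_measurable (lebesgue_on \<Omega>)"
    unfolding m'_def[abs_def] k'_def[abs_def] using deriv_param_measurable[OF S z0] m(1,2) k(1,2) by blast+
  define C where "C = 2 * B / r\<^sup>2"
  define D where "D = B / r"
  have B: "0 \<le> B" using m(3)[OF z0] norm_ge_zero order_trans by blast
  have CD: "0 \<le> C" "0 \<le> D" using B r by (auto simp: C_def D_def)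
  have m'_le: "norm (m' x) \<le> D" and k'_le: "norm (k' x) \<le> D" for x
    unfolding D_def m'_def k'_def
    by (rule holomorphic_second_order_bound(1)[where z = z0, OF m(1) r(2,1) m(3)],
        use r in simp_all)
       (rule holomorphic_second_order_bound(1)[where z = z0, OF k(1) r(2,1) k(3)],
        use r in simp_all)
  have m2: "norm (m z x - m z0 x - (z - z0) * m' x) \<le> C * (norm (z - z0))\<^sup>2"
    and k2: "norm (k z x - k z0 x - (z - z0) * k' x) \<le> C * (norm (z - z0))\<^sup>2" if "norm (z - z0) \<le> r" for z x
    unfolding C_def m'_def k'_def
    using holomorphic_second_order_bound(2)[OF m(1) r(2,1) m(3) that]
      holomorphic_second_order_bound(2)[OF k(1) r(2,1) k(3) that] by auto
  define D1 where "D1 = C * r + D"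
  have D1: "0 \<le> D1" using CD r by (simp add: D1_def)
  have lin: "norm a \<le> D1 * norm h" if "norm (a - h * b) \<le> C * (norm h)\<^sup>2" "norm b \<le> D" "norm h \<le> r" for a b h :: complex
  proof -
    have "norm a \<le> norm (a - h * b) + norm h * norm b"
      using norm_triangle_sub[of a "h * b"] by (simp add: norm_mult)
    also have "\<dots> \<le> C * (norm h * r) + norm h * D"
      using that CD by (intro add_mono mult_left_mono order_trans[OF that(1)]) (auto simp: power2_eq_square intro!: mult_left_mono)
    finally show ?thesis by (simp add: D1_def algebra_simps)
  qed
  have m1: "norm (m z x - m z0 x) \<le> D1 * norm (z - z0)"
    and k1: "norm (k z x - k z0 x) \<le> D1 * norm (z - z0)" if "norm (z - z0) \<le> r" for z x
    using lin[OF m2[OF that] m'_le that] lin[OF k2[OF that] k'_le that] by auto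
  have zS: "z \<in> S" if "norm (z - z0) \<le> r" for z
  proof -
    have "z \<in> cball z0 (3 * r)" using that r by (simp add: dist_norm norm_minus_commute)
    with r show ?thesis by blast
  qed
  define N where "N = l2_norm \<Omega> g"
  have N: "0 \<le> N" by (simp add: N_def)
  have uL2: "u z \<in> L2 \<Omega>" if "z \<in> S" for z using resolvent_eq_L2[OF u[OF that]] .
  have kg: "(\<lambda>x. k z x * g x) \<in> L2 \<Omega>" if "z \<in> S" for z
    using L2_mult[OF k(2)[OF that] k(3)[OF that] g] .
  have u_le: "l2_norm \<Omega> (u z) \<le> B * N / c" if "z \<in> S" for z
  proof -
    have "l2_norm \<Omega> (u z) \<le> l2_norm \<Omega> (\<lambda>x. k z x * g x) / c"
      by (rule resolvent_eq_bound[OF \<Omega> m(2,3,4)[OF that] kg[OF that] u[OF that] c])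
    also have "\<dots> \<le> B * N / c"
      unfolding N_def using l2_norm_mult_le[OF k(2)[OF that] k(3)[OF that] g] c by (intro divide_right_mono) auto
    finally show ?thesis .
  qed
  define P where "P = B * N / c"
  have P: "0 \<le> P" using B N c by (simp add: P_def)
  note u_le = u_le[folded P_def]
  note bound0 = resolvent_eq_bound[OF \<Omega> m(2,3,4)[OF z0] _ _ c]
  \<comment> \<open>Lipschitz continuity of \<open>u\<close> at \<open>z0\<close>; it makes the
    product of h m' with the increment of \<open>u\<close> quadratic in the final remainder.\<close>
  have u_diff: "l2_norm \<Omega> (\<lambda>x. u z x - u z0 x) \<le> D1 * norm (z - z0) * (N + P) / c"
    if z: "norm (z - z0) \<le> r" for z
  proof -
    note zS = zS[OF z]
    have mm: "(\<lambda>x. m z0 x - m z x) \<in> borel_measurable (lebesgue_on \<Omega>)"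
      and kk: "(\<lambda>x. k z x - k z0 x) \<in> borel_measurable (lebesgue_on \<Omega>)"
      using m(2)[OF zS] m(2)[OF z0] k(2)[OF zS] k(2)[OF z0] by measurable
    have mb: "norm (m z0 x - m z x) \<le> D1 * norm (z - z0)" for x
      using m1[OF z, of x] by (simp add: norm_minus_commute)
    have L2s: "(\<lambda>x. (k z x - k z0 x) * g x) \<in> L2 \<Omega>" "(\<lambda>x. (m z0 x - m z x) * u z x) \<in> L2 \<Omega>"
      using L2_mult[OF kk k1[OF z] g] L2_mult[OF mm mb uL2[OF zS]] .
    have "resolvent_eq \<Omega> (m z0) (\<lambda>x. (k z x * g x + (m z0 x - m z x) * u z x) - k z0 x * g x) (\<lambda>x. u z x - u z0 x)"
      by (rule resolvent_eq_diff[OF \<Omega> resolvent_eq_change_mult[OF u[OF zS]] u[OF z0]])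
    also have "(\<lambda>x. (k z x * g x + (m z0 x - m z x) * u z x) - k z0 x * g x)
      = (\<lambda>x. (k z x - k z0 x) * g x + (m z0 x - m z x) * u z x)" by (simp add: algebra_simps)
    finally have "l2_norm \<Omega> (\<lambda>x. u z x - u z0 x)
        \<le> l2_norm \<Omega> (\<lambda>x. (k z x - k z0 x) * g x + (m z0 x - m z x) * u z x) / c"
      by (rule bound0[rotated]) (intro L2_add L2s)
    also have "\<dots> \<le> (l2_norm \<Omega> (\<lambda>x. (k z x - k z0 x) * g x) + l2_norm \<Omega> (\<lambda>x. (m z0 x - m z x) * u z x)) / c"
      using c by (intro divide_right_mono l2_norm_triangle L2s) auto
    also have "\<dots> \<le> (D1 * norm (z - z0) * N + D1 * norm (z - z0) * P) / c"
    proof (intro divide_right_mono add_mono)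
      show "l2_norm \<Omega> (\<lambda>x. (k z x - k z0 x) * g x) \<le> D1 * norm (z - z0) * N"
        unfolding N_def by (rule l2_norm_mult_le[OF kk k1[OF z] g])
      have "l2_norm \<Omega> (\<lambda>x. (m z0 x - m z x) * u z x) \<le> D1 * norm (z - z0) * l2_norm \<Omega> (u z)"
        by (rule l2_norm_mult_le[OF mm mb uL2[OF zS]])
      also have "\<dots> \<le> D1 * norm (z - z0) * P"
        using D1 by (intro mult_left_mono u_le[OF zS]) auto
      finally show "l2_norm \<Omega> (\<lambda>x. (m z0 x - m z x) * u z x) \<le> D1 * norm (z - z0) * P" .
    qed (use c in auto)
    finally show ?thesis by (simp add: algebra_simps)
  qed
  have rhs0: "(\<lambda>x. k' x * g x - m' x * u z0 x) \<in> L2 \<Omega>"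
    by (intro L2_diff L2_mult[OF k'_meas k'_le] L2_mult[OF m'_meas m'_le] g uL2 z0)
  obtain w where w: "resolvent_eq \<Omega> (m z0) (\<lambda>x. k' x * g x - m' x * u z0 x) w"
    using resolvent_exists[OF \<Omega> m(2,3,4)[OF z0] rhs0 c] by blast
  have wL2: "w \<in> L2 \<Omega>" using resolvent_eq_L2[OF w] .
  define E where "E = (C * N + C * P + D * (D1 * (N + P) / c)) / c"
  have key: "l2_norm \<Omega> (\<lambda>x. u z x - u z0 x - (z - z0) * w x) \<le> E * (norm (z - z0))\<^sup>2"
    if z: "norm (z - z0) \<le> r" for z
  proof -
    note zS = zS[OF z]
    define h where "h = z - z0"
    \<comment> \<open>The right-hand side of the equation for u(z) - u(z0) - h w splits into the
      second-order remainders of \<open>k\<close> and \<open>m\<close> and the mixed term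
      \<open>d\<close>; each is O(|h|^2).\<close>
    define a where "a x = (k z x - k z0 x - h * k' x) * g x" for x
    define b where "b x = - (m z x - m z0 x - h * m' x) * u z x" for x
    define d where "d x = - (h * m' x) * (u z x - u z0 x)" for x
    have meas: "(\<lambda>x. k z x - k z0 x - h * k' x) \<in> borel_measurable (lebesgue_on \<Omega>)"
      "(\<lambda>x. - (m z x - m z0 x - h * m' x)) \<in> borel_measurable (lebesgue_on \<Omega>)"
      "(\<lambda>x. - (h * m' x)) \<in> borel_measurable (lebesgue_on \<Omega>)"
      using m(2)[OF zS] m(2)[OF z0] k(2)[OF zS] k(2)[OF z0] m'_meas k'_meas by measurable
    have bd: "norm (k z x - k z0 x - h * k' x) \<le> C * (norm h)\<^sup>2"
      "norm (- (m z x - m z0 x - h * m' x)) \<le> C * (norm h)\<^sup>2"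
      "norm (- (h * m' x)) \<le> norm h * D" for x
      using k2[OF z, of x] m2[OF z, of x] mult_left_mono[OF m'_le[of x], of "norm h"]
      by (auto simp: h_def norm_mult norm_minus_commute)
    have ud: "(\<lambda>x. u z x - u z0 x) \<in> L2 \<Omega>" using uL2[OF zS] uL2[OF z0] by simp
    have L2s: "a \<in> L2 \<Omega>" "b \<in> L2 \<Omega>" "d \<in> L2 \<Omega>"
      unfolding a_def[abs_def] b_def[abs_def] d_def[abs_def]
      using L2_mult[OF meas(1) bd(1) g] L2_mult[OF meas(2) bd(2) uL2[OF zS]] L2_mult[OF meas(3) bd(3) ud] .
    have nb: "l2_norm \<Omega> a \<le> C * (norm h)\<^sup>2 * N" "l2_norm \<Omega> b \<le> C * (norm h)\<^sup>2 * P"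
      "l2_norm \<Omega> d \<le> norm h * D * (D1 * norm h * (N + P) / c)"
    proof -
      show "l2_norm \<Omega> a \<le> C * (norm h)\<^sup>2 * N"
        unfolding a_def[abs_def] N_def by (rule l2_norm_mult_le[OF meas(1) bd(1) g])
      have "l2_norm \<Omega> b \<le> C * (norm h)\<^sup>2 * l2_norm \<Omega> (u z)"
        unfolding b_def[abs_def] by (rule l2_norm_mult_le[OF meas(2) bd(2) uL2[OF zS]])
      also have "\<dots> \<le> C * (norm h)\<^sup>2 * P" using CD by (intro mult_left_mono u_le[OF zS]) auto
      finally show "l2_norm \<Omega> b \<le> C * (norm h)\<^sup>2 * P" .
      have "l2_norm \<Omega> d \<le> norm h * D * l2_norm \<Omega> (\<lambda>x. u z x - u z0 x)"
        unfolding d_def[abs_def] by (rule l2_norm_mult_le[OF meas(3) bd(3) ud])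
      also have "\<dots> \<le> norm h * D * (D1 * norm h * (N + P) / c)"
        using CD u_diff[OF z] unfolding h_def by (intro mult_left_mono) auto
      finally show "l2_norm \<Omega> d \<le> norm h * D * (D1 * norm h * (N + P) / c)" .
    qed
    have "resolvent_eq \<Omega> (m z0) (\<lambda>x. (k z x * g x + (m z0 x - m z x) * u z x) - k z0 x * g x
         - h * (k' x * g x - m' x * u z0 x)) (\<lambda>x. (u z x - u z0 x) - h * w x)"
      by (intro resolvent_eq_diff[OF \<Omega>] resolvent_eq_scale[OF \<Omega>] resolvent_eq_change_mult u zS z0 w)
    also have "(\<lambda>x. (k z x * g x + (m z0 x - m z x) * u z x) - k z0 x * g x - h * (k' x * g x - m' x * u z0 x))
        = (\<lambda>x. (a x + b x) + d x)"
      by (auto simp: a_def b_def d_def algebra_simps)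
    finally have "l2_norm \<Omega> (\<lambda>x. u z x - u z0 x - h * w x) \<le> l2_norm \<Omega> (\<lambda>x. (a x + b x) + d x) / c"
      by (rule bound0[rotated]) (intro L2_add L2s)
    also have "\<dots> \<le> (l2_norm \<Omega> a + l2_norm \<Omega> b + l2_norm \<Omega> d) / c"
      using c l2_norm_triangle[OF L2_add[OF L2s(1,2)] L2s(3)] l2_norm_triangle[OF L2s(1,2)]
      by (intro divide_right_mono) auto
    also have "\<dots> \<le> (C * (norm h)\<^sup>2 * N + C * (norm h)\<^sup>2 * P + norm h * D * (D1 * norm h * (N + P) / c)) / c"
      using c nb by (intro divide_right_mono add_mono) auto
    also have "\<dots> = E * (norm h)\<^sup>2"
      using c by (simp add: E_def field_simps power2_eq_square)
    finally show ?thesis by (simp add: h_def)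
  qed
  have "((\<lambda>z. l2_inner \<Omega> (u z) \<phi>) has_field_derivative l2_inner \<Omega> w \<phi>) (at z0)"
    unfolding has_field_derivative_iff
  proof (rule LIM_zero_cancel, rule Lim_null_comparison)
    show "\<forall>\<^sub>F z in at z0. norm ((l2_inner \<Omega> (u z) \<phi> - l2_inner \<Omega> (u z0) \<phi>) / (z - z0) - l2_inner \<Omega> w \<phi>)
        \<le> E * l2_norm \<Omega> \<phi> * norm (z - z0)"
      unfolding eventually_at
    proof (intro exI[of _ r] conjI ballI impI r(1))
      fix z assume z: "z \<noteq> z0 \<and> dist z z0 < r"
      then have zr: "norm (z - z0) \<le> r" by (simp add: dist_norm)
      have "l2_inner \<Omega> (u z) \<phi> - l2_inner \<Omega> (u z0) \<phi> - (z - z0) * l2_inner \<Omega> w \<phi>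
          = l2_inner \<Omega> (\<lambda>x. u z x - u z0 x - (z - z0) * w x) \<phi>"
        using uL2[OF zS[OF zr]] uL2[OF z0] wL2 \<phi> by (simp add: l2_inner_diff_left l2_inner_scale_left)
      also have "norm \<dots> \<le> l2_norm \<Omega> (\<lambda>x. u z x - u z0 x - (z - z0) * w x) * l2_norm \<Omega> \<phi>"
        using uL2[OF zS[OF zr]] uL2[OF z0] wL2 \<phi> by (intro l2_Cauchy_Schwarz) auto
      also have "\<dots> \<le> E * (norm (z - z0))\<^sup>2 * l2_norm \<Omega> \<phi>"
        using key[OF zr] by (intro mult_right_mono) auto
      finally have *: "norm (l2_inner \<Omega> (u z) \<phi> - l2_inner \<Omega> (u z0) \<phi> - (z - z0) * l2_inner \<Omega> w \<phi>)
          \<le> E * (norm (z - z0))\<^sup>2 * l2_norm \<Omega> \<phi>" .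
      have "(l2_inner \<Omega> (u z) \<phi> - l2_inner \<Omega> (u z0) \<phi>) / (z - z0) - l2_inner \<Omega> w \<phi>
          = (l2_inner \<Omega> (u z) \<phi> - l2_inner \<Omega> (u z0) \<phi> - (z - z0) * l2_inner \<Omega> w \<phi>) / (z - z0)"
        using z by (simp add: field_simps)
      then show "norm ((l2_inner \<Omega> (u z) \<phi> - l2_inner \<Omega> (u z0) \<phi>) / (z - z0) - l2_inner \<Omega> w \<phi>)
        \<le> E * l2_norm \<Omega> \<phi> * norm (z - z0)"
        using * z by (simp add: norm_divide divide_le_eq power2_eq_square mult_ac)
    qed
    show "((\<lambda>z. E * l2_norm \<Omega> \<phi> * norm (z - z0)) \<longlongrightarrow> 0) (at z0)"
      by (rule tendsto_eq_intros refl tendsto_ident_at)+ simp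
  qed
  then show "(\<lambda>z. l2_inner \<Omega> (u z) \<phi>) field_differentiable at z0 within S"
    using field_differentiable_def field_differentiable_at_within by blast
qed

section \<open>Scalar estimates for the second-order backward difference symbol\<close>

text \<open>A power with exponent below 1 contracts arguments, so even a sector slightly wider than
  the right half-plane is mapped strictly inside it. The condition
  \<open>- \<epsilon> * norm b \<le> Re b\<close> means that |Arg b| is at most the angle
  \<open>a0\<close> with \<epsilon> = - cos a0.\<close>

lemma Re_powr_sector:
  fixes \<alpha> :: real
  assumes "0 < \<alpha>" "\<alpha> < 1"
  obtains \<epsilon> c where "0 < \<epsilon>" "\<epsilon> \<le> 1/2" "0 < c"
    "\<And>b. b \<noteq> 0 \<Longrightarrow> - \<epsilon> * norm b \<le> Re b \<Longrightarrow> c * norm b powr \<alpha> \<le> Re (b powr of_real \<alpha>)"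
proof -
  \<comment> \<open>An angle beyond pi/2 with \<alpha> a0 \<le> (pi/2) (1 + \<alpha>)/2 < pi/2. The
    cap 4/3 keeps it at most 2 pi/3, hence \<epsilon> \<le> 1/2.\<close>
  define a0 where "a0 = (pi / 2) * min (4/3) ((1 + \<alpha>) / (2 * \<alpha>))"
  have m: "1 < min (4/3) ((1 + \<alpha>) / (2 * \<alpha>))" using assms by simp
  have a0: "pi / 2 < a0" "a0 \<le> 2 * pi / 3"
    using mult_strict_left_mono[OF m, of "pi/2"] mult_left_mono[of "min (4/3) ((1 + \<alpha>) / (2 * \<alpha>))" "4/3" "pi/2"]
    unfolding a0_def by auto
  have "\<alpha> * a0 \<le> \<alpha> * ((pi / 2) * ((1 + \<alpha>) / (2 * \<alpha>)))"
    unfolding a0_def using assms by (intro mult_left_mono) auto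
  also have "\<dots> = (pi / 2) * ((1 + \<alpha>) / 2)" using assms by simp
  also have "\<dots> < (pi / 2) * 1" using assms by (intro mult_strict_left_mono) auto
  finally have \<alpha>a0: "\<alpha> * a0 < pi / 2" by simp
  define \<epsilon> where "\<epsilon> = - cos a0"
  define c where "c = cos (\<alpha> * a0)"
  have "cos a0 < cos (pi / 2)" using a0 by (subst cos_mono_less_eq) auto
  then have "0 < \<epsilon>" by (simp add: \<epsilon>_def)
  moreover have "cos (2 * pi / 3) \<le> cos a0" using a0 by (subst cos_mono_le_eq) auto
  then have "\<epsilon> \<le> 1/2" using cos_120 by (simp add: \<epsilon>_def)
  moreover have "0 < c" unfolding c_def using \<alpha>a0 a0 assms by (intro cos_gt_zero_pi) (auto intro: less_trans[of _ 0])
  moreover have "c * norm b powr \<alpha> \<le> Re (b powr of_real \<alpha>)" if b: "b \<noteq> 0" "- \<epsilon> * norm b \<le> Re b" for b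
  proof -
    have Reb: "Re b = norm b * cos (Arg b)"
      using arg_cong[OF rcis_cmod_Arg[of b], of Re] by (simp only: Re_rcis)
    then have "norm b * cos a0 \<le> norm b * cos \<bar>Arg b\<bar>"
      using b by (simp add: \<epsilon>_def mult.commute)
    then have "cos a0 \<le> cos \<bar>Arg b\<bar>" using b by simp
    then have Arg: "\<bar>Arg b\<bar> \<le> a0"
      using a0 mpi_less_Arg[of b] Arg_le_pi[of b] by (subst (asm) cos_mono_le_eq) auto
    have "Re (b powr of_real \<alpha>) = exp (\<alpha> * ln (norm b)) * cos (\<alpha> * Arg b)"
      using b by (simp add: powr_def Re_exp Arg_eq_Im_Ln)
    also have "exp (\<alpha> * ln (norm b)) = norm b powr \<alpha>" using b by (simp add: powr_def)
    finally have Re: "Re (b powr of_real \<alpha>) = norm b powr \<alpha> * cos \<bar>\<alpha> * Arg b\<bar>" by simp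
    have "\<bar>\<alpha> * Arg b\<bar> \<le> \<alpha> * a0" using Arg assms by (simp add: abs_mult mult_left_mono)
    then have "c \<le> cos \<bar>\<alpha> * Arg b\<bar>"
      unfolding c_def using \<alpha>a0 by (subst cos_mono_le_eq) auto
    then show ?thesis unfolding Re using mult_left_mono[OF _ powr_ge_zero[of "norm b" \<alpha>]]
      by (metis mult.commute)
  qed
  ultimately show ?thesis using that by blast
qed

section \<open>The generating polynomial of BDF2\<close>

definition bdf2_delta :: "complex \<Rightarrow> complex" where
  "bdf2_delta w = (1 - w) + (1 - w)\<^sup>2 / 2"

lemma bdf2_delta_factor: "bdf2_delta w = (1 - w) * (3 - w) / 2"
  by (simp add: bdf2_delta_def power2_eq_square field_simps)

text \<open>A-stability: for w = a + i b the real part is (1 - a)^2 + (1 - a^2 - b^2)/2.\<close>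

lemma Re_bdf2_delta_nonneg:
  assumes "norm w \<le> 1" shows "0 \<le> Re (bdf2_delta w)"
proof -
  define a b where "a = Re w" and "b = Im w"
  have "a\<^sup>2 + b\<^sup>2 \<le> 1" using power_mono[OF assms norm_ge_zero, of 2] by (simp add: cmod_power2 a_def b_def)
  moreover have "Re (bdf2_delta w) = 3/2 - 2 * a + a\<^sup>2 / 2 - b\<^sup>2 / 2"
    by (simp add: bdf2_delta_def power2_eq_square a_def b_def field_simps)
  moreover have "0 \<le> 1 - 2 * a + a\<^sup>2"
    using zero_le_power2[of "1 - a"] by (simp add: power2_diff)
  ultimately show ?thesis by linarith
qed

lemma bdf2_delta_diff_le:
  "norm (bdf2_delta w - bdf2_delta v) \<le> norm (w - v) * (2 + (norm w + norm v) / 2)"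
proof -
  have "bdf2_delta w - bdf2_delta v = (w - v) * ((w + v) / 2 - 2)"
    by (simp add: bdf2_delta_def power2_eq_square field_simps)
  moreover have "norm ((w + v) / 2 - 2) \<le> 2 + (norm w + norm v) / 2"
  proof -
    have "norm ((w + v) / 2 - 2) \<le> norm ((w + v) / 2) + 2"
      using norm_triangle_ineq4[of "(w + v) / 2" 2] by simp
    moreover have "norm ((w + v) / 2) = norm (w + v) / 2" by (simp add: norm_divide)
    ultimately show ?thesis using norm_triangle_ineq[of w v] by (simp add: field_simps)
  qed
  ultimately show ?thesis by (simp add: norm_mult mult_left_mono)
qed

text \<open>The bound 4 lies between pi and 2 pi: wide enough for the period strip, scaled by
  \<tau>, together with the shift by \<tau> \<rho> U, and narrow enough to exclude the other zeros
  of 1 - e^(-s).\<close>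

lemma exp_strip_eq_1: "\<bar>Im s\<bar> \<le> 4 \<Longrightarrow> exp (- s) = 1 \<longleftrightarrow> s = 0"
proof
  assume s: "\<bar>Im s\<bar> \<le> 4" "exp (- s) = 1"
  then obtain n :: int where n: "Re s = 0" "- Im s = of_int (2 * n) * pi"
    by (auto simp: exp_eq_1)
  have "n = 0"
  proof (rule ccontr)
    assume "n \<noteq> 0"
    then have "1 \<le> \<bar>real_of_int n\<bar>" by linarith
    moreover have "\<bar>Im s\<bar> = 2 * \<bar>real_of_int n\<bar> * pi" using n(2) by (simp add: abs_mult flip: abs_minus_cancel[of "Im s"])
    ultimately have "2 * pi \<le> \<bar>Im s\<bar>" by simp
    then show False using s(1) pi_gt3 by linarith
  qed
  with n show "s = 0" by (simp add: complex_eq_iff)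
qed auto

text \<open>The quotient (1 - e^(-s))/s, continued by 1 to the origin, is continuous without zeros
  on a compact piece of the strip, so its modulus has a positive minimum there.\<close>

lemma one_minus_exp_lower:
  obtains c where "0 < c" "c \<le> 1/2" "\<And>s. \<bar>Im s\<bar> \<le> 4 \<Longrightarrow> norm s \<le> 6 \<Longrightarrow> c * norm s \<le> norm (1 - exp (- s))"
proof -
  define q where "q s = (if s = 0 then 1 else (1 - exp (- s)) / s)" for s :: complex
  define K where "K = cball 0 6 \<inter> {s. \<bar>Im s\<bar> \<le> 4}"
  have "closed {s. \<bar>Im s\<bar> \<le> 4}"
    by (intro closed_Collect_le continuous_intros)
  then have K: "compact K"
    unfolding K_def by (intro compact_Int_closed) auto
  have "isCont q s" for s
  proof (cases "s = 0")
    case True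
    have "((\<lambda>s. 1 - exp (- s)) has_field_derivative 1) (at (0::complex))"
      by (auto intro!: derivative_eq_intros)
    then have "((\<lambda>s. (1 - exp (- s)) / s) \<longlongrightarrow> 1) (at (0::complex))"
      by (simp add: has_field_derivative_iff)
    then have "(q \<longlongrightarrow> 1) (at 0)"
      by (rule Lim_transform_eventually) (auto simp: q_def eventually_at_filter)
    then show ?thesis using True by (simp add: isCont_def q_def)
  next
    case False
    have "\<forall>\<^sub>F s in nhds s. q s = (1 - exp (- s)) / s"
      using t1_space_nhds[OF False] by eventually_elim (simp add: q_def)
    then show ?thesis
      using False by (subst isCont_cong) (auto intro!: continuous_intros)
  qed
  then have cont: "continuous_on K (\<lambda>s. norm (q s))"
    by (intro continuous_on_norm continuous_at_imp_continuous_on) auto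
  have "0 \<in> K" by (simp add: K_def)
  then obtain s0 where s0: "s0 \<in> K" "\<And>s. s \<in> K \<Longrightarrow> norm (q s0) \<le> norm (q s)"
    using continuous_attains_inf[OF K _ cont] by blast
  have "q s0 \<noteq> 0"
    using s0(1) exp_strip_eq_1[of s0] by (auto simp: q_def K_def)
  define c where "c = min (1/2) (norm (q s0))"
  show ?thesis
  proof (rule that[of c])
    fix s :: complex assume s: "\<bar>Im s\<bar> \<le> 4" "norm s \<le> 6"
    show "c * norm s \<le> norm (1 - exp (- s))"
    proof (cases "s = 0")
      case False
      have "c \<le> norm (q s)" using s0(2)[of s] s by (auto simp: K_def c_def)
      then show ?thesis using False by (simp add: q_def norm_divide field_simps)
    qed simp
  qed (use \<open>q s0 \<noteq> 0\<close> in \<open>auto simp: c_def\<close>)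
qed

text \<open>Since 8/5 is below 2, |3 - e^(-s)| stays above 1: the second zero w = 3 of
  \<open>bdf2_delta\<close> is out of reach.\<close>

lemma norm_exp_neg_le:
  assumes "\<bar>Im s\<bar> \<le> 4" "- (1/10) * \<bar>Im s\<bar> \<le> Re s"
  shows "norm (exp (- s)) \<le> 8/5"
proof -
  have "exp (- Re s) \<le> exp (4/10)" using assms by simp
  also have "\<dots> \<le> 1 + 4/10 + (4/10)\<^sup>2" by (rule exp_bound) auto
  finally show ?thesis by (simp add: power2_eq_square)
qed

text \<open>For t = - Re s > 0 the point e^(-s) leaves the unit disc slightly. Compared with its
  radial projection \<open>v\<close>, where the real part is nonnegative, at most 8 t is lost, while
  |bdf2_delta| is at least of order |Im s|.\<close>

lemma bdf2_delta_sector: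
  assumes "0 < \<epsilon>"
  obtains \<eta> where "0 < \<eta>" "\<eta> \<le> 1/10"
    "\<And>s. \<bar>Im s\<bar> \<le> 4 \<Longrightarrow> - \<eta> * \<bar>Im s\<bar> \<le> Re s \<Longrightarrow> - \<epsilon> * norm (bdf2_delta (exp (- s))) \<le> Re (bdf2_delta (exp (- s)))"
proof -
  obtain c where c: "0 < c" "\<And>s. \<bar>Im s\<bar> \<le> 4 \<Longrightarrow> norm s \<le> 6 \<Longrightarrow> c * norm s \<le> norm (1 - exp (- s))"
    using one_minus_exp_lower by metis
  \<comment> \<open>The loss 8 t \<le> 8 \<eta> |y| must be covered by \<epsilon> times the lower
    bound c |y| / 2; hence 16 \<eta> \<le> \<epsilon> c.\<close>
  define \<eta> where "\<eta> = min (1/10) (\<epsilon> * c / 16)"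
  have \<eta>: "0 < \<eta>" "\<eta> \<le> 1/10" "16 * \<eta> \<le> \<epsilon> * c" using assms c by (auto simp: \<eta>_def)
  show ?thesis
  proof (rule that[OF \<eta>(1,2)])
    fix s assume s: "\<bar>Im s\<bar> \<le> 4" "- \<eta> * \<bar>Im s\<bar> \<le> Re s"
    define w where "w = exp (- s)"
    show "- \<epsilon> * norm (bdf2_delta (exp (- s))) \<le> Re (bdf2_delta (exp (- s)))"
    proof (cases "0 \<le> Re s")
      case True
      then have "0 \<le> Re (bdf2_delta (exp (- s)))" by (intro Re_bdf2_delta_nonneg) simp
      moreover have "- \<epsilon> * norm (bdf2_delta (exp (- s))) \<le> 0" using assms by simp
      ultimately show ?thesis by linarith
    next
      case False
      define t y where "t = - Re s" and "y = Im s"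
      have ty: "0 < t" "t \<le> \<eta> * \<bar>y\<bar>" "\<bar>y\<bar> \<le> 4" using False s by (auto simp: t_def y_def)
      have "\<eta> * \<bar>y\<bar> \<le> (1/10) * 4" using \<eta> ty by (intro mult_mono) auto
      then have t4: "t \<le> 4/10" using ty by simp
      define v where "v = exp (- \<i> * of_real y)"
      have v: "norm v = 1" by (simp add: v_def)
      have w: "w = of_real (exp t) * v"
      proof -
        have "- s = of_real t + - \<i> * of_real y" by (simp add: complex_eq_iff t_def y_def)
        then show ?thesis by (simp only: w_def v_def exp_add exp_of_real)
      qed
      have et: "exp t \<le> 1 + 2 * t"
      proof -
        have "t * t \<le> 1 * t" using ty t4 by (intro mult_right_mono) auto
        moreover have "exp t \<le> 1 + t + t * t" using exp_bound[of t] ty t4 by (simp add: power2_eq_square)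
        ultimately show ?thesis by linarith
      qed
      have nw: "norm w \<le> 9/5" using w v et t4 by (simp add: norm_mult)
      have "w - v = of_real (exp t - 1) * v" by (simp add: w algebra_simps)
      then have "norm (w - v) = \<bar>exp t - 1\<bar>" by (simp only: norm_mult v mult_1_right norm_of_real)
      then have "norm (w - v) = exp t - 1" using ty by simp
      then have "norm (w - v) \<le> 2 * t" using et by simp
      then have "norm (bdf2_delta w - bdf2_delta v) \<le> 2 * t * 4"
        using nw v ty by (intro order_trans[OF bdf2_delta_diff_le] mult_mono) auto
      then have "Re (bdf2_delta v) - Re (bdf2_delta w) \<le> 8 * t"
        using abs_Re_le_cmod[of "bdf2_delta w - bdf2_delta v"] by simp
      then have 1: "- (8 * t) \<le> Re (bdf2_delta w)"
        using Re_bdf2_delta_nonneg[of v] v by simp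
      have "norm s \<le> 6" using cmod_le[of s] t4 ty by (simp add: t_def y_def)
      then have "c * \<bar>y\<bar> \<le> norm (1 - w)"
        unfolding w_def y_def using c(1) s(1) by (intro order_trans[OF mult_left_mono[OF abs_Im_le_cmod] c(2)]) auto
      moreover have "1 \<le> norm (3 - w)" using norm_triangle_ineq2[of 3 w] nw by simp
      ultimately have "c * \<bar>y\<bar> * 1 \<le> norm (1 - w) * norm (3 - w)"
        using c(1) by (intro mult_mono) auto
      then have 2: "c * \<bar>y\<bar> / 2 \<le> norm (bdf2_delta w)"
        by (simp add: bdf2_delta_factor norm_mult norm_divide)
      have "8 * t \<le> 8 * (\<eta> * \<bar>y\<bar>)" using ty by simp
      also have "\<dots> \<le> \<epsilon> * (c * \<bar>y\<bar> / 2)" using mult_right_mono[OF \<eta>(3), of "\<bar>y\<bar>"] by simp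
      also have "\<dots> \<le> \<epsilon> * norm (bdf2_delta w)" using 2 assms by (intro mult_left_mono) auto
      finally show ?thesis using 1 unfolding w_def by linarith
    qed
  qed
qed

text \<open>Second-order consistency: the difference and its first two derivatives vanish at the
  origin, so the Taylor polynomial of degree 2 drops out. In the proof \<open>f i\<close> is the
  i-th derivative.\<close>

lemma bdf2_delta_exp_approx:
  assumes "norm s \<le> 6"
  shows "norm (bdf2_delta (exp (- s)) - s) \<le> 3 * exp 12 * norm s ^ 3"
proof -
  define f :: "nat \<Rightarrow> complex \<Rightarrow> complex" where "f i s = (if i = 0 then 3/2 - 2 * exp (- s) + exp (- 2 * s) / 2 - s
    else if i = 1 then 2 * exp (- s) - exp (- 2 * s) - 1
    else if i = 2 then - 2 * exp (- s) + 2 * exp (- 2 * s)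
    else 2 * exp (- s) - 4 * exp (- 2 * s))" for i s
  have "norm (f 0 s - (\<Sum>i\<le>2. f i 0 * (s - 0) ^ i / fact i)) \<le> (6 * exp 12) * norm (s - 0) ^ Suc 2 / fact 2"
  proof (rule complex_Taylor[where S = "cball 0 6"])
    fix i :: nat and x :: complex assume "i \<le> 2"
    then consider "i = 0" | "i = 1" | "i = 2" by linarith
    then show "(f i has_field_derivative f (Suc i) x) (at x within cball 0 6)"
      by cases (auto simp: f_def[abs_def] intro!: derivative_eq_intros)
  next
    fix x :: complex assume "x \<in> cball 0 6"
    then have x: "\<bar>Re x\<bar> \<le> 6" using abs_Re_le_cmod[of x] by simp
    have "f (Suc 2) x = 2 * exp (- x) - 4 * exp (- 2 * x)" by (simp add: f_def)
    also have "norm \<dots> \<le> norm (2 * exp (- x)) + norm (4 * exp (- 2 * x))"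
      by (rule norm_triangle_ineq4)
    also have "\<dots> = 2 * exp (- Re x) + 4 * exp (- 2 * Re x)" by (simp add: norm_mult)
    also have "\<dots> \<le> 2 * exp 12 + 4 * exp 12"
      using x by (intro add_mono mult_left_mono) auto
    finally show "norm (f (Suc 2) x) \<le> 6 * exp 12" by simp
  qed (use assms in auto)
  moreover have "(\<Sum>i\<le>2. f i 0 * (s - 0) ^ i / fact i) = 0"
    by (simp add: f_def numeral_2_eq_2)
  moreover have "f 0 s = bdf2_delta (exp (- s)) - s"
    by (simp add: f_def bdf2_delta_def power2_eq_square field_simps flip: exp_add)
  ultimately show ?thesis by (simp add: numeral_3_eq_3 numeral_2_eq_2 mult_ac)
qed

text \<open>The numerator of \<open>e\<^sup>-\<^sup>s/(1-e\<^sup>-\<^sup>s) + e\<^sup>-\<^sup>s/2 - 1/s\<close>.\<close>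
lemma bdf2_source_numerator:
  fixes s :: complex
  assumes "norm s \<le> 6"
  shows "norm (s * (3 * exp (- s) - exp (- 2 * s)) / 2 - (1 - exp (- s))) \<le> 40 * exp 12 * norm s ^ 3"
proof -
  \<comment> \<open>\<open>f i\<close> is the i-th derivative. Vanishing to third order is due to
    the summand w/2 of the source; without it the numerator would begin with - s^2 / 2.\<close>
  define f :: "nat \<Rightarrow> complex \<Rightarrow> complex" where "f i s =
   (if i = 0 then s * (3 * exp (- s) - exp (- 2 * s)) / 2 - (1 - exp (- s))
    else if i = 1 then (3 * exp (- s) - exp (- 2 * s)) / 2 + s * (- 3 * exp (- s) + 2 * exp (- 2 * s)) / 2 - exp (- s)
    else if i = 2 then (- 3 * exp (- s) + 2 * exp (- 2 * s)) + s * (3 * exp (- s) - 4 * exp (- 2 * s)) / 2 + exp (- s)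
    else (3 * exp (- s) - 4 * exp (- 2 * s)) + (3 * exp (- s) - 4 * exp (- 2 * s)) / 2 + s * (- 3 * exp (- s) + 8 * exp (- 2 * s)) / 2 - exp (- s))" for i s
  have "norm (f 0 s - (\<Sum>i\<le>2. f i 0 * (s - 0) ^ i / fact i)) \<le> (80 * exp 12) * norm (s - 0) ^ Suc 2 / fact 2"
  proof (rule complex_Taylor[where S = "cball 0 6"])
    fix i :: nat and x :: complex assume "i \<le> 2"
    then consider "i = 0" | "i = 1" | "i = 2" by linarith
    then show "(f i has_field_derivative f (Suc i) x) (at x within cball 0 6)"
      by cases (auto simp: f_def[abs_def] field_simps intro!: derivative_eq_intros)
  next
    fix x :: complex assume "x \<in> cball 0 6"
    then have nx: "norm x \<le> 6" by simp
    then have x: "\<bar>Re x\<bar> \<le> 6" using abs_Re_le_cmod[of x] by simp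
    define a b where "a = exp (- x)" and "b = exp (- 2 * x)"
    have ab: "norm a \<le> exp 12" "norm b \<le> exp 12" using x by (auto simp: a_def b_def)
    have "f (Suc 2) x = (7/2) * a - 6 * b + x * (- 3 * a + 8 * b) / 2"
      unfolding f_def a_def b_def by (simp add: field_simps)
    also have "norm \<dots> \<le> (7/2) * norm a + 6 * norm b + norm x * (3 * norm a + 8 * norm b) / 2"
    proof -
      have "norm ((7/2) * a - 6 * b) \<le> (7/2) * norm a + 6 * norm b"
        using norm_triangle_ineq4[of "(7/2) * a" "6 * b"] by (simp add: norm_mult norm_divide)
      moreover have "norm (- 3 * a + 8 * b) \<le> 3 * norm a + 8 * norm b"
        using norm_triangle_ineq[of "- 3 * a" "8 * b"] by (simp add: norm_mult)
      then have "norm (x * (- 3 * a + 8 * b) / 2) \<le> norm x * (3 * norm a + 8 * norm b) / 2"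
        by (simp add: norm_mult norm_divide mult_left_mono)
      ultimately show ?thesis by (intro order_trans[OF norm_triangle_ineq] add_mono)
    qed
    also have "\<dots> \<le> (7/2) * exp 12 + 6 * exp 12 + 6 * (3 * exp 12 + 8 * exp 12) / 2"
      using ab nx by (intro add_mono mult_left_mono divide_right_mono mult_mono) auto
    also have "\<dots> \<le> 80 * exp 12" by simp
    finally show "norm (f (Suc 2) x) \<le> 80 * exp 12" .
  qed (use assms in auto)
  moreover have "(\<Sum>i\<le>2. f i 0 * (s - 0) ^ i / fact i) = 0"
    by (simp add: f_def numeral_2_eq_2)
  moreover have "f 0 s = s * (3 * exp (- s) - exp (- 2 * s)) / 2 - (1 - exp (- s))"
    by (simp add: f_def)
  ultimately show ?thesis by (simp add: numeral_3_eq_3 numeral_2_eq_2 mult_ac)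
qed

text \<open>The generating function of the weights 3/2, 1, 1, ... of the initial value. The summand
  \<open>w / 2\<close> is the starting correction: it cancels the constant term of e^(-s)/(1 -
  e^(-s)) = 1/s - 1/2 + O(s).\<close>

definition bdf2_source :: "complex \<Rightarrow> complex" where
  "bdf2_source w = w / (1 - w) + w / 2"

lemma norm_powr_of_real: "norm (z powr of_real a) = norm (z :: complex) powr a"
  by (simp add: norm_powr_real_powr')

text \<open>Keeps the disc of the mean value inequality off the branch cut of the power. The
  distance of \<open>s\<close> to the cut is |s| if Re s \<ge> 0 and |Im s| \<ge> 10/11 |s|
  otherwise.\<close>

lemma nonpos_Reals_dist_sector:
  assumes "s \<noteq> 0" "- (1/10) * \<bar>Im s\<bar> \<le> Re s" "norm (z - s) \<le> norm s / 2"
  shows "z \<notin> \<real>\<^sub>\<le>\<^sub>0"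
proof
  assume "z \<in> \<real>\<^sub>\<le>\<^sub>0"
  then have z: "Im z = 0" "Re z \<le> 0" by (auto simp: complex_nonpos_Reals_iff)
  have ns: "0 < norm s" using assms by simp
  show False
  proof (cases "0 \<le> Re s")
    case True
    have "\<bar>Re s\<bar> \<le> \<bar>Re (z - s)\<bar>" using z True by simp
    then have "(Re s)\<^sup>2 \<le> (Re (z - s))\<^sup>2" by (simp only: abs_le_square_iff)
    then have "(norm s)\<^sup>2 \<le> (norm (z - s))\<^sup>2"
      unfolding cmod_power2 using z by simp
    then have "norm s \<le> norm (z - s)" by simp
    then show ?thesis using assms ns by linarith
  next
    case False
    have "norm s \<le> \<bar>Re s\<bar> + \<bar>Im s\<bar>" by (rule cmod_le)
    moreover have "\<bar>Im s\<bar> \<le> norm (z - s)" using abs_Im_le_cmod[of "z - s"] z by simp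
    ultimately show ?thesis using assms ns False by (simp add: field_simps)
  qed
qed

text \<open>Mean value inequality: |z| \<ge> |s|/2 on the disc bounds the derivative by
  2^(1-\<alpha>) |s|^(\<alpha>-1).\<close>

lemma powr_diff_sector:
  fixes \<alpha> :: real
  assumes "0 < \<alpha>" "\<alpha> < 1" "s \<noteq> 0" "- (1/10) * \<bar>Im s\<bar> \<le> Re s" "norm (d - s) \<le> norm s / 2"
  shows "norm (d powr of_real \<alpha> - s powr of_real \<alpha>) \<le> 2 * norm s powr (\<alpha> - 1) * norm (d - s)"
proof (rule field_differentiable_bound[where S = "cball s (norm s / 2)"])
  fix z assume z: "z \<in> cball s (norm s / 2)"
  then have z': "norm (z - s) \<le> norm s / 2" by (simp add: dist_norm norm_minus_commute)
  have "z \<notin> \<real>\<^sub>\<le>\<^sub>0" using nonpos_Reals_dist_sector assms(3,4) z' by blast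
  then show "((\<lambda>z. z powr of_real \<alpha>) has_field_derivative of_real \<alpha> * z powr of_real (\<alpha> - 1)) (at z within cball s (norm s / 2))"
    by (auto intro!: derivative_eq_intros)
  have ns: "0 < norm s" using assms by simp
  have nz: "norm s / 2 \<le> norm z" using norm_triangle_ineq2[of s "s - z"] z' by (simp add: norm_minus_commute)
  have "norm z powr (\<alpha> - 1) \<le> (norm s / 2) powr (\<alpha> - 1)"
    using assms ns nz by (intro powr_mono2') auto
  also have "\<dots> = norm s powr (\<alpha> - 1) * 2 powr (1 - \<alpha>)"
    using ns by (simp add: powr_divide powr_diff)
  also have "2 powr (1 - \<alpha>) \<le> 2 powr (1::real)" using assms by (intro powr_mono) auto
  finally have "norm z powr (\<alpha> - 1) \<le> norm s powr (\<alpha> - 1) * 2"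
    by (simp add: mult_left_mono)
  then have "\<alpha> * norm z powr (\<alpha> - 1) \<le> 1 * (norm s powr (\<alpha> - 1) * 2)"
    using assms by (intro mult_mono) auto
  then show "norm (of_real \<alpha> * z powr of_real (\<alpha> - 1)) \<le> 2 * norm s powr (\<alpha> - 1)"
    using assms unfolding norm_mult norm_powr_of_real by (simp add: mult.commute)
qed (use assms in \<open>auto simp: dist_norm norm_minus_commute\<close>)

lemma bdf2_powr_approx:
  fixes \<alpha> :: real
  assumes "0 < \<alpha>" "\<alpha> < 1"
  obtains C where "0 < C"
    "\<And>s. s \<noteq> 0 \<Longrightarrow> norm s \<le> 6 \<Longrightarrow> \<bar>Im s\<bar> \<le> 4 \<Longrightarrow> - (1/10) * \<bar>Im s\<bar> \<le> Re s \<Longrightarrow>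
      norm (bdf2_delta (exp (- s)) powr of_real \<alpha> - s powr of_real \<alpha>) \<le> C * norm s powr (\<alpha> + 2)"
    "\<And>s. s \<noteq> 0 \<Longrightarrow> norm s \<le> 6 \<Longrightarrow> \<bar>Im s\<bar> \<le> 4 \<Longrightarrow> - (1/10) * \<bar>Im s\<bar> \<le> Re s \<Longrightarrow>
      norm (s powr of_real (\<alpha> - 1) - bdf2_delta (exp (- s)) powr of_real \<alpha> * bdf2_source (exp (- s)))
        \<le> C * norm s powr (\<alpha> + 1)"
proof -
  obtain c where c: "0 < c" "\<And>s. \<bar>Im s\<bar> \<le> 4 \<Longrightarrow> norm s \<le> 6 \<Longrightarrow> c * norm s \<le> norm (1 - exp (- s))"
    using one_minus_exp_lower by metis
  define E where "E = 3 * exp (12::real)"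
  define C1 where "C1 = (2 + 36 * E) * (2 * E)"
  define C2 where "C2 = 40 * exp 12 / c"
  define C where "C = max C1 (C1 * (1 + 36 * C2) + C2)"
  have E: "0 < E" by (simp add: E_def)
  then have C1: "0 < C1" "2 * E \<le> C1" by (auto simp: C1_def)
  have C2: "0 < C2" using c by (simp add: C2_def)
  have approx1: "norm (bdf2_delta (exp (- s)) powr of_real \<alpha> - s powr of_real \<alpha>) \<le> C1 * norm s powr (\<alpha> + 2)"
    if s: "s \<noteq> 0" "norm s \<le> 6" "- (1/10) * \<bar>Im s\<bar> \<le> Re s" for s
  proof -
    define d where "d = bdf2_delta (exp (- s))"
    define x where "x = norm s"
    have x: "0 < x" "x \<le> 6" using s by (auto simp: x_def)
    have ds: "norm (d - s) \<le> E * x ^ 3"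
      unfolding d_def E_def x_def by (rule bdf2_delta_exp_approx[OF s(2)])
    have xp: "x powr (\<alpha> + 2) = x powr \<alpha> * x ^ 2"
      using x by (simp add: powr_add)
    show ?thesis
    \<comment> \<open>If \<open>d\<close> is not close to \<open>s\<close>, the cubic bound forces 2
      E x^2 \<ge> 1, so a crude bound of order x^\<alpha> is already of order x^(\<alpha>+2). The
      factor 36 comes from x \<le> 6.\<close>
    proof (cases "norm (d - s) \<le> x / 2")
      case True
      have "norm (d powr of_real \<alpha> - s powr of_real \<alpha>) \<le> 2 * x powr (\<alpha> - 1) * norm (d - s)"
        unfolding x_def by (rule powr_diff_sector) (use assms s True in \<open>auto simp: x_def\<close>)
      also have "\<dots> \<le> 2 * x powr (\<alpha> - 1) * (E * x ^ 3)"
        by (intro mult_left_mono ds) auto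
      also have "\<dots> = 2 * E * x powr (\<alpha> + 2)"
        unfolding xp using x by (simp add: powr_diff power3_eq_cube power2_eq_square)
      also have "\<dots> \<le> C1 * x powr (\<alpha> + 2)"
        using C1 by (intro mult_right_mono) auto
      finally show ?thesis by (simp add: d_def x_def)
    next
      case False
      then have "x / 2 < E * x ^ 3" using ds by linarith
      then have x2: "1 \<le> 2 * E * x ^ 2" using x by (simp add: power3_eq_cube power2_eq_square)
      have "norm d \<le> x + E * x ^ 3" using norm_triangle_sub[of d s] ds by (simp add: x_def)
      also have "x ^ 3 \<le> 36 * x" using x mult_right_mono[OF mult_mono[of x 6 x 6], of x] by (simp add: power3_eq_cube)
      finally have d: "norm d \<le> (1 + 36 * E) * x" using E by (simp add: algebra_simps)
      have "norm d powr \<alpha> \<le> ((1 + 36 * E) * x) powr \<alpha>"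
        using d assms by (intro powr_mono2) auto
      also have "\<dots> = (1 + 36 * E) powr \<alpha> * x powr \<alpha>" using E x by (simp add: powr_mult)
      also have "\<dots> \<le> (1 + 36 * E) powr 1 * x powr \<alpha>"
        using E assms by (intro mult_right_mono powr_mono) auto
      finally have "norm d powr \<alpha> \<le> (1 + 36 * E) * x powr \<alpha>" using E by simp
      then have "norm (d powr of_real \<alpha> - s powr of_real \<alpha>) \<le> (2 + 36 * E) * x powr \<alpha>"
        using norm_triangle_ineq4[of "d powr of_real \<alpha>" "s powr of_real \<alpha>"]
        unfolding norm_powr_of_real x_def by (simp add: algebra_simps)
      also have "\<dots> \<le> (2 + 36 * E) * x powr \<alpha> * (2 * E * x ^ 2)"
        using mult_left_mono[OF x2, of "(2 + 36 * E) * x powr \<alpha>"] E by simp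
      also have "\<dots> = C1 * x powr (\<alpha> + 2)" unfolding xp C1_def by simp
      finally show ?thesis by (simp add: d_def x_def)
    qed
  qed
  show ?thesis
  proof (rule that[of C])
    show "0 < C" using C1 by (simp add: C_def)
  next
    fix s assume s: "s \<noteq> 0" "norm s \<le> 6" "\<bar>Im s\<bar> \<le> 4" "- (1/10) * \<bar>Im s\<bar> \<le> Re s"
    have "C1 * norm s powr (\<alpha> + 2) \<le> C * norm s powr (\<alpha> + 2)"
      unfolding C_def by (intro mult_right_mono) auto
    with approx1[OF s(1,2,4)]
    show "norm (bdf2_delta (exp (- s)) powr of_real \<alpha> - s powr of_real \<alpha>) \<le> C * norm s powr (\<alpha> + 2)"
      by linarith
    define x where "x = norm s"
    have x: "0 < x" "x \<le> 6" using s by (auto simp: x_def)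
    define w where "w = exp (- s)"
    define k where "k = bdf2_source w"
    have w1: "c * x \<le> norm (1 - w)" using c(2)[OF s(3,2)] by (simp add: x_def w_def)
    then have w0: "1 - w \<noteq> 0" using c(1) x by (metis mult_pos_pos norm_zero not_le)
    define n where "n = s * (3 * w - w\<^sup>2) / 2 - (1 - w)"
    have n: "norm n \<le> 40 * exp 12 * x ^ 3"
      using bdf2_source_numerator[OF s(2)] by (simp add: n_def w_def x_def power2_eq_square flip: exp_add)
    have "k - 1 / s = n / (s * (1 - w))"
      using w0 s(1) by (simp add: k_def bdf2_source_def n_def field_simps power2_eq_square)
    then have "norm (k - 1 / s) = norm n / (x * norm (1 - w))"
      by (simp add: norm_divide norm_mult x_def)
    also have "\<dots> \<le> (40 * exp 12 * x ^ 3) / (x * (c * x))"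
      using n w1 c(1) x by (intro frac_le mult_left_mono) auto
    also have "\<dots> = C2 * x" using x c by (simp add: C2_def power3_eq_cube)
    finally have k1: "norm (k - 1 / s) \<le> C2 * x" .
    have "norm k \<le> norm (1 / s) + norm (k - 1 / s)"
      by (rule norm_triangle_sub)
    also have "\<dots> \<le> 1 / x + C2 * x" using k1 by (simp add: norm_divide x_def)
    also have "\<dots> \<le> (1 + 36 * C2) / x"
    proof -
      have "C2 * (x * x) \<le> C2 * 36" using x C2 mult_mono[of x 6 x 6] by (intro mult_left_mono) auto
      then have "(1 + C2 * (x * x)) / x \<le> (1 + 36 * C2) / x" using x by (intro divide_right_mono) auto
      then show ?thesis using x by (simp add: add_divide_distrib)
    qed
    finally have k2: "norm k \<le> (1 + 36 * C2) / x" .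
    define D where "D = bdf2_delta w powr of_real \<alpha>"
    define S where "S = s powr of_real \<alpha>"
    have nS: "norm S = x powr \<alpha>" by (simp add: S_def x_def norm_powr_of_real)
    have "s powr of_real (\<alpha> - 1) = S * (1 / s)"
      using s(1) by (simp add: S_def powr_diff)
    \<comment> \<open>Symbol and source are replaced one at a time: S/s is compared with D k through
      S k.\<close>
    then have "s powr of_real (\<alpha> - 1) - D * k = - ((D - S) * k + S * (k - 1 / s))"
      by (simp add: algebra_simps)
    then have "norm (s powr of_real (\<alpha> - 1) - D * k) = norm ((D - S) * k + S * (k - 1 / s))"
      by (simp only: norm_minus_cancel)
    also have "\<dots> \<le> norm (D - S) * norm k + norm S * norm (k - 1 / s)"
      unfolding norm_mult[symmetric] by (rule norm_triangle_ineq)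
    also have "\<dots> \<le> (C1 * x powr (\<alpha> + 2)) * ((1 + 36 * C2) / x) + x powr \<alpha> * (C2 * x)"
      using approx1[OF s(1,2,4)] k1 k2 nS C1 by (intro add_mono mult_mono) (auto simp: D_def S_def w_def x_def)
    also have "\<dots> = (C1 * (1 + 36 * C2) + C2) * x powr (\<alpha> + 1)"
      using x by (simp add: powr_add power2_eq_square field_simps)
    also have "\<dots> \<le> C * x powr (\<alpha> + 1)"
      unfolding C_def by (intro mult_right_mono) auto
    finally show "norm (s powr of_real (\<alpha> - 1) - bdf2_delta (exp (- s)) powr of_real \<alpha> * bdf2_source (exp (- s)))
        \<le> C * norm s powr (\<alpha> + 1)"
      by (simp add: D_def k_def w_def x_def)
  qed
qed

lemma bdf2_delta_lower:
  obtains c where "0 < c"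
    "\<And>s. \<bar>Im s\<bar> \<le> 4 \<Longrightarrow> norm s \<le> 6 \<Longrightarrow> - (1/10) * \<bar>Im s\<bar> \<le> Re s \<Longrightarrow> c * norm s \<le> norm (bdf2_delta (exp (- s)))"
proof -
  obtain c where c: "0 < c" "\<And>s. \<bar>Im s\<bar> \<le> 4 \<Longrightarrow> norm s \<le> 6 \<Longrightarrow> c * norm s \<le> norm (1 - exp (- s))"
    using one_minus_exp_lower by metis
  show ?thesis
  proof (rule that[of "c / 2"])
    fix s assume s: "\<bar>Im s\<bar> \<le> 4" "norm s \<le> 6" "- (1/10) * \<bar>Im s\<bar> \<le> Re s"
    have "1 \<le> norm (3 - exp (- s))"
      using norm_triangle_ineq2[of 3 "exp (- s)"] norm_exp_neg_le[OF s(1,3)] by simp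
    then have "c * norm s * 1 \<le> norm (1 - exp (- s)) * norm (3 - exp (- s))"
      using c(1) c(2)[OF s(1,2)] by (intro mult_mono) auto
    then show "c / 2 * norm s \<le> norm (bdf2_delta (exp (- s)))"
      by (simp add: bdf2_delta_factor norm_mult norm_divide)
  qed (use c in simp)
qed

text \<open>Reaches the unbounded part of the strip, where compactness fails: for Re s \<ge> 1 the
  exponential is at most 1/2, and the rest of the strip satisfies |s| \<le> 6.\<close>

lemma one_minus_exp_lower_far:
  assumes "0 < (r::real)"
  obtains c where "0 < c" "c \<le> 1"
    "\<And>s. \<bar>Im s\<bar> \<le> 4 \<Longrightarrow> - (1/10) * \<bar>Im s\<bar> \<le> Re s \<Longrightarrow> r \<le> norm s \<Longrightarrow>
      c \<le> norm (1 - exp (- s)) \<and> c \<le> norm (bdf2_delta (exp (- s)))"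
proof -
  obtain c where c: "0 < c" "\<And>s. \<bar>Im s\<bar> \<le> 4 \<Longrightarrow> norm s \<le> 6 \<Longrightarrow> c * norm s \<le> norm (1 - exp (- s))"
    using one_minus_exp_lower by metis
  define c' where "c' = min (1/2) (c * r)"
  have c': "0 < c'" "c' \<le> 1/2" "c' \<le> c * r" using c assms by (auto simp: c'_def)
  show ?thesis
  proof (rule that[of "c' / 2"])
    fix s assume s: "\<bar>Im s\<bar> \<le> 4" "- (1/10) * \<bar>Im s\<bar> \<le> Re s" "r \<le> norm s"
    have 1: "c' \<le> norm (1 - exp (- s))"
    proof (cases "1 \<le> Re s")
      case True
      have "exp (- Re s) \<le> exp (- 1)" using True by simp
      also have "exp (- 1 :: real) \<le> 1/2" using exp_ge_add_one_self[of 1] by (simp add: exp_minus field_simps)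
      finally have "norm (exp (- s)) \<le> 1/2" by simp
      then show ?thesis using c' norm_triangle_ineq2[of 1 "exp (- s)"] by simp
    next
      case False
      then have "norm s \<le> 6" using cmod_le[of s] s by linarith
      then have "c * norm s \<le> norm (1 - exp (- s))" using c(2) s by blast
      moreover have "c * r \<le> c * norm s" using c s by simp
      ultimately show ?thesis using c' by linarith
    qed
    have "1 \<le> norm (3 - exp (- s))"
      using norm_triangle_ineq2[of 3 "exp (- s)"] norm_exp_neg_le[OF s(1,2)] by simp
    then have "c' * 1 \<le> norm (1 - exp (- s)) * norm (3 - exp (- s))"
      using c' 1 by (intro mult_mono) auto
    then have "c' / 2 \<le> norm (bdf2_delta (exp (- s)))"
      by (simp add: bdf2_delta_factor norm_mult norm_divide)
    with 1 c' show "c' / 2 \<le> norm (1 - exp (- s)) \<and> c' / 2 \<le> norm (bdf2_delta (exp (- s)))"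
      by simp
  qed (use c' in auto)
qed

section \<open>Contour integrals\<close>

text \<open>The increment of a primitive of \<open>e\<^sup>n\<^sup>\<tau>\<^sup>z h(z)\<close> over one period does not depend on the abscissa,
  and far to the right only the \<open>n\<close>-th term of the polynomial contributes.\<close>
lemma primitive_period_increment:
  fixes g h :: "complex \<Rightarrow> complex" and a :: "nat \<Rightarrow> complex" and \<tau> \<sigma>0 x0 K :: real and n N :: nat
  assumes \<tau>: "0 < \<tau>" and n: "n \<in> {1..N}"
    and g: "\<And>z. z \<in> S \<Longrightarrow> (g has_field_derivative exp (of_nat n * of_real \<tau> * z) * h z) (at z)"
    and S1: "\<And>x. x \<ge> x0 \<Longrightarrow> Complex x (pi / \<tau>) \<in> S \<and> Complex x (- (pi / \<tau>)) \<in> S"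
    and S2: "\<And>z. \<sigma>0 \<le> Re z \<Longrightarrow> \<bar>Im z\<bar> \<le> pi / \<tau> \<Longrightarrow> z \<in> S"
    and per: "\<And>x. x \<ge> x0 \<Longrightarrow> h (Complex x (pi / \<tau>)) = h (Complex x (- (pi / \<tau>)))"
    and approx: "\<And>z. \<sigma>0 \<le> Re z \<Longrightarrow> \<bar>Im z\<bar> \<le> pi / \<tau> \<Longrightarrow>
      norm (h z - of_real \<tau> * (\<Sum>k=1..N. a k * exp (- (of_nat k * of_real \<tau> * z)))) \<le> K * exp (- (real (Suc N) * \<tau> * Re z))"
  shows "g (Complex x0 (pi / \<tau>)) - g (Complex x0 (- (pi / \<tau>))) = 2 * of_real pi * \<i> * a n"
proof -
  define D where "D x = g (Complex x (pi / \<tau>)) - g (Complex x (- (pi / \<tau>)))" for x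
  define L where "L = 2 * of_real pi * \<i> * a n"
  \<comment> \<open>The derivative of \<open>D\<close> is the difference of the integrands on the
    upper and the lower edge of the strip, which agree by periodicity.\<close>
  have "\<exists>c. \<forall>x\<in>{x0..}. D x = c"
  proof (rule has_vector_derivative_zero_constant)
    fix x assume "x \<in> {x0..}"
    then have x: "x \<ge> x0" by simp
    have d: "((\<lambda>x. g (Complex x y)) has_vector_derivative 1 * (exp (of_nat n * of_real \<tau> * Complex x y) * h (Complex x y))) (at x within {x0..})"
      if "Complex x y \<in> S" for y
    proof -
      have "((\<lambda>x. Complex x y) has_vector_derivative 1) (at x within {x0..})"
        unfolding Complex_eq by (auto intro!: derivative_eq_intros)
      from field_vector_diff_chain_within[OF this has_field_derivative_at_within[OF g[OF that]]]
      show ?thesis by (simp add: o_def)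
    qed
    have "exp (of_nat n * of_real \<tau> * Complex x (pi / \<tau>)) = exp (of_nat n * of_real \<tau> * Complex x (- (pi / \<tau>)))"
    proof -
      have "of_nat n * of_real \<tau> * Complex x (pi / \<tau>)
          = of_nat n * of_real \<tau> * Complex x (- (pi / \<tau>)) + \<i> * (of_int (int n) * (of_real pi * 2))"
        using \<tau> by (simp add: complex_eq_iff)
      then show ?thesis by (simp only: exp_plus_2pin)
    qed
    then have "(D has_vector_derivative 0) (at x within {x0..})"
      unfolding D_def using has_vector_derivative_diff[OF d[OF conjunct1[OF S1[OF x]]] d[OF conjunct2[OF S1[OF x]]]] per[OF x]
      by simp
    then show "(D has_vector_derivative 0) (at x within {x0..})" .
  qed (simp, blast)
  then obtain c where c: "\<And>x. x \<ge> x0 \<Longrightarrow> D x = c" by auto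
  \<comment> \<open>A primitive of the polynomial part times e^(n \<tau> z). Its exponentials have
    period 2 pi i / \<tau>; only the term k = n, integrated to a linear function, has a nonzero
    increment.\<close>
  define P where "P z = a n * of_real \<tau> * z + (\<Sum>k\<in>{1..N}-{n}. a k * exp (of_real ((real n - real k) * \<tau>) * z) / of_real (real n - real k))" for z
  have P': "(P has_field_derivative of_real \<tau> * (\<Sum>k=1..N. a k * exp (of_real ((real n - real k) * \<tau>) * z))) (at z)" for z
  proof -
    have "(P has_field_derivative a n * of_real \<tau> + (\<Sum>k\<in>{1..N}-{n}. a k * (exp (of_real ((real n - real k) * \<tau>) * z) * of_real ((real n - real k) * \<tau>)) / of_real (real n - real k))) (at z)"
    proof -
      have E: "((\<lambda>z. b * exp (c * z) / d) has_field_derivative b * (exp (c * z) * c) / d) (at z)" for b c d :: complex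
        by (intro DERIV_cdivide DERIV_cmult) (auto intro!: derivative_eq_intros)
      show ?thesis
        unfolding P_def[abs_def] by (rule DERIV_add[OF DERIV_cmult_Id DERIV_sum]) (rule E)
    qed
    also have "(\<Sum>k\<in>{1..N}-{n}. a k * (exp (of_real ((real n - real k) * \<tau>) * z) * of_real ((real n - real k) * \<tau>)) / of_real (real n - real k))
       = of_real \<tau> * (\<Sum>k\<in>{1..N}-{n}. a k * exp (of_real ((real n - real k) * \<tau>) * z))"
      unfolding sum_distrib_left
    proof (rule sum.cong)
      fix k assume "k \<in> {1..N} - {n}"
      then have "complex_of_real (real n - real k) \<noteq> 0" unfolding of_real_eq_0_iff by auto
      then show "a k * (exp (of_real ((real n - real k) * \<tau>) * z) * of_real ((real n - real k) * \<tau>)) / of_real (real n - real k)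
        = of_real \<tau> * (a k * exp (of_real ((real n - real k) * \<tau>) * z))"
        unfolding of_real_mult by (simp del: of_real_diff)
    qed simp
    also have "a n * of_real \<tau> + of_real \<tau> * (\<Sum>k\<in>{1..N}-{n}. a k * exp (of_real ((real n - real k) * \<tau>) * z))
        = of_real \<tau> * (\<Sum>k=1..N. a k * exp (of_real ((real n - real k) * \<tau>) * z))"
      using n by (subst sum.remove[of "{1..N}" n]) (simp_all add: distrib_left mult.commute[of "a n"])
    finally show ?thesis .
  qed
  have Pdiff: "P (Complex x (pi / \<tau>)) - P (Complex x (- (pi / \<tau>))) = L" for x
  proof -
    have "exp (of_real ((real n - real k) * \<tau>) * Complex x (pi / \<tau>)) = exp (of_real ((real n - real k) * \<tau>) * Complex x (- (pi / \<tau>)))" for k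
    proof -
      have "of_real ((real n - real k) * \<tau>) * Complex x (pi / \<tau>)
          = of_real ((real n - real k) * \<tau>) * Complex x (- (pi / \<tau>)) + \<i> * (of_int (int n - int k) * (of_real pi * 2))"
        using \<tau> by (simp add: complex_eq_iff field_simps)
      then show ?thesis by (simp only: exp_plus_2pin)
    qed
    then have "P (Complex x (pi / \<tau>)) - P (Complex x (- (pi / \<tau>))) = a n * of_real \<tau> * (Complex x (pi / \<tau>) - Complex x (- (pi / \<tau>)))"
      unfolding P_def by (simp add: algebra_simps)
    also have "\<dots> = L" using \<tau> by (simp add: L_def complex_eq_iff)
    finally show ?thesis .
  qed
  \<comment> \<open>The defect e^(-(N+1) \<tau> x) beats the factor e^(n \<tau> x) by at least
    e^(-\<tau> x), because n \<le> N.\<close>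
  have bound: "norm (D x - L) \<le> K * exp (- (\<tau> * x)) * (2 * pi / \<tau>)" if x: "x \<ge> max 0 \<sigma>0" for x
  proof -
    let ?A = "Complex x (pi / \<tau>)" and ?B = "Complex x (- (pi / \<tau>))"
    have seg: "Re z = x \<and> \<bar>Im z\<bar> \<le> pi / \<tau>" if "z \<in> closed_segment ?B ?A" for z
    proof -
      obtain u where u: "0 \<le> u" "u \<le> 1" "z = (1 - u) *\<^sub>R ?B + u *\<^sub>R ?A"
        using \<open>z \<in> closed_segment ?B ?A\<close> unfolding closed_segment_def by blast
      have eq: "(1 - u) * (- p) + u * p = (2 * u - 1) * p" for p by (simp add: algebra_simps)
      have "Im z = (1 - u) * (- (pi / \<tau>)) + u * (pi / \<tau>)" by (simp add: u(3))
      also have "\<dots> = (2 * u - 1) * (pi / \<tau>)" by (rule eq)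
      finally have "Im z = (2 * u - 1) * (pi / \<tau>)" .
      then have "\<bar>Im z\<bar> = \<bar>2 * u - 1\<bar> * (pi / \<tau>)" using \<tau> by (simp add: abs_mult)
      also have "\<dots> \<le> 1 * (pi / \<tau>)" using u \<tau> by (intro mult_right_mono) auto
      finally have "\<bar>Im z\<bar> \<le> pi / \<tau>" by simp
      moreover have "Re z = (1 - u) * x + u * x" by (simp add: u(3))
      then have "Re z = x" by (simp add: algebra_simps)
      ultimately show ?thesis by simp
    qed
    have "norm ((g ?A - P ?A) - (g ?B - P ?B)) \<le> K * exp (- (\<tau> * x)) * norm (?A - ?B)"
    proof (rule field_differentiable_bound[where S = "closed_segment ?B ?A" and f = "\<lambda>z. g z - P z"])
      fix z assume "z \<in> closed_segment ?B ?A"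
      then have z: "Re z = x" "\<bar>Im z\<bar> \<le> pi / \<tau>" using seg by auto
      let ?f' = "exp (of_nat n * of_real \<tau> * z) * h z - of_real \<tau> * (\<Sum>k=1..N. a k * exp (of_real ((real n - real k) * \<tau>) * z))"
      have zS: "z \<in> S" using S2[of z] z x by simp
      show "((\<lambda>z. g z - P z) has_field_derivative ?f') (at z within closed_segment ?B ?A)"
        by (rule has_field_derivative_at_within[OF DERIV_diff[OF g[OF zS] P']])
      have E2: "exp (of_nat n * of_real \<tau> * z) * (a k * exp (- (of_nat k * of_real \<tau> * z))) = a k * exp (of_real ((real n - real k) * \<tau>) * z)" for k
      proof -
        have "of_nat n * of_real \<tau> * z + - (of_nat k * of_real \<tau> * z) = of_real ((real n - real k) * \<tau>) * z"
          by (simp add: algebra_simps)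
        then show ?thesis by (simp only: mult.left_commute[of _ "a k"] exp_add[symmetric])
      qed
      then have "?f' = exp (of_nat n * of_real \<tau> * z) * (h z - of_real \<tau> * (\<Sum>k=1..N. a k * exp (- (of_nat k * of_real \<tau> * z))))"
        by (simp only: right_diff_distrib sum_distrib_left mult.left_commute[of _ "complex_of_real \<tau>"] E2)
      then have "norm ?f' = exp (real n * \<tau> * x) * norm (h z - of_real \<tau> * (\<Sum>k=1..N. a k * exp (- (of_nat k * of_real \<tau> * z))))"
        using z by (simp add: norm_mult)
      also have "\<dots> \<le> exp (real n * \<tau> * x) * (K * exp (- (real (Suc N) * \<tau> * x)))"
        using approx[of z] z x by (intro mult_left_mono) auto
      also have "\<dots> = K * exp (real n * \<tau> * x + - (real (Suc N) * \<tau> * x))"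
        by (simp only: mult.left_commute[of _ K] exp_add)
      also have "real n * \<tau> * x + - (real (Suc N) * \<tau> * x) = - ((real (Suc N) - real n) * \<tau> * x)"
        by (simp add: algebra_simps)
      also have "K * exp (- ((real (Suc N) - real n) * \<tau> * x)) \<le> K * exp (- (\<tau> * x))"
      proof (rule mult_left_mono)
        have "0 \<le> K * exp (- (real (Suc N) * \<tau> * Re z))"
          using z x by (intro order_trans[OF norm_ge_zero approx]) auto
        then show "0 \<le> K" by (simp add: zero_le_mult_iff)
        have "1 * (\<tau> * x) \<le> (real (Suc N) - real n) * (\<tau> * x)"
          using n x \<tau> by (intro mult_right_mono) auto
        then show "exp (- ((real (Suc N) - real n) * \<tau> * x)) \<le> exp (- (\<tau> * x))" by (simp add: mult.assoc)
      qed
      finally show "norm ?f' \<le> K * exp (- (\<tau> * x))" .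
    qed auto
    moreover have "?A - ?B = \<i> * of_real (2 * pi / \<tau>)" by (simp add: complex_eq_iff)
    then have "norm (?A - ?B) = 2 * pi / \<tau>" using \<tau> by (simp only: norm_mult norm_of_real norm_ii) simp
    moreover have "(g ?A - P ?A) - (g ?B - P ?B) = D x - L" using Pdiff[of x] by (simp add: D_def algebra_simps)
    ultimately show ?thesis by simp
  qed
  have "((\<lambda>x. K * exp (- (\<tau> * x)) * (2 * pi / \<tau>)) \<longlongrightarrow> K * 0 * (2 * pi / \<tau>)) at_top"
  proof (intro tendsto_mult tendsto_const)
    have "LIM x at_top. \<tau> * x :> at_top"
      using \<tau> by (intro filterlim_tendsto_pos_mult_at_top[OF tendsto_const]) (auto simp: filterlim_ident)
    then show "((\<lambda>x. exp (- (\<tau> * x))) \<longlongrightarrow> 0) at_top"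
      by (intro filterlim_compose[OF exp_at_bot]) (simp add: filterlim_uminus_at_bot)
  qed
  then have lim: "((\<lambda>x. K * exp (- (\<tau> * x)) * (2 * pi / \<tau>)) \<longlongrightarrow> 0) at_top" by simp
  have "\<forall>\<^sub>F x in at_top. norm (D x - L) \<le> K * exp (- (\<tau> * x)) * (2 * pi / \<tau>)"
    using eventually_ge_at_top[of "max 0 \<sigma>0"] by eventually_elim (rule bound)
  from Lim_null_comparison[OF this lim] have "((\<lambda>x. D x - L) \<longlongrightarrow> 0) at_top" .
  moreover have "\<forall>\<^sub>F x in at_top. D x - L = c - L"
    using eventually_ge_at_top[of x0] by eventually_elim (simp add: c)
  then have "((\<lambda>x. D x - L) \<longlongrightarrow> c - L) at_top" by (rule tendsto_eventually)
  ultimately have "c - L = 0" using tendsto_unique[OF trivial_limit_at_top_linorder] by blast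
  then show ?thesis using c[of x0] by (simp add: D_def L_def)
qed

text \<open>The origin of t^(-2): with \<open>q\<close> proportional to t, the weight r on the rays
  integrates to at most q^(-2), uniformly in \<kappa> because (1 + y) e^(-y) \<le> 1.\<close>

lemma integral_linear_exp:
  fixes q \<kappa> :: real
  assumes "0 < q" "0 \<le> \<kappa>"
  shows "integrable lborel (\<lambda>r. indicator {\<kappa>..} r * (r * exp (- (q * r))))"
    and "(\<integral>r. indicator {\<kappa>..} r * (r * exp (- (q * r))) \<partial>lborel) \<le> 1 / q\<^sup>2"
proof -
  define F where "F r = - ((r / q + 1 / q\<^sup>2) * exp (- (q * r)))" for r
  have F': "(F has_real_derivative r * exp (- (q * r))) (at r)" for r
    unfolding F_def[abs_def] using assms
    by (auto intro!: derivative_eq_intros simp: field_simps power2_eq_square)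
  have qr: "LIM r at_top. q * r :> at_top"
    using assms by (intro filterlim_tendsto_pos_mult_at_top[OF tendsto_const]) (auto simp: filterlim_ident)
  have "((\<lambda>r. - ((1 / q\<^sup>2) * ((q * r) ^ 1 / exp (q * r)) + (1 / q\<^sup>2) * ((q * r) ^ 0 / exp (q * r)))) \<longlongrightarrow> - ((1 / q\<^sup>2) * 0 + (1 / q\<^sup>2) * 0)) at_top"
    by (intro tendsto_intros filterlim_compose[OF tendsto_power_div_exp_0 qr])
  moreover have "(\<lambda>r. - ((1 / q\<^sup>2) * ((q * r) ^ 1 / exp (q * r)) + (1 / q\<^sup>2) * ((q * r) ^ 0 / exp (q * r)))) = F"
    using assms by (auto simp: F_def fun_eq_iff exp_minus field_simps power2_eq_square)
  ultimately have lim: "(F \<longlongrightarrow> 0) at_top" by simp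
  have nn: "(\<integral>\<^sup>+r. ennreal (r * exp (- (q * r))) * indicator {\<kappa>..} r \<partial>lborel) = ennreal (0 - F \<kappa>)"
    by (rule nn_integral_FTC_atLeast[OF _ F' _ lim]) (use assms in auto)
  have nn': "(\<integral>\<^sup>+r. ennreal (indicator {\<kappa>..} r * (r * exp (- (q * r)))) \<partial>lborel) = ennreal (0 - F \<kappa>)"
    unfolding nn[symmetric] by (intro nn_integral_cong) (auto simp: indicator_def)
  show int: "integrable lborel (\<lambda>r. indicator {\<kappa>..} r * (r * exp (- (q * r))))"
    by (rule integrableI_nonneg) (use assms nn' in \<open>auto simp: indicator_def\<close>)
  have "ennreal (\<integral>r. indicator {\<kappa>..} r * (r * exp (- (q * r))) \<partial>lborel) = ennreal (0 - F \<kappa>)"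
    unfolding nn'[symmetric]
    by (rule nn_integral_eq_integral[symmetric, OF int]) (use assms in \<open>auto simp: indicator_def\<close>)
  moreover have "0 \<le> 0 - F \<kappa>" using assms by (simp add: F_def)
  moreover have "0 \<le> (\<integral>r. indicator {\<kappa>..} r * (r * exp (- (q * r))) \<partial>lborel)"
    by (rule Bochner_Integration.integral_nonneg) (use assms in \<open>auto simp: indicator_def\<close>)
  ultimately have "(\<integral>r. indicator {\<kappa>..} r * (r * exp (- (q * r))) \<partial>lborel) = 0 - F \<kappa>"
    by (simp del: diff_0)
  also have "\<dots> = (1 + q * \<kappa>) * exp (- (q * \<kappa>)) / q\<^sup>2"
    using assms by (simp add: F_def field_simps power2_eq_square)
  also have "\<dots> \<le> 1 / q\<^sup>2"
  proof (rule divide_right_mono)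
    show "(1 + q * \<kappa>) * exp (- (q * \<kappa>)) \<le> 1"
      using exp_ge_add_one_self[of "q * \<kappa>"] by (simp add: exp_minus field_simps)
  qed simp
  finally show "(\<integral>r. indicator {\<kappa>..} r * (r * exp (- (q * r))) \<partial>lborel) \<le> 1 / q\<^sup>2" .
qed

text \<open>The continuous integrand \<open>F\<close> lives on the whole ray, its discrete
  counterpart \<open>H\<close> only up to \<open>R\<close>. One majorant serves for their difference
  up to \<open>R\<close> and for \<open>F\<close> alone beyond.\<close>

lemma ray_integral_bound:
  fixes F H g :: "complex \<Rightarrow> complex"
  assumes F: "set_integrable lborel {\<kappa>..} (\<lambda>r. F (rcis r a) * cis a)"
    and g: "\<And>r. r \<in> {\<kappa>..R} \<Longrightarrow> (g has_field_derivative H (rcis r a)) (at (rcis r a))"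
    and H: "continuous_on {\<kappa>..R} (\<lambda>r. H (rcis r a))"
    and \<kappa>: "0 \<le> \<kappa>" "\<kappa> \<le> R" and q: "0 < q"
    and near: "\<And>r. \<kappa> \<le> r \<Longrightarrow> r \<le> R \<Longrightarrow> norm (F (rcis r a) - H (rcis r a)) \<le> B * (r * exp (- (q * r)))"
    and far: "\<And>r. R < r \<Longrightarrow> norm (F (rcis r a)) \<le> B * (r * exp (- (q * r)))"
  shows "norm ((LINT r:{\<kappa>..}|lborel. F (rcis r a) * cis a) - (g (rcis R a) - g (rcis \<kappa> a))) \<le> B / q\<^sup>2"
proof -
  have FTC: "has_bochner_integral lborel (\<lambda>r. indicator {\<kappa>..R} r *\<^sub>R (H (rcis r a) * cis a)) (g (rcis R a) - g (rcis \<kappa> a))"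
  proof (rule has_bochner_integral_FTC_Icc)
    fix r assume r: "\<kappa> \<le> r" "r \<le> R"
    have "((\<lambda>r. rcis r a) has_vector_derivative cis a) (at r within {\<kappa>..R})"
      unfolding rcis_def by (auto intro!: derivative_eq_intros)
    from field_vector_diff_chain_within[OF this has_field_derivative_at_within[OF g]] r
    show "((\<lambda>r. g (rcis r a)) has_vector_derivative H (rcis r a) * cis a) (at r within {\<kappa>..R})"
      by (simp add: o_def mult.commute)
  qed (use \<kappa> H in \<open>auto intro!: continuous_intros\<close>)
  define X where "X r = indicator {\<kappa>..} r *\<^sub>R (F (rcis r a) * cis a) - indicator {\<kappa>..R} r *\<^sub>R (H (rcis r a) * cis a)" for r
  have intF: "integrable lborel (\<lambda>r. indicator {\<kappa>..} r *\<^sub>R (F (rcis r a) * cis a))"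
    using F unfolding set_integrable_def .
  have "(LINT r:{\<kappa>..}|lborel. F (rcis r a) * cis a) - (g (rcis R a) - g (rcis \<kappa> a)) = (\<integral>r. X r \<partial>lborel)"
    unfolding X_def set_lebesgue_integral_def
    using intF FTC by (subst Bochner_Integration.integral_diff) (auto simp: has_bochner_integral_iff)
  also have "norm \<dots> \<le> (\<integral>r. B * (indicator {\<kappa>..} r * (r * exp (- (q * r)))) \<partial>lborel)"
  proof (rule Bochner_Integration.integral_norm_bound_integral)
    show "integrable lborel X"
      unfolding X_def[abs_def] using intF FTC by (auto simp: has_bochner_integral_iff)
    show "integrable lborel (\<lambda>r. B * (indicator {\<kappa>..} r * (r * exp (- (q * r)))))"
      using integral_linear_exp(1)[OF q \<kappa>(1)] by (rule integrable_mult_right)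
    show "norm (X r) \<le> B * (indicator {\<kappa>..} r * (r * exp (- (q * r))))" for r
    proof (cases "\<kappa> \<le> r")
      case True
      show ?thesis
      proof (cases "r \<le> R")
        case le: True
        have "X r = (F (rcis r a) - H (rcis r a)) * cis a" using True le by (simp add: X_def algebra_simps)
        then show ?thesis using near[OF True le] True by (simp add: norm_mult)
      next
        case False
        then have "X r = F (rcis r a) * cis a" using True by (simp add: X_def)
        then show ?thesis using far[of r] False True by (simp add: norm_mult)
      qed
    qed (simp add: X_def)
  qed
  also have "\<dots> \<le> B * (1 / q\<^sup>2)"
  proof -
    \<comment> \<open>The sign of \<open>B\<close> is read off from the majorant at one point beyond
      \<open>R\<close>.\<close>
    have "0 \<le> B * ((R + 1) * exp (- (q * (R + 1))))"
      using far[of "R + 1"] norm_ge_zero order_trans by (metis less_add_one)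
    moreover have "0 < (R + 1) * exp (- (q * (R + 1)))" using \<kappa> by simp
    ultimately have "0 \<le> B" by (simp only: zero_le_mult_iff) auto
    then show ?thesis
      using integral_linear_exp(2)[OF q \<kappa>(1)] by (simp only: integral_mult_right_zero mult_left_mono)
  qed
  finally show ?thesis by simp
qed

text \<open>The increments of \<open>g\<close> over the two ray pieces and the arc telescope to the
  increment between the endpoints; this is why \<open>H\<close> is represented by a primitive rather
  than by an integral.\<close>

lemma Gamma_integral_bound:
  fixes F H g :: "complex \<Rightarrow> complex"
  assumes I: "has_Gamma_integral \<theta> \<kappa> F I" and \<theta>: "0 \<le> \<theta>" and \<kappa>: "0 < \<kappa>" "\<kappa> \<le> R" and q: "0 < q"
    and S: "\<And>r. \<kappa> \<le> r \<Longrightarrow> r \<le> R \<Longrightarrow> rcis r \<theta> \<in> S \<and> rcis r (- \<theta>) \<in> S"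
      "\<And>b. \<bar>b\<bar> \<le> \<theta> \<Longrightarrow> rcis \<kappa> b \<in> S"
    and g: "\<And>z. z \<in> S \<Longrightarrow> (g has_field_derivative H z) (at z)"
    and H: "continuous_on S H"
    and near: "\<And>r b. \<kappa> \<le> r \<Longrightarrow> r \<le> R \<Longrightarrow> \<bar>b\<bar> = \<theta> \<Longrightarrow> norm (F (rcis r b) - H (rcis r b)) \<le> B * (r * exp (- (q * r)))"
    and far: "\<And>r b. R < r \<Longrightarrow> \<bar>b\<bar> = \<theta> \<Longrightarrow> norm (F (rcis r b)) \<le> B * (r * exp (- (q * r)))"
    and arc: "\<And>b. \<bar>b\<bar> \<le> \<theta> \<Longrightarrow> norm (F (rcis \<kappa> b) - H (rcis \<kappa> b)) \<le> A"
  shows "norm (I - (g (rcis R \<theta>) - g (rcis R (- \<theta>)))) \<le> 2 * B / q\<^sup>2 + A * \<kappa> * (2 * \<theta>)"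
proof -
  let ?p = "part_circlepath 0 \<kappa> (- \<theta>) \<theta>"
  define I1 I2 I3 where "I1 = (LINT r:{\<kappa>..}|lborel. F (rcis r (- \<theta>)) * cis (- \<theta>))"
    and "I2 = contour_integral ?p F" and "I3 = (LINT r:{\<kappa>..}|lborel. F (rcis r \<theta>) * cis \<theta>)"
  have G: "set_integrable lborel {\<kappa>..} (\<lambda>r. F (rcis r (- \<theta>)) * cis (- \<theta>))" "F contour_integrable_on ?p"
    "set_integrable lborel {\<kappa>..} (\<lambda>r. F (rcis r \<theta>) * cis \<theta>)" "I = - I1 + I2 + I3"
    using I unfolding has_Gamma_integral_def I1_def I2_def I3_def by auto
  have ray: "norm ((LINT r:{\<kappa>..}|lborel. F (rcis r b) * cis b) - (g (rcis R b) - g (rcis \<kappa> b))) \<le> B / q\<^sup>2"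
    if b: "b = \<theta> \<or> b = - \<theta>" for b
  proof (rule ray_integral_bound[where H = H])
    have rS: "rcis r b \<in> S" if "r \<in> {\<kappa>..R}" for r using S(1)[of r] that b by auto
    show "(g has_field_derivative H (rcis r b)) (at (rcis r b))" if "r \<in> {\<kappa>..R}" for r
      using g[OF rS[OF that]] .
    show "continuous_on {\<kappa>..R} (\<lambda>r. H (rcis r b))"
      unfolding rcis_def
      by (rule continuous_on_compose2[OF H]) (use rS in \<open>auto intro!: continuous_intros simp: rcis_def\<close>)
    have \<theta>b: "\<bar>b\<bar> = \<theta>" using b \<theta> by auto
    show "norm (F (rcis r b) - H (rcis r b)) \<le> B * (r * exp (- (q * r)))" if "\<kappa> \<le> r" "r \<le> R" for r
      using near[OF that \<theta>b] .
    show "norm (F (rcis r b)) \<le> B * (r * exp (- (q * r)))" if "R < r" for r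
      using far[OF that \<theta>b] .
  qed (use G b \<kappa> q in auto)
  have r1: "norm (I1 - (g (rcis R (- \<theta>)) - g (rcis \<kappa> (- \<theta>)))) \<le> B / q\<^sup>2"
    and r3: "norm (I3 - (g (rcis R \<theta>) - g (rcis \<kappa> \<theta>))) \<le> B / q\<^sup>2"
    using ray[of "- \<theta>"] ray[of \<theta>] by (auto simp: I1_def I3_def)
  have img: "\<exists>b. \<bar>b\<bar> \<le> \<theta> \<and> z = rcis \<kappa> b" if "z \<in> path_image ?p" for z
    using that \<theta> unfolding path_image_part_circlepath'[of 0 \<kappa> "- \<theta>" \<theta>]
    by (force simp: rcis_def closed_segment_eq_real_ivl abs_le_iff)
  have "(H has_contour_integral (g (pathfinish ?p) - g (pathstart ?p))) ?p"
  proof (rule contour_integral_primitive[where S = S])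
    show "(g has_field_derivative H x) (at x within S)" if "x \<in> S" for x
      using g[OF that] by (rule has_field_derivative_at_within)
    show "path_image ?p \<subseteq> S" using img S(2) by blast
  qed simp
  moreover have "pathfinish ?p = rcis \<kappa> \<theta>" "pathstart ?p = rcis \<kappa> (- \<theta>)"
    by (auto simp: rcis_def cis_conv_exp)
  ultimately have Hint: "(H has_contour_integral (g (rcis \<kappa> \<theta>) - g (rcis \<kappa> (- \<theta>)))) ?p" by simp
  have "((\<lambda>z. F z - H z) has_contour_integral (I2 - (g (rcis \<kappa> \<theta>) - g (rcis \<kappa> (- \<theta>))))) ?p"
    unfolding I2_def by (intro has_contour_integral_diff has_contour_integral_integral G Hint)
  then have r2: "norm (I2 - (g (rcis \<kappa> \<theta>) - g (rcis \<kappa> (- \<theta>)))) \<le> A * \<kappa> * (\<theta> - - \<theta>)"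
  proof (rule has_contour_integral_bound_part_circlepath)
    show "0 \<le> A" using arc[of \<theta>] \<theta> norm_ge_zero order_trans by (metis abs_of_nonneg order_refl)
    show "norm (F z - H z) \<le> A" if "z \<in> path_image ?p" for z
      using img[OF that] arc by auto
  qed (use \<kappa> \<theta> in auto)
  have "I - (g (rcis R \<theta>) - g (rcis R (- \<theta>))) = (I3 - (g (rcis R \<theta>) - g (rcis \<kappa> \<theta>)))
      - (I1 - (g (rcis R (- \<theta>)) - g (rcis \<kappa> (- \<theta>)))) + (I2 - (g (rcis \<kappa> \<theta>) - g (rcis \<kappa> (- \<theta>))))"
    using G(4) by simp
  also have "norm \<dots> \<le> B / q\<^sup>2 + B / q\<^sup>2 + A * \<kappa> * (\<theta> - - \<theta>)"
    by (intro order_trans[OF norm_triangle_ineq] add_mono order_trans[OF norm_triangle_ineq4] r1 r2 r3)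
  finally show ?thesis by simp
qed

section \<open>The discrete scheme\<close>

text \<open>The power jumps across its branch cut, so measurability comes from its continuity on the
  complement of the cut.\<close>

lemma borel_measurable_powr_complex:
  assumes [measurable]: "f \<in> borel_measurable M" and "\<And>x. f x \<notin> \<real>\<^sub>\<le>\<^sub>0"
  shows "(\<lambda>x. f x powr (w :: complex)) \<in> borel_measurable M"
proof -
  have [measurable]: "(\<lambda>z::complex. indicator (- \<real>\<^sub>\<le>\<^sub>0) z *\<^sub>R (z powr w)) \<in> borel_measurable borel"
    by (rule borel_measurable_continuous_on_indicator)
       (auto intro!: borel_open holomorphic_on_imp_continuous_on holomorphic_intros simp: open_Compl)
  have "(\<lambda>x. indicator (- \<real>\<^sub>\<le>\<^sub>0) (f x) *\<^sub>R (f x powr w)) \<in> borel_measurable M"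
    by measurable
  then show ?thesis using assms(2) by simp
qed

lemma powr_divide_of_real:
  fixes b :: complex
  assumes "0 < (t::real)"
  shows "(b / of_real t) powr of_real a = b powr of_real a / of_real (t powr a)"
proof (cases "b = 0")
  case False
  have "Ln (b / of_real t) = Ln (of_real (1 / t) * b)" by (simp add: field_simps)
  also have "\<dots> = Ln (of_real (1 / t)) + Ln b"
    using assms False by (subst Ln_times_of_real) (simp_all add: Ln_of_real)
  also have "Ln (complex_of_real (1 / t)) = of_real (ln (1 / t))" using assms by (intro Ln_of_real) simp
  finally have "Ln (b / of_real t) = Ln b - of_real (ln t)" using assms by (simp add: ln_div)
  then show ?thesis
    using assms False by (simp add: powr_def right_diff_distrib exp_diff flip: exp_of_real)
qed simp

lemma sum_convolution_swap:
  fixes a b :: "nat \<Rightarrow> 'c::comm_ring"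
  shows "(\<Sum>n=1..N. \<Sum>i<n. a i * b (n - i)) = (\<Sum>j=1..N. (\<Sum>i\<le>N - j. a i) * b j)"
proof (induction N)
  case (Suc N)
  have "(\<Sum>j=1..Suc N. (\<Sum>i\<le>Suc N - j. a i) * b j) = (\<Sum>j=1..N. (\<Sum>i\<le>Suc N - j. a i) * b j) + a 0 * b (Suc N)"
    by simp
  also have "(\<Sum>j=1..N. (\<Sum>i\<le>Suc N - j. a i) * b j) = (\<Sum>j=1..N. (\<Sum>i\<le>N - j. a i) * b j + a (Suc N - j) * b j)"
    by (intro sum.cong refl) (simp add: Suc_diff_le algebra_simps)
  also have "\<dots> + a 0 * b (Suc N) = (\<Sum>j=1..N. (\<Sum>i\<le>N - j. a i) * b j) + (\<Sum>j=1..Suc N. a (Suc N - j) * b j)"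
    by (simp add: sum.distrib add.assoc)
  also have "(\<Sum>j=1..Suc N. a (Suc N - j) * b j) = (\<Sum>i<Suc N. a i * b (Suc N - i))"
    by (rule sum.reindex_bij_witness[where i = "\<lambda>i. Suc N - i" and j = "\<lambda>j. Suc N - j"]) auto
  finally show ?case using Suc by simp
qed simp

text \<open>The weight of the initial value in step j after the shift: the half added to G^1 raises
  its weight from 1 to 3/2.\<close>

definition bdf2_weight :: "nat \<Rightarrow> complex" where
  "bdf2_weight j = (if j = 1 then 3/2 else 1)"

lemma bdf2_source_expand:
  assumes "w \<noteq> 1" "1 \<le> N"
  shows "(\<Sum>j=1..N. bdf2_weight j * w ^ j) = bdf2_source w - w ^ Suc N / (1 - w)"
  using assms(2)
proof (induction N rule: nat_induct_at_least)
  case base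
  have "w / (1 - w) - w ^ Suc 1 / (1 - w) = w * (1 - w) / (1 - w)"
    unfolding diff_divide_distrib[symmetric] by (simp add: algebra_simps)
  then have "w / (1 - w) - w ^ Suc 1 / (1 - w) = w" using assms(1) by simp
  then have "bdf2_source w - w ^ Suc 1 / (1 - w) = w + w / 2"
    unfolding bdf2_source_def by (simp only: diff_add_eq[symmetric])
  then show ?case by (simp only: bdf2_weight_def) simp
next
  case (Suc n)
  have "(\<Sum>j=1..Suc n. bdf2_weight j * w ^ j) = bdf2_source w - w ^ Suc n / (1 - w) + w ^ Suc n"
    using Suc by (simp add: bdf2_weight_def)
  also have "\<dots> = bdf2_source w - w ^ Suc (Suc n) / (1 - w)"
    using assms(1) by (simp add: field_simps)
  finally show ?case .
qed

text \<open>The truncation of the generating function leaves only terms of order \<open>N + 1\<close>.\<close>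
lemma bdf2_residual_identity:
  fixes D w z e G :: complex and W d :: "nat \<Rightarrow> complex"
  assumes w: "w = z * e" "w \<noteq> 1" and N: "1 \<le> N"
  shows "(\<Sum>n=1..N. z ^ n * (D * W n + (e ^ n * G * (\<Sum>i<n. d i * bdf2_weight (n - i)) - (\<Sum>i<n. d i * e ^ i * W (n - i)))))
    = D * bdf2_source w * G - D * (w ^ Suc N / (1 - w)) * G
      + (\<Sum>j=1..N. (D - (\<Sum>i\<le>N - j. d i * w ^ i)) * (z ^ j * W j - bdf2_weight j * w ^ j * G))"
proof -
  define X where "X j = z ^ j * W j - bdf2_weight j * w ^ j * G" for j
  have "z ^ n * (D * W n + (e ^ n * G * (\<Sum>i<n. d i * bdf2_weight (n - i)) - (\<Sum>i<n. d i * e ^ i * W (n - i))))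
      = D * (z ^ n * W n) - (\<Sum>i<n. (d i * w ^ i) * X (n - i))" for n
  proof -
    have "(\<Sum>i<n. (d i * w ^ i) * X (n - i)) = (\<Sum>i<n. z ^ n * (d i * e ^ i * W (n - i)) - z ^ n * e ^ n * G * (d i * bdf2_weight (n - i)))"
    proof (rule sum.cong)
      fix i assume "i \<in> {..<n}"
      then have "z ^ n = z ^ i * z ^ (n - i)" "e ^ n = e ^ i * e ^ (n - i)"
        by (simp_all flip: power_add)
      then show "(d i * w ^ i) * X (n - i) = z ^ n * (d i * e ^ i * W (n - i)) - z ^ n * e ^ n * G * (d i * bdf2_weight (n - i))"
        by (simp add: X_def w(1) power_mult_distrib right_diff_distrib mult_ac)
    qed simp
    also have "\<dots> = z ^ n * (\<Sum>i<n. d i * e ^ i * W (n - i)) - z ^ n * e ^ n * G * (\<Sum>i<n. d i * bdf2_weight (n - i))"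
      by (simp add: sum_subtractf sum_distrib_left)
    finally show ?thesis by (simp add: algebra_simps)
  qed
  then have "(\<Sum>n=1..N. z ^ n * (D * W n + (e ^ n * G * (\<Sum>i<n. d i * bdf2_weight (n - i)) - (\<Sum>i<n. d i * e ^ i * W (n - i)))))
      = D * (\<Sum>n=1..N. z ^ n * W n) - (\<Sum>n=1..N. \<Sum>i<n. (d i * w ^ i) * X (n - i))"
    by (simp add: sum_subtractf sum_distrib_left)
  also have "(\<Sum>n=1..N. \<Sum>i<n. (d i * w ^ i) * X (n - i)) = (\<Sum>j=1..N. (\<Sum>i\<le>N - j. d i * w ^ i) * X j)"
    by (rule sum_convolution_swap)
  also have "(\<Sum>n=1..N. z ^ n * W n) = (\<Sum>j=1..N. X j) + (\<Sum>j=1..N. bdf2_weight j * w ^ j) * G"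
    by (simp add: X_def sum_subtractf sum_distrib_right)
  finally show ?thesis
    unfolding bdf2_source_expand[OF w(2) N] X_def[symmetric]
    by (simp add: left_diff_distrib right_diff_distrib distrib_left sum_subtractf sum_distrib_left mult_ac)
qed

text \<open>One constant serves all truncation orders up to N, because every tail is compared with
  the same absolutely convergent series at 1/2; convergence at 3/4 supplies it.\<close>

lemma bdf2_coeff_tail:
  assumes "0 < \<tau>"
  obtains C where "0 \<le> C"
    "\<And>k w. k \<le> N \<Longrightarrow> norm w \<le> 1/2 \<Longrightarrow>
      norm (bdf2_symbol \<alpha> \<tau> w - (\<Sum>i\<le>k. bdf2_coeff \<alpha> \<tau> i * w ^ i)) \<le> C * norm w ^ Suc k"
proof -
  let ?d = "bdf2_coeff \<alpha> \<tau>"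
  have sm: "summable (\<lambda>i. norm (?d i * (1/2) ^ i))"
    by (rule powser_insidea[where x = "3/4"])
       (use sums_summable[OF bdf2_coeff_sums[OF assms, of "3/4" \<alpha>]] in \<open>auto simp: norm_divide\<close>)
  define C where "C = 2 ^ Suc N * (\<Sum>i. norm (?d i * (1/2) ^ i))"
  show ?thesis
  proof (rule that[of C])
    show "0 \<le> C" unfolding C_def by (intro mult_nonneg_nonneg suminf_nonneg sm) auto
    fix k w assume k: "k \<le> N" and w: "norm (w::complex) \<le> 1/2"
    have sms: "(\<lambda>i. ?d i * w ^ i) sums bdf2_symbol \<alpha> \<tau> w"
      using bdf2_coeff_sums[OF assms] w by simp
    have sms2: "(\<lambda>i. ?d (i + Suc k) * w ^ (i + Suc k)) sums (bdf2_symbol \<alpha> \<tau> w - (\<Sum>i<Suc k. ?d i * w ^ i))"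
      using sums_split_initial_segment[OF sms] .
    have le: "norm (?d (i + Suc k) * w ^ (i + Suc k)) \<le> norm w ^ Suc k * 2 ^ Suc k * norm (?d (i + Suc k) * (1/2) ^ (i + Suc k))" for i
    proof -
      have "norm (?d (i + Suc k) * w ^ (i + Suc k)) = norm w ^ Suc k * (norm (?d (i + Suc k)) * norm w ^ i)"
        by (simp add: norm_mult norm_power power_add mult_ac)
      also have "\<dots> \<le> norm w ^ Suc k * (norm (?d (i + Suc k)) * (1/2) ^ i)"
        using w by (intro mult_left_mono power_mono) auto
      also have "\<dots> = norm w ^ Suc k * 2 ^ Suc k * norm (?d (i + Suc k) * (1/2) ^ (i + Suc k))"
        by (simp add: norm_mult norm_power norm_divide power_add field_simps)
      finally show ?thesis .
    qed
    have sm': "summable (\<lambda>i. norm w ^ Suc k * 2 ^ Suc k * norm (?d (i + Suc k) * (1/2) ^ (i + Suc k)))"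
      by (intro summable_mult) (use sm in \<open>subst summable_iff_shift\<close>)
    have "norm (\<Sum>i. ?d (i + Suc k) * w ^ (i + Suc k)) \<le> (\<Sum>i. norm w ^ Suc k * 2 ^ Suc k * norm (?d (i + Suc k) * (1/2) ^ (i + Suc k)))"
      by (rule norm_suminf_le[OF le sm'])
    also have "\<dots> = norm w ^ Suc k * 2 ^ Suc k * (\<Sum>i. norm (?d (i + Suc k) * (1/2) ^ (i + Suc k)))"
      by (rule suminf_mult) (use sm in \<open>subst summable_iff_shift\<close>)
    also have "\<dots> \<le> norm w ^ Suc k * (2 ^ Suc N) * (\<Sum>i. norm (?d i * (1/2) ^ i))"
    proof (intro mult_mono mult_left_mono)
      show "(2::real) ^ Suc k \<le> 2 ^ Suc N" using k by (intro power_increasing) auto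
      show "(\<Sum>i. norm (?d (i + Suc k) * (1/2) ^ (i + Suc k))) \<le> (\<Sum>i. norm (?d i * (1/2) ^ i))"
        unfolding suminf_split_initial_segment[OF sm, of "Suc k"] by (simp add: sum_nonneg)
      show "0 \<le> (\<Sum>i. norm (?d (i + Suc k) * (1/2) ^ (i + Suc k)))"
        by (intro suminf_nonneg) (use sm in \<open>subst summable_iff_shift\<close>, auto)
    qed auto
    finally have "norm (\<Sum>i. ?d (i + Suc k) * w ^ (i + Suc k)) \<le> C * norm w ^ Suc k"
      by (simp add: C_def mult_ac)
    with sms2 show "norm (bdf2_symbol \<alpha> \<tau> w - (\<Sum>i\<le>k. ?d i * w ^ i)) \<le> C * norm w ^ Suc k"
      by (simp add: sums_iff lessThan_Suc_atMost)
  qed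
qed

section \<open>The resolvent problem of the scheme\<close>

locale bdf2_setting =
  fixes \<Omega> :: "'a::euclidean_space set" and \<alpha> \<tau> M \<epsilon> c :: real and V G0 :: "'a \<Rightarrow> complex"
  assumes \<Omega>: "open \<Omega>" and \<alpha>: "0 < \<alpha>" "\<alpha> < 1" and \<tau>: "0 < \<tau>"
    and V_meas [measurable]: "V \<in> borel_measurable (lebesgue_on \<Omega>)" and V_le: "\<And>x. norm (V x) \<le> M"
    and G0: "G0 \<in> L2 \<Omega>"
    and \<epsilon>: "0 < \<epsilon>" "\<epsilon> \<le> 1/2" and c: "0 < c"
    and sector: "\<And>b. b \<noteq> 0 \<Longrightarrow> - \<epsilon> * norm b \<le> Re b \<Longrightarrow> c * norm b powr \<alpha> \<le> Re (b powr of_real \<alpha>)"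
begin

text \<open>The variable w of the generating function with z replaced by e^(-z \<tau>), where
  \<open>V\<close> stands for \<rho> U. Then \<open>bdf2_delta (pt z x) / \<tau>\<close> is the
  discrete counterpart of \<open>z + V x\<close>.\<close>

definition pt :: "complex \<Rightarrow> 'a \<Rightarrow> complex" where
  "pt z x = exp (- (of_real \<tau> * (z + V x)))"

definition mul :: "complex \<Rightarrow> 'a \<Rightarrow> complex" where
  "mul z x = bdf2_symbol \<alpha> \<tau> (pt z x)"

definition src :: "complex \<Rightarrow> 'a \<Rightarrow> complex" where
  "src z x = of_real \<tau> * mul z x * bdf2_source (pt z x)"

text \<open>The choice depends on the multiplier and the right-hand side only, so equal data give
  literally equal solutions; \<open>sol_periodic\<close> rests on this.\<close>

definition sol :: "complex \<Rightarrow> 'a \<Rightarrow> complex" where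
  "sol z = (SOME u. resolvent_eq \<Omega> (mul z) (\<lambda>x. src z x * G0 x) u)"

text \<open>The conditions, uniform in \<open>x\<close>, under which the discrete resolvent problem
  is solvable and holomorphic in \<open>z\<close>: the sector condition, and a distance from the
  zero of the multiplier and the pole of the source. The constant \<open>a\<close> may depend on
  \<tau>.\<close>

definition admissible :: "real \<Rightarrow> complex \<Rightarrow> bool" where
  "admissible a z \<longleftrightarrow> (\<forall>x. - \<epsilon> * norm (bdf2_delta (pt z x)) \<le> Re (bdf2_delta (pt z x)) \<and>
     a \<le> norm (bdf2_delta (pt z x)) \<and> a \<le> norm (1 - pt z x) \<and> norm (pt z x) \<le> 2)"

lemma M_nonneg: "0 \<le> M"
  using V_le norm_ge_zero order_trans by blast

lemma mul_eq: "mul z x = (bdf2_delta (pt z x) / of_real \<tau>) powr of_real \<alpha>"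
  by (simp add: mul_def bdf2_symbol_def bdf2_delta_def)

lemma norm_mul: "norm (mul z x) = (norm (bdf2_delta (pt z x)) / \<tau>) powr \<alpha>"
  using \<tau> by (simp add: mul_eq norm_powr_of_real norm_divide)

text \<open>A nonpositive number in the sector would satisfy |d| \<le> \<epsilon> |d| with
  \<epsilon> \<le> 1/2. This keeps the base of the power off its branch cut.\<close>

lemma admissible_not_nonpos:
  assumes "admissible a z" "0 < a"
  shows "bdf2_delta (pt z x) / of_real \<tau> \<notin> \<real>\<^sub>\<le>\<^sub>0"
proof
  define d where "d = bdf2_delta (pt z x)"
  assume "bdf2_delta (pt z x) / of_real \<tau> \<in> \<real>\<^sub>\<le>\<^sub>0"
  then have d: "Im d = 0" "Re d \<le> 0"
    using \<tau> by (auto simp: complex_nonpos_Reals_iff d_def divide_le_0_iff)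
  then have "norm d = - Re d" by (simp add: cmod_eq_Re)
  moreover have "- \<epsilon> * norm d \<le> Re d" "a \<le> norm d" using assms by (auto simp: admissible_def d_def)
  ultimately have "norm d \<le> \<epsilon> * norm d" by simp
  also have "\<dots> \<le> (1/2) * norm d" using \<epsilon> by (intro mult_right_mono) auto
  finally show False using \<open>a \<le> norm d\<close> assms(2) by simp
qed

lemma mul_bounds:
  assumes "admissible a z" "0 < a"
  shows "c * norm (mul z x) \<le> Re (mul z x)" "(a / \<tau>) powr \<alpha> \<le> norm (mul z x)"
    "norm (mul z x) \<le> (8 / \<tau>) powr \<alpha>"
proof -
  define d where "d = bdf2_delta (pt z x)"
  have d: "- \<epsilon> * norm d \<le> Re d" "a \<le> norm d" "norm (pt z x) \<le> 2"
    using assms by (auto simp: admissible_def d_def)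
  have "- \<epsilon> * norm (d / of_real \<tau>) \<le> Re (d / of_real \<tau>)"
    using divide_right_mono[OF d(1), of \<tau>] \<tau> by (simp add: norm_divide)
  moreover have "d / of_real \<tau> \<noteq> 0" using d assms \<tau> by auto
  ultimately show "c * norm (mul z x) \<le> Re (mul z x)"
    using sector[of "d / of_real \<tau>"] by (simp add: mul_eq d_def norm_powr_of_real)
  show "(a / \<tau>) powr \<alpha> \<le> norm (mul z x)"
    unfolding norm_mul d_def[symmetric] using d assms \<tau> \<alpha> by (intro powr_mono2 divide_right_mono) auto
  have "norm d = norm (1 - pt z x) * norm (3 - pt z x) / 2"
    by (simp add: d_def bdf2_delta_factor norm_mult norm_divide)
  \<comment> \<open>For |w| \<le> 2 the product is at most 15/2, rounded up to the 8 of the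
    claim.\<close>
  also have "\<dots> \<le> 3 * 5 / 2"
    using d(3) norm_triangle_ineq4[of 1 "pt z x"] norm_triangle_ineq4[of 3 "pt z x"]
    by (intro divide_right_mono mult_mono) auto
  finally show "norm (mul z x) \<le> (8 / \<tau>) powr \<alpha>"
    unfolding norm_mul d_def[symmetric] using \<tau> \<alpha> by (intro powr_mono2 divide_right_mono) auto
qed

lemma Re_mul_lower:
  assumes "admissible a z" "0 < a"
  shows "c * (a / \<tau>) powr \<alpha> \<le> Re (mul z x)"
  using c by (intro order_trans[OF mult_left_mono[OF mul_bounds(2)[OF assms]] mul_bounds(1)[OF assms]]) auto

lemma src_bound:
  assumes "admissible a z" "0 < a"
  shows "norm (src z x) \<le> \<tau> * (8 / \<tau>) powr \<alpha> * (2 / a + 1)"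
proof -
  have pt: "a \<le> norm (1 - pt z x)" "norm (pt z x) \<le> 2" using assms by (auto simp: admissible_def)
  have "norm (bdf2_source (pt z x)) \<le> norm (pt z x) / norm (1 - pt z x) + norm (pt z x) / 2"
    unfolding bdf2_source_def using norm_triangle_ineq[of "pt z x / (1 - pt z x)" "pt z x / 2"]
    by (simp add: norm_divide)
  also have "\<dots> \<le> 2 / a + 1"
    using pt assms by (intro add_mono frac_le) auto
  finally have "norm (bdf2_source (pt z x)) \<le> 2 / a + 1" .
  then show ?thesis
    unfolding src_def norm_mult using mul_bounds(3)[OF assms, of x] \<tau> by (intro mult_mono) auto
qed

lemma pt_meas [measurable]: "pt z \<in> borel_measurable (lebesgue_on \<Omega>)"
  unfolding pt_def[abs_def] by measurable

lemma mul_meas: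
  assumes "admissible a z" "0 < a"
  shows "mul z \<in> borel_measurable (lebesgue_on \<Omega>)"
  unfolding mul_eq[abs_def]
  by (intro borel_measurable_powr_complex admissible_not_nonpos[OF assms])
     (unfold bdf2_delta_def, measurable)

lemma src_meas:
  assumes "admissible a z" "0 < a"
  shows "src z \<in> borel_measurable (lebesgue_on \<Omega>)"
  unfolding src_def[abs_def] bdf2_source_def
  using mul_meas[OF assms] by measurable

lemma src_L2:
  assumes "admissible a z" "0 < a"
  shows "(\<lambda>x. src z x * G0 x) \<in> L2 \<Omega>"
  using L2_mult[OF src_meas[OF assms] src_bound[OF assms] G0] .

lemma Re_mul_pos: "0 < a \<Longrightarrow> 0 < c * (a / \<tau>) powr \<alpha>"
  using c \<tau> by simp

lemma sol:
  assumes "admissible a z" "0 < a"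
  shows "resolvent_eq \<Omega> (mul z) (\<lambda>x. src z x * G0 x) (sol z)"
  unfolding sol_def
  by (rule someI_ex[OF resolvent_exists[OF \<Omega> mul_meas[OF assms] mul_bounds(3)[OF assms] Re_mul_lower[OF assms]
        src_L2[OF assms] Re_mul_pos[OF assms(2)]]])

text \<open>The powers of \<tau> in multiplier and source cancel up to one factor \<tau>, which the
  length 2 pi / \<tau> of the integration segment absorbs in \<open>scheme_bound\<close>.\<close>

lemma sol_bound:
  assumes "admissible a z" "0 < a"
  shows "l2_norm \<Omega> (sol z) \<le> \<tau> * (8 / a) powr \<alpha> * (2 / a + 1) / c * l2_norm \<Omega> G0"
proof -
  have "l2_norm \<Omega> (sol z) \<le> l2_norm \<Omega> (\<lambda>x. src z x * G0 x) / (c * (a / \<tau>) powr \<alpha>)"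
    by (rule resolvent_eq_bound[OF \<Omega> mul_meas[OF assms] mul_bounds(3)[OF assms] Re_mul_lower[OF assms]
        src_L2[OF assms] sol[OF assms] Re_mul_pos[OF assms(2)]])
  also have "\<dots> \<le> (\<tau> * (8 / \<tau>) powr \<alpha> * (2 / a + 1) * l2_norm \<Omega> G0) / (c * (a / \<tau>) powr \<alpha>)"
    using c by (intro divide_right_mono l2_norm_mult_le src_meas[OF assms] src_bound[OF assms] G0) auto
  also have "\<dots> = \<tau> * (8 / a) powr \<alpha> * (2 / a + 1) / c * l2_norm \<Omega> G0"
    using \<tau> c assms(2) by (simp add: powr_divide field_simps)
  finally show ?thesis .
qed

lemma sol_L2: "admissible a z \<Longrightarrow> 0 < a \<Longrightarrow> sol z \<in> L2 \<Omega>"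
  using resolvent_eq_L2[OF sol] .

lemma sol_holomorphic:
  assumes S: "open S" "\<And>z. z \<in> S \<Longrightarrow> admissible a z" and a: "0 < a" and \<phi>: "\<phi> \<in> L2 \<Omega>"
  shows "(\<lambda>z. l2_inner \<Omega> (sol z) \<phi>) holomorphic_on S"
proof -
  define B where "B = max ((8 / \<tau>) powr \<alpha>) (\<tau> * (8 / \<tau>) powr \<alpha> * (2 / a + 1))"
  have mul_hol: "(\<lambda>z. mul z x) holomorphic_on S" for x
  proof -
    define q where "q z = bdf2_delta (pt z x) / of_real \<tau>" for z
    have "q holomorphic_on S"
      unfolding q_def bdf2_delta_def pt_def using \<tau> by (intro holomorphic_intros) auto
    moreover have "q z \<notin> \<real>\<^sub>\<le>\<^sub>0" if "z \<in> S" for z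
      unfolding q_def by (rule admissible_not_nonpos[OF S(2)[OF that] a])
    ultimately have "(\<lambda>z. q z powr of_real \<alpha>) holomorphic_on S"
      by (intro holomorphic_intros) auto
    then show ?thesis by (simp add: mul_eq q_def)
  qed
  have src_hol: "(\<lambda>z. src z x) holomorphic_on S" for x
  proof -
    have "1 - pt z x \<noteq> 0" if "z \<in> S" for z
      using S(2)[OF that] a by (auto simp: admissible_def dest!: spec[of _ x])
    then show ?thesis
      unfolding src_def bdf2_source_def using mul_hol[of x]
      by (intro holomorphic_intros) (auto simp: pt_def intro!: holomorphic_intros)
  qed
  show ?thesis
  proof (rule resolvent_holomorphic[OF \<Omega> S(1) mul_hol _ _ _ src_hol _ _ Re_mul_pos[OF a] G0 \<phi>])
    fix z x assume "z \<in> S"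
    note adm = S(2)[OF this] a
    show "mul z \<in> borel_measurable (lebesgue_on \<Omega>)" "src z \<in> borel_measurable (lebesgue_on \<Omega>)"
      using mul_meas[OF adm] src_meas[OF adm] .
    show "norm (mul z x) \<le> B" "norm (src z x) \<le> B"
      using mul_bounds(3)[OF adm, of x] src_bound[OF adm, of x] by (auto simp: B_def le_max_iff_disj)
    show "c * (a / \<tau>) powr \<alpha> \<le> Re (mul z x)" by (rule Re_mul_lower[OF adm])
    show "resolvent_eq \<Omega> (mul z) (\<lambda>x. src z x * G0 x) (sol z)" by (rule sol[OF adm])
  qed
qed

text \<open>Here |w| < 1, so A-stability gives the sector condition with a nonnegative real
  part.\<close>

lemma halfplane_admissible:
  assumes z: "M + r \<le> Re z" and r: "0 < r"
  shows "norm (pt z x) \<le> exp (- (\<tau> * r))" "admissible (1 - exp (- (\<tau> * r))) z"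
proof -
  have le: "norm (pt z x) \<le> exp (- (\<tau> * r))" for x
  proof -
    have "r \<le> Re z + Re (V x)" using z abs_Re_le_cmod[of "V x"] V_le[of x] by linarith
    then show ?thesis using \<tau> by (simp add: pt_def)
  qed
  then show "norm (pt z x) \<le> exp (- (\<tau> * r))" .
  have r1: "exp (- (\<tau> * r)) < 1" using r \<tau> by simp
  show "admissible (1 - exp (- (\<tau> * r))) z"
    unfolding admissible_def
  proof (intro allI conjI)
    fix x
    have n1: "norm (pt z x) \<le> 1" using le[of x] r1 by linarith
    have "0 \<le> Re (bdf2_delta (pt z x))" by (rule Re_bdf2_delta_nonneg[OF n1])
    moreover have "- \<epsilon> * norm (bdf2_delta (pt z x)) \<le> 0" using \<epsilon> by simp
    ultimately show "- \<epsilon> * norm (bdf2_delta (pt z x)) \<le> Re (bdf2_delta (pt z x))" by linarith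
    show 1: "1 - exp (- (\<tau> * r)) \<le> norm (1 - pt z x)"
      using norm_triangle_ineq2[of 1 "pt z x"] le[of x] by simp
    have "2 \<le> norm (3 - pt z x)" using norm_triangle_ineq2[of 3 "pt z x"] n1 by simp
    then have "(1 - exp (- (\<tau> * r))) * 2 \<le> norm (1 - pt z x) * norm (3 - pt z x)"
      using 1 r1 by (intro mult_mono) auto
    then show "1 - exp (- (\<tau> * r)) \<le> norm (bdf2_delta (pt z x))"
      by (simp add: bdf2_delta_factor norm_mult norm_divide)
    show "norm (pt z x) \<le> 2" using n1 by simp
  qed
qed

lemma sol_periodic:
  "sol (Complex x (pi / \<tau>)) = sol (Complex x (- (pi / \<tau>)))"
proof -
  have "pt (Complex x (pi / \<tau>)) = pt (Complex x (- (pi / \<tau>)))"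
  proof
    fix y
    have "- (of_real \<tau> * (Complex x (- (pi / \<tau>)) + V y)) = - (of_real \<tau> * (Complex x (pi / \<tau>) + V y)) + \<i> * (of_int 1 * (of_real pi * 2))"
      using \<tau> by (simp add: complex_eq_iff algebra_simps)
    then show "pt (Complex x (pi / \<tau>)) y = pt (Complex x (- (pi / \<tau>))) y"
      unfolding pt_def by (simp only: exp_plus_2pin)
  qed
  then show ?thesis by (simp add: sol_def src_def[abs_def] mul_def[abs_def])
qed

text \<open>The scheme for the shifted unknowns: every step, the first included, has the same form
  and lies in the domain of A. At n = 1 the weight 3/2 is what d_0 + A produces on G^1 plus half the
  damped initial value.\<close>

definition scheme :: "nat \<Rightarrow> (nat \<Rightarrow> 'a \<Rightarrow> complex) \<Rightarrow> bool" where
  "scheme N W \<longleftrightarrow> (\<forall>n\<in>{1..N}. \<exists>AW. dirichlet_laplacian \<Omega> (W n) AW \<and>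
     (AE x in lebesgue_on \<Omega>.
        (\<Sum>i<n. bdf2_coeff \<alpha> \<tau> i * exp (- (of_real \<tau> * V x)) ^ i * W (n - i) x) + AW x
        = exp (- (of_real \<tau> * V x)) ^ n * G0 x * (\<Sum>i<n. bdf2_coeff \<alpha> \<tau> i * bdf2_weight (n - i))))"

text \<open>For large Re z the truncated generating function \<open>P\<close> solves the resolvent
  problem of \<open>sol z / \<tau>\<close> up to a residual of order e^(-(N+1) \<tau> Re z).
  \<open>K\<close> may depend on everything except \<open>z\<close>, since it is used only in the
  limit Re z to infinity.\<close>

lemma scheme_approx:
  assumes W: "scheme N W" and N: "1 \<le> N" and \<phi>: "\<phi> \<in> L2 \<Omega>"
  shows "\<exists>K. \<forall>z. M + 1 / \<tau> \<le> Re z \<longrightarrow>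
    norm (l2_inner \<Omega> (sol z) \<phi> - of_real \<tau> * (\<Sum>k=1..N. l2_inner \<Omega> (W k) \<phi> * exp (- (of_nat k * of_real \<tau> * z))))
      \<le> K * exp (- (real (Suc N) * \<tau> * Re z))"
proof -
  let ?d = "bdf2_coeff \<alpha> \<tau>"
  define e where "e x = exp (- (of_real \<tau> * V x))" for x
  have "\<exists>AW. \<forall>n\<in>{1..N}. dirichlet_laplacian \<Omega> (W n) (AW n) \<and>
     (AE x in lebesgue_on \<Omega>. (\<Sum>i<n. ?d i * e x ^ i * W (n - i) x) + AW n x
        = e x ^ n * G0 x * (\<Sum>i<n. ?d i * bdf2_weight (n - i)))"
    using W unfolding scheme_def e_def by (rule bchoice)
  then obtain AW where AW: "\<And>n. n \<in> {1..N} \<Longrightarrow> dirichlet_laplacian \<Omega> (W n) (AW n)"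
    "\<And>n. n \<in> {1..N} \<Longrightarrow> AE x in lebesgue_on \<Omega>. (\<Sum>i<n. ?d i * e x ^ i * W (n - i) x) + AW n x
        = e x ^ n * G0 x * (\<Sum>i<n. ?d i * bdf2_weight (n - i))"
    by blast
  obtain C where C: "0 \<le> C" "\<And>k w. k \<le> N \<Longrightarrow> norm w \<le> 1/2 \<Longrightarrow>
      norm (bdf2_symbol \<alpha> \<tau> w - (\<Sum>i\<le>k. ?d i * w ^ i)) \<le> C * norm w ^ Suc k"
    using bdf2_coeff_tail[OF \<tau>] by metis
  have WL2: "W n \<in> L2 \<Omega>" if "n \<in> {1..N}" for n using dirichlet_laplacian_L2(1)[OF AW(1)[OF that]] .
  have [measurable]: "e \<in> borel_measurable (lebesgue_on \<Omega>)" unfolding e_def[abs_def] by measurable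
  define E where "E = exp (\<tau> * M)"
  have E: "1 \<le> E" using \<tau> M_nonneg by (simp add: E_def)
  have e_le: "norm (e x) \<le> E" for x
  proof -
    have "- Re (V x) \<le> M" using abs_Re_le_cmod[of "V x"] V_le[of x] by linarith
    from mult_left_mono[OF this, of \<tau>] show ?thesis using \<tau> by (simp add: e_def E_def)
  qed
  \<comment> \<open>The half-plane Re z \<ge> M + 1/\<tau> gives |w| \<le> e^(-1) \<le> 1/2, within
    reach of \<open>bdf2_coeff_tail\<close>.\<close>
  define a0 where "a0 = 1 - exp (- 1 :: real)"
  have a0: "0 < a0" by (simp add: a0_def)
  define c0 where "c0 = c * (a0 / \<tau>) powr \<alpha>"
  have c0: "0 < c0" unfolding c0_def by (rule Re_mul_pos[OF a0])
  define B where "B = (8 / \<tau>) powr \<alpha>"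
  define N0 where "N0 = l2_norm \<Omega> G0"
  define K0 where "K0 = E ^ Suc N * (B * 2 * N0 + (\<Sum>j=1..N. C * (l2_norm \<Omega> (W j) + 2 * N0)))"
  have K: "norm (l2_inner \<Omega> (sol z) \<phi> - of_real \<tau> * (\<Sum>k=1..N. l2_inner \<Omega> (W k) \<phi> * exp (- (of_nat k * of_real \<tau> * z))))
      \<le> (\<tau> * K0 / c0 * l2_norm \<Omega> \<phi>) * exp (- (real (Suc N) * \<tau> * Re z))"
    if z: "M + 1 / \<tau> \<le> Re z" for z
  proof -
    define \<zeta> where "\<zeta> = exp (- (of_real \<tau> * z))"
    have adm: "admissible a0 z" and pt1: "norm (pt z x) \<le> exp (- 1)" for x
      using halfplane_admissible[OF z] \<tau> by (auto simp: a0_def)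
    have "exp (- 1 :: real) \<le> 1/2" using exp_ge_add_one_self[of 1] by (simp add: exp_minus field_simps)
    then have pt: "norm (pt z x) \<le> 1/2" for x using pt1[of x] by linarith
    have pt_eq: "pt z x = \<zeta> * e x" for x
      by (simp add: pt_def \<zeta>_def e_def distrib_left flip: exp_add)
    have pt_ne: "pt z x \<noteq> 1" for x using pt[of x] by auto
    have n\<zeta>: "norm (pt z x) \<le> E * norm \<zeta>" for x
      unfolding pt_eq norm_mult using mult_right_mono[OF e_le[of x], of "norm \<zeta>"] by (simp add: mult.commute)
    \<comment> \<open>The pieces of the residual: \<open>R1\<close> stems from truncating the
      source, \<open>Tk j\<close> is the tail of the symbol met by step j, and \<open>Y j\<close> is
      the deviation of step j from its weighted initial value.\<close>
    define R1 where "R1 x = - (mul z x * (pt z x ^ Suc N / (1 - pt z x)))" for x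
    define Tk where "Tk j x = mul z x - (\<Sum>i\<le>N - j. ?d i * pt z x ^ i)" for j x
    define Y where "Y j x = \<zeta> ^ j * W j x - (bdf2_weight j * pt z x ^ j) * G0 x" for j x
    define \<rho> where "\<rho> x = R1 x * G0 x + (\<Sum>j=1..N. Tk j x * Y j x)" for x
    define P where "P x = (\<Sum>n=1..N. \<zeta> ^ n * W n x)" for x
    define AP where "AP x = (\<Sum>n=1..N. \<zeta> ^ n * AW n x)" for x
    have "dirichlet_laplacian \<Omega> P AP"
      unfolding P_def[abs_def] AP_def[abs_def]
      using N by (intro dirichlet_laplacian_sum[OF \<Omega>] dirichlet_laplacian_scale[OF \<Omega>] AW) auto
    moreover have "AE x in lebesgue_on \<Omega>. mul z x * P x + AP x = mul z x * bdf2_source (pt z x) * G0 x + \<rho> x"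
    proof -
      have "AE x in lebesgue_on \<Omega>. \<forall>n\<in>{1..N}. (\<Sum>i<n. ?d i * e x ^ i * W (n - i) x) + AW n x
        = e x ^ n * G0 x * (\<Sum>i<n. ?d i * bdf2_weight (n - i))"
        using AW(2) by (intro AE_finite_allI) auto
      then show ?thesis
      proof eventually_elim
        case (elim x)
        have "mul z x * P x + AP x = (\<Sum>n=1..N. \<zeta> ^ n * (mul z x * W n x + AW n x))"
          by (simp add: P_def AP_def sum_distrib_left sum.distrib distrib_left mult.left_commute)
        also have "\<dots> = (\<Sum>n=1..N. \<zeta> ^ n * (mul z x * W n x + (e x ^ n * G0 x * (\<Sum>i<n. ?d i * bdf2_weight (n - i))
            - (\<Sum>i<n. ?d i * e x ^ i * W (n - i) x))))"
        proof (intro sum.cong refl)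
          fix n assume "n \<in> {1..N}"
          then have "AW n x = e x ^ n * G0 x * (\<Sum>i<n. ?d i * bdf2_weight (n - i)) - (\<Sum>i<n. ?d i * e x ^ i * W (n - i) x)"
            using elim unfolding eq_diff_eq by (simp add: add.commute)
          then show "\<zeta> ^ n * (mul z x * W n x + AW n x) = \<zeta> ^ n * (mul z x * W n x + (e x ^ n * G0 x * (\<Sum>i<n. ?d i * bdf2_weight (n - i))
            - (\<Sum>i<n. ?d i * e x ^ i * W (n - i) x)))" by simp
        qed
        also have "\<dots> = mul z x * bdf2_source (pt z x) * G0 x - mul z x * (pt z x ^ Suc N / (1 - pt z x)) * G0 x
            + (\<Sum>j=1..N. (mul z x - (\<Sum>i\<le>N - j. ?d i * pt z x ^ i)) * (\<zeta> ^ j * W j x - bdf2_weight j * pt z x ^ j * G0 x))"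
          by (rule bdf2_residual_identity[OF pt_eq pt_ne N])
        also have "\<dots> = mul z x * bdf2_source (pt z x) * G0 x + \<rho> x"
          by (simp add: \<rho>_def R1_def Tk_def Y_def)
        finally show ?case .
      qed
    qed
    ultimately have "resolvent_eq \<Omega> (mul z) (\<lambda>x. mul z x * bdf2_source (pt z x) * G0 x + \<rho> x) P"
      unfolding resolvent_eq_def by blast
    from resolvent_eq_scale[OF \<Omega> this, of "of_real \<tau>"]
    have "resolvent_eq \<Omega> (mul z) (\<lambda>x. src z x * G0 x + of_real \<tau> * \<rho> x) (\<lambda>x. of_real \<tau> * P x)"
      by (simp add: src_def distrib_left mult.assoc)
    from resolvent_eq_diff[OF \<Omega> sol[OF adm a0] this]
    have res: "resolvent_eq \<Omega> (mul z) (\<lambda>x. - of_real \<tau> * \<rho> x) (\<lambda>x. sol z x - of_real \<tau> * P x)"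
      by simp
    have q0: "0 \<le> E * norm \<zeta>" using E by simp
    have R1_le: "norm (R1 x) \<le> B * ((E * norm \<zeta>) ^ Suc N * 2)" for x
    proof -
      have "1/2 \<le> norm (1 - pt z x)" using norm_triangle_ineq2[of 1 "pt z x"] pt[of x] by simp
      then have "norm (pt z x) ^ Suc N / norm (1 - pt z x) \<le> (E * norm \<zeta>) ^ Suc N / (1/2)"
        using n\<zeta>[of x] q0 by (intro frac_le power_mono) auto
      then show ?thesis
        unfolding R1_def norm_minus_cancel norm_mult norm_divide norm_power B_def
        using mul_bounds(3)[OF adm a0, of x] by (intro mult_mono) auto
    qed
    have Tk_le: "norm (Tk j x) \<le> C * (E * norm \<zeta>) ^ Suc (N - j)" for j x
    proof -
      have "norm (Tk j x) \<le> C * norm (pt z x) ^ Suc (N - j)"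
        unfolding Tk_def mul_def by (rule C(2)[OF _ pt]) simp
      also have "\<dots> \<le> C * (E * norm \<zeta>) ^ Suc (N - j)"
        using C(1) n\<zeta>[of x] by (intro mult_left_mono power_mono) auto
      finally show ?thesis .
    qed
    have w_meas: "(\<lambda>x. bdf2_weight j * pt z x ^ j) \<in> borel_measurable (lebesgue_on \<Omega>)" for j
      by measurable
    have w_le: "norm (bdf2_weight j * pt z x ^ j) \<le> 2 * (E * norm \<zeta>) ^ j" for j x
    proof -
      have "norm (bdf2_weight j) \<le> 2" by (simp add: bdf2_weight_def)
      then show ?thesis
        unfolding norm_mult norm_power using n\<zeta>[of x] by (intro mult_mono power_mono) auto
    qed
    have meas [measurable]: "mul z \<in> borel_measurable (lebesgue_on \<Omega>)" by (rule mul_meas[OF adm a0])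
    have R1_meas: "R1 \<in> borel_measurable (lebesgue_on \<Omega>)" unfolding R1_def[abs_def] by measurable
    have Tk_meas: "Tk j \<in> borel_measurable (lebesgue_on \<Omega>)" for j unfolding Tk_def[abs_def] by measurable
    have Y_L2: "Y j \<in> L2 \<Omega>" and Y_le: "l2_norm \<Omega> (Y j) \<le> (E * norm \<zeta>) ^ j * (l2_norm \<Omega> (W j) + 2 * N0)"
      if j: "j \<in> {1..N}" for j
    proof -
      have 1: "(\<lambda>x. \<zeta> ^ j * W j x) \<in> L2 \<Omega>" using WL2[OF j] by simp
      have 2: "(\<lambda>x. (bdf2_weight j * pt z x ^ j) * G0 x) \<in> L2 \<Omega>" by (rule L2_mult[OF w_meas w_le G0])
      show "Y j \<in> L2 \<Omega>" unfolding Y_def[abs_def] by (rule L2_diff[OF 1 2])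
      have "l2_norm \<Omega> (Y j) \<le> l2_norm \<Omega> (\<lambda>x. \<zeta> ^ j * W j x) + l2_norm \<Omega> (\<lambda>x. (bdf2_weight j * pt z x ^ j) * G0 x)"
        unfolding Y_def[abs_def] by (rule l2_norm_triangle_diff[OF 1 2])
      also have "\<dots> \<le> norm \<zeta> ^ j * l2_norm \<Omega> (W j) + 2 * (E * norm \<zeta>) ^ j * N0"
        unfolding N0_def l2_norm_scale norm_power by (intro add_mono order_refl l2_norm_mult_le[OF w_meas w_le G0])
      also have "norm \<zeta> ^ j * l2_norm \<Omega> (W j) \<le> (E * norm \<zeta>) ^ j * l2_norm \<Omega> (W j)"
        using E by (intro mult_right_mono power_mono) (auto simp: mult_le_cancel_right1)
      finally show "l2_norm \<Omega> (Y j) \<le> (E * norm \<zeta>) ^ j * (l2_norm \<Omega> (W j) + 2 * N0)"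
        by (simp add: algebra_simps)
    qed
    have TY_L2: "(\<lambda>x. Tk j x * Y j x) \<in> L2 \<Omega>" if "j \<in> {1..N}" for j
      by (rule L2_mult[OF Tk_meas Tk_le Y_L2[OF that]])
    have RG_L2: "(\<lambda>x. R1 x * G0 x) \<in> L2 \<Omega>" by (rule L2_mult[OF R1_meas R1_le G0])
    have sum_L2: "(\<lambda>x. \<Sum>j=1..N. Tk j x * Y j x) \<in> L2 \<Omega>" using TY_L2 by (rule L2_sum)
    have \<rho>_L2: "\<rho> \<in> L2 \<Omega>" unfolding \<rho>_def[abs_def] by (rule L2_add[OF RG_L2 sum_L2])
    have "l2_norm \<Omega> \<rho> \<le> l2_norm \<Omega> (\<lambda>x. R1 x * G0 x) + l2_norm \<Omega> (\<lambda>x. \<Sum>j=1..N. Tk j x * Y j x)"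
      unfolding \<rho>_def[abs_def] by (rule l2_norm_triangle[OF RG_L2 sum_L2])
    also have "\<dots> \<le> B * ((E * norm \<zeta>) ^ Suc N * 2) * N0 + (\<Sum>j=1..N. (E * norm \<zeta>) ^ Suc N * (C * (l2_norm \<Omega> (W j) + 2 * N0)))"
    proof (rule add_mono)
      show "l2_norm \<Omega> (\<lambda>x. R1 x * G0 x) \<le> B * ((E * norm \<zeta>) ^ Suc N * 2) * N0"
        unfolding N0_def by (rule l2_norm_mult_le[OF R1_meas R1_le G0])
      have "l2_norm \<Omega> (\<lambda>x. \<Sum>j=1..N. Tk j x * Y j x) \<le> (\<Sum>j=1..N. l2_norm \<Omega> (\<lambda>x. Tk j x * Y j x))"
        using TY_L2 by (rule l2_norm_sum_le)
      also have "\<dots> \<le> (\<Sum>j=1..N. (E * norm \<zeta>) ^ Suc N * (C * (l2_norm \<Omega> (W j) + 2 * N0)))"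
      proof (rule sum_mono)
        fix j assume j: "j \<in> {1..N}"
        have "l2_norm \<Omega> (\<lambda>x. Tk j x * Y j x) \<le> C * (E * norm \<zeta>) ^ Suc (N - j) * l2_norm \<Omega> (Y j)"
          by (rule l2_norm_mult_le[OF Tk_meas Tk_le Y_L2[OF j]])
        also have "\<dots> \<le> C * (E * norm \<zeta>) ^ Suc (N - j) * ((E * norm \<zeta>) ^ j * (l2_norm \<Omega> (W j) + 2 * N0))"
          using C(1) q0 by (intro mult_left_mono Y_le[OF j]) auto
        \<comment> \<open>The order N - j + 1 of the tail and the order j of the step always add up
          to N + 1.\<close>
        also have "\<dots> = (E * norm \<zeta>) ^ (Suc (N - j) + j) * (C * (l2_norm \<Omega> (W j) + 2 * N0))"
          by (simp only: power_add mult_ac)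
        also have "Suc (N - j) + j = Suc N" using j by simp
        finally show "l2_norm \<Omega> (\<lambda>x. Tk j x * Y j x) \<le> (E * norm \<zeta>) ^ Suc N * (C * (l2_norm \<Omega> (W j) + 2 * N0))" .
      qed
      finally show "l2_norm \<Omega> (\<lambda>x. \<Sum>j=1..N. Tk j x * Y j x) \<le> (\<Sum>j=1..N. (E * norm \<zeta>) ^ Suc N * (C * (l2_norm \<Omega> (W j) + 2 * N0)))" .
    qed
    also have "\<dots> = norm \<zeta> ^ Suc N * K0"
      unfolding K0_def sum_distrib_left[symmetric] power_mult_distrib by (simp only: distrib_left mult_ac)
    finally have \<rho>_le: "l2_norm \<Omega> \<rho> \<le> norm \<zeta> ^ Suc N * K0" .
    have PL2: "P \<in> L2 \<Omega>" unfolding P_def[abs_def] using WL2 by (intro L2_sum L2_scale)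
    have "l2_norm \<Omega> (\<lambda>x. sol z x - of_real \<tau> * P x) \<le> l2_norm \<Omega> (\<lambda>x. - of_real \<tau> * \<rho> x) / c0"
      unfolding c0_def
      by (rule resolvent_eq_bound[OF \<Omega> meas mul_bounds(3)[OF adm a0] Re_mul_lower[OF adm a0] L2_scale[OF \<rho>_L2] res Re_mul_pos[OF a0]])
    also have "\<dots> = \<tau> * l2_norm \<Omega> \<rho> / c0" using \<tau> by (simp only: l2_norm_scale norm_minus_cancel norm_of_real abs_of_pos)
    also have "\<dots> \<le> \<tau> * (norm \<zeta> ^ Suc N * K0) / c0"
      using \<rho>_le \<tau> c0 by (intro divide_right_mono mult_left_mono) auto
    finally have diff: "l2_norm \<Omega> (\<lambda>x. sol z x - of_real \<tau> * P x) \<le> \<tau> * (norm \<zeta> ^ Suc N * K0) / c0" .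
    have "l2_inner \<Omega> P \<phi> = (\<Sum>n=1..N. \<zeta> ^ n * l2_inner \<Omega> (W n) \<phi>)"
      unfolding P_def[abs_def] using WL2 \<phi> by (subst l2_inner_sum_left) (auto simp: l2_inner_scale_left)
    also have "\<dots> = (\<Sum>k=1..N. l2_inner \<Omega> (W k) \<phi> * exp (- (of_nat k * of_real \<tau> * z)))"
      by (intro sum.cong refl) (simp add: \<zeta>_def mult.assoc flip: exp_of_nat_mult)
    finally have "l2_inner \<Omega> (sol z) \<phi> - of_real \<tau> * (\<Sum>k=1..N. l2_inner \<Omega> (W k) \<phi> * exp (- (of_nat k * of_real \<tau> * z)))
        = l2_inner \<Omega> (\<lambda>x. sol z x - of_real \<tau> * P x) \<phi>"
      using sol_L2[OF adm a0] PL2 \<phi> by (simp add: l2_inner_diff_left l2_inner_scale_left)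
    also have "norm \<dots> \<le> l2_norm \<Omega> (\<lambda>x. sol z x - of_real \<tau> * P x) * l2_norm \<Omega> \<phi>"
      using sol_L2[OF adm a0] PL2 \<phi> by (intro l2_Cauchy_Schwarz) auto
    also have "\<dots> \<le> \<tau> * (norm \<zeta> ^ Suc N * K0) / c0 * l2_norm \<Omega> \<phi>"
      using diff by (intro mult_right_mono) auto
    also have "norm \<zeta> ^ Suc N = exp (- (real (Suc N) * \<tau> * Re z))"
      by (simp add: \<zeta>_def mult.assoc flip: exp_of_nat_mult del: of_nat_Suc power_Suc)
    finally show ?thesis by (simp only: mult_ac times_divide_eq_left times_divide_eq_right)
  qed
  then show ?thesis by blast
qed

text \<open>The region \<open>S\<close> of the primitive may reach into the left half-plane along
  the strip; this is what transfers the coefficient formula to the cut contour.\<close>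

lemma scheme_increment:
  assumes W: "scheme N W" and n: "n \<in> {1..N}" and \<phi>: "\<phi> \<in> L2 \<Omega>"
    and g: "\<And>z. z \<in> S \<Longrightarrow> (g has_field_derivative exp (of_nat n * of_real \<tau> * z) * l2_inner \<Omega> (sol z) \<phi>) (at z)"
    and S1: "\<And>x. x \<ge> x0 \<Longrightarrow> Complex x (pi / \<tau>) \<in> S \<and> Complex x (- (pi / \<tau>)) \<in> S"
    and S2: "\<And>z. \<sigma> \<le> Re z \<Longrightarrow> \<bar>Im z\<bar> \<le> pi / \<tau> \<Longrightarrow> z \<in> S"
  shows "g (Complex x0 (pi / \<tau>)) - g (Complex x0 (- (pi / \<tau>))) = 2 * of_real pi * \<i> * l2_inner \<Omega> (W n) \<phi>"
proof -
  have "1 \<le> N" using n by simp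
  then obtain K where K: "\<And>z. M + 1 / \<tau> \<le> Re z \<Longrightarrow>
    norm (l2_inner \<Omega> (sol z) \<phi> - of_real \<tau> * (\<Sum>k=1..N. l2_inner \<Omega> (W k) \<phi> * exp (- (of_nat k * of_real \<tau> * z))))
      \<le> K * exp (- (real (Suc N) * \<tau> * Re z))"
    using scheme_approx[OF W _ \<phi>] by blast
  show ?thesis
    by (rule primitive_period_increment[OF \<tau> n g S1, where ?\<sigma>0.0 = "max \<sigma> (M + 1 / \<tau>)" and K = K])
       (use S2 K sol_periodic in auto)
qed

end

text \<open>Completeness of Lebesgue measure on an open set. The initial value of the scheme is
  prescribed only almost everywhere, so measurability must survive changes on null sets.\<close>

lemma borel_measurable_AE_eq:
  fixes f g :: "'a::euclidean_space \<Rightarrow> 'b::topological_space"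
  assumes "open \<Omega>" "f \<in> borel_measurable (lebesgue_on \<Omega>)" "AE x in lebesgue_on \<Omega>. f x = g x"
  shows "g \<in> borel_measurable (lebesgue_on \<Omega>)"
proof -
  interpret complete_measure "lebesgue_on \<Omega>"
  proof
    fix A B :: "'a set" assume "B \<subseteq> A" "A \<in> null_sets (lebesgue_on \<Omega>)"
    then have "A \<subseteq> \<Omega>" "A \<in> null_sets lebesgue"
      using null_sets_restrict_space[of \<Omega> lebesgue] assms(1) by auto
    with \<open>B \<subseteq> A\<close> have "B \<in> sets lebesgue" "B \<subseteq> \<Omega>"
      using completion.complete2 by blast+
    then show "B \<in> sets (lebesgue_on \<Omega>)"
      using assms(1) by (simp add: sets_restrict_space_iff)
  qed
  show ?thesis
  proof (rule measurableI)
    fix X :: "'b set" assume "X \<in> sets borel"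
    then have fX: "f -` X \<inter> space (lebesgue_on \<Omega>) \<in> sets (lebesgue_on \<Omega>)"
      using assms(2) by (rule measurable_sets[rotated])
    have ae: "AE x in lebesgue_on \<Omega>. x \<in> f -` X \<inter> space (lebesgue_on \<Omega>) \<longleftrightarrow> x \<in> g -` X \<inter> space (lebesgue_on \<Omega>)"
      using assms(3) by eventually_elim simp
    show "g -` X \<inter> space (lebesgue_on \<Omega>) \<in> sets (lebesgue_on \<Omega>)"
      by (rule in_sets_AE[OF ae fX]) auto
  qed simp
qed

lemma L2_AE_eq:
  assumes "open \<Omega>" "f \<in> L2 \<Omega>" "AE x in lebesgue_on \<Omega>. f x = g x"
  shows "g \<in> L2 \<Omega>"
proof -
  have g: "g \<in> borel_measurable (lebesgue_on \<Omega>)" by (rule borel_measurable_AE_eq[OF assms(1) L2D(1)[OF assms(2)] assms(3)])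
  have "integrable (lebesgue_on \<Omega>) (\<lambda>x. (norm (g x))\<^sup>2)"
    by (rule integrable_cong_AE_imp[OF L2D(2)[OF assms(2)]]) (use g assms(3) in auto)
  with g show ?thesis by (simp add: L2_def)
qed

section \<open>From the given scheme to the shifted one\<close>

context bdf2_setting
begin

lemma bdf2_coeff_0: "bdf2_coeff \<alpha> \<tau> 0 = of_real ((3 / (2 * \<tau>)) powr \<alpha>)"
proof -
  have "(\<lambda>i. bdf2_coeff \<alpha> \<tau> i * 0 ^ i) sums bdf2_symbol \<alpha> \<tau> 0"
    by (rule bdf2_coeff_sums[OF \<tau>]) simp
  moreover have "(\<lambda>i. bdf2_coeff \<alpha> \<tau> i * 0 ^ i) sums bdf2_coeff \<alpha> \<tau> 0"
    by (rule powser_sums_zero)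
  ultimately have "bdf2_coeff \<alpha> \<tau> 0 = bdf2_symbol \<alpha> \<tau> 0" by (rule sums_unique2[symmetric])
  also have "\<dots> = of_real (3 / (2 * \<tau>)) powr of_real \<alpha>"
    by (simp add: bdf2_symbol_def field_simps)
  also have "\<dots> = of_real ((3 / (2 * \<tau>)) powr \<alpha>)"
    using \<tau> by (subst powr_of_real) auto
  finally show ?thesis .
qed

lemma damp_eq:
  assumes "\<rho> * U x = V x"
  shows "damp \<rho> U (real i * \<tau>) x = exp (- (of_real \<tau> * V x)) ^ i"
  unfolding damp_def exp_of_nat_mult[symmetric] assms[symmetric] by (simp add: mult_ac)

text \<open>\<open>W\<close> differs from the discrete solution only in the first step, where adding
  \<open>e\<^sup>-\<^sup>\<tau>\<^sup>V G0 / 2\<close> moves \<open>G\<^sup>1\<close> into the domain of the Laplacian.\<close>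
lemma bdf2_solution_scheme:
  assumes UV: "AE x in lebesgue_on \<Omega>. \<rho> * U x = V x"
    and sol: "bdf2_solution \<Omega> \<alpha> \<rho> U \<tau> N G0 Gs" and N: "1 \<le> N"
  shows "\<exists>W. scheme N W \<and> (\<forall>n\<in>{1..N}. AE x in lebesgue_on \<Omega>.
      Gs n x = W n x - (if n = 1 then exp (- (of_real \<tau> * V x)) * G0 x / 2 else 0))"
proof -
  let ?d = "bdf2_coeff \<alpha> \<tau>"
  let ?M = "lebesgue_on \<Omega>"
  define e where "e x = exp (- (of_real \<tau> * V x))" for x
  have [measurable]: "e \<in> borel_measurable ?M" unfolding e_def[abs_def] by measurable
  have e_le: "norm (e x) \<le> exp (\<tau> * M)" for x
  proof -
    have "- Re (V x) \<le> M" using abs_Re_le_cmod[of "V x"] V_le[of x] by linarith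
    from mult_left_mono[OF this, of \<tau>] show ?thesis using \<tau> by (simp add: e_def)
  qed
  have eG: "(\<lambda>x. e x * G0 x) \<in> L2 \<Omega>" by (rule L2_mult[OF _ e_le G0]) measurable
  \<comment> \<open>The coefficient d_0 is real and positive: it is a legitimate resolvent parameter
    and passes through the conjugation in the second slot of \<open>l2_inner\<close>.\<close>
  define \<delta> where "\<delta> = (3 / (2 * \<tau>)) powr \<alpha>"
  have \<delta>: "0 < \<delta>" using \<tau> by (simp add: \<delta>_def)
  have d0: "?d 0 = of_real \<delta>" by (simp add: bdf2_coeff_0 \<delta>_def)
  have Gs0: "AE x in ?M. Gs 0 x = G0 x" and GsL2: "\<And>n. n \<in> {1..N} \<Longrightarrow> Gs n \<in> L2 \<Omega>"
    and step1: "\<And>v Av. dirichlet_laplacian \<Omega> v Av \<Longrightarrow>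
        l2_inner \<Omega> (\<lambda>x. ?d 0 * Gs 1 x) v + l2_inner \<Omega> (Gs 1) Av
        + 1/2 * l2_inner \<Omega> (\<lambda>x. damp \<rho> U \<tau> x * Gs 0 x) Av
        = l2_inner \<Omega> (\<lambda>x. damp \<rho> U \<tau> x * ?d 0 * Gs 0 x) v"
    and stepn: "\<And>n. n \<in> {2..N} \<Longrightarrow> \<exists>AG. dirichlet_laplacian \<Omega> (Gs n) AG \<and>
        (AE x in ?M. (\<Sum>i<n. ?d i * damp \<rho> U (real i * \<tau>) x * Gs (n - i) x) + AG x
           = damp \<rho> U (real n * \<tau>) x * (\<Sum>i<n. ?d i * Gs 0 x))"
    using sol unfolding bdf2_solution_def by blast+
  have G1: "Gs 1 \<in> L2 \<Omega>" using GsL2[of 1] N by simp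
  have res_meas: "(\<lambda>x. complex_of_real \<delta>) \<in> borel_measurable ?M" by simp
  have res_ex: "\<exists>u. resolvent_eq \<Omega> (\<lambda>x. of_real \<delta>) f u" if "f \<in> L2 \<Omega>" for f
    using resolvent_exists[OF \<Omega> res_meas _ _ that \<delta>, of \<delta>] \<delta> by auto
  \<comment> \<open>The dual formulation does not say outright that the shifted first step lies in
    the domain of A. So \<open>W1\<close> is built as a strong solution, and the discrepancy
    \<open>X\<close> is shown to vanish.\<close>
  obtain W1 AW1 where W1: "dirichlet_laplacian \<Omega> W1 AW1" "AE x in ?M. of_real \<delta> * W1 x + AW1 x = (3/2 * of_real \<delta>) * (e x * G0 x)"
    using res_ex[OF L2_scale[OF eG, of "3/2 * of_real \<delta>"]] unfolding resolvent_eq_def by blast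
  note W1L2 = dirichlet_laplacian_L2[OF W1(1)]
  define X where "X x = Gs 1 x + (1/2) * (e x * G0 x) - W1 x" for x
  have XL2: "X \<in> L2 \<Omega>" unfolding X_def[abs_def] by (intro L2_diff L2_add G1 L2_scale eG W1L2)
  have orth: "l2_inner \<Omega> X (\<lambda>x. of_real \<delta> * v x + Av x) = 0" if v: "dirichlet_laplacian \<Omega> v Av" for v Av
  proof -
    note vL2 = dirichlet_laplacian_L2[OF v]
    have dG: "AE x in ?M. e x * G0 x = damp \<rho> U \<tau> x * Gs 0 x"
      using Gs0 UV by eventually_elim (use damp_eq[of \<rho> U _ 1] in \<open>simp add: e_def\<close>)
    have dGL2: "(\<lambda>x. damp \<rho> U \<tau> x * Gs 0 x) \<in> L2 \<Omega>" by (rule L2_AE_eq[OF \<Omega> eG dG])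
    have 1: "l2_inner \<Omega> (\<lambda>x. damp \<rho> U \<tau> x * Gs 0 x) w = l2_inner \<Omega> (\<lambda>x. e x * G0 x) w" if "w \<in> L2 \<Omega>" for w
      using dG that dGL2 eG by (intro l2_inner_cong_AE) auto
    have "l2_inner \<Omega> (\<lambda>x. damp \<rho> U \<tau> x * ?d 0 * Gs 0 x) v = of_real \<delta> * l2_inner \<Omega> (\<lambda>x. damp \<rho> U \<tau> x * Gs 0 x) v"
      unfolding d0 l2_inner_scale_left[symmetric] by (simp add: mult_ac)
    then have s1: "of_real \<delta> * l2_inner \<Omega> (Gs 1) v + l2_inner \<Omega> (Gs 1) Av + 1/2 * l2_inner \<Omega> (\<lambda>x. e x * G0 x) Av
        = of_real \<delta> * l2_inner \<Omega> (\<lambda>x. e x * G0 x) v"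
      using step1[OF v] unfolding 1[OF vL2(1)] 1[OF vL2(2)] d0 l2_inner_scale_left by simp
    have "l2_inner \<Omega> (\<lambda>x. of_real \<delta> * W1 x + AW1 x) v = l2_inner \<Omega> (\<lambda>x. (3/2 * of_real \<delta>) * (e x * G0 x)) v"
      by (intro l2_inner_cong_AE[OF W1(2)] L2_add L2_scale vL2 W1L2 eG) auto
    then have s2: "of_real \<delta> * l2_inner \<Omega> W1 v + l2_inner \<Omega> W1 Av = (3/2 * of_real \<delta>) * l2_inner \<Omega> (\<lambda>x. e x * G0 x) v"
      using dirichlet_laplacian_symmetric[OF \<Omega> W1(1) v] vL2 W1L2
      by (simp only: l2_inner_add_left L2_scale l2_inner_scale_left)
    have Xw: "l2_inner \<Omega> X w = l2_inner \<Omega> (Gs 1) w + (1/2) * l2_inner \<Omega> (\<lambda>x. e x * G0 x) w - l2_inner \<Omega> W1 w" if "w \<in> L2 \<Omega>" for w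
      unfolding X_def[abs_def] using that G1 eG W1L2
      by (simp only: l2_inner_diff_left l2_inner_add_left l2_inner_scale_left L2_add L2_scale)
    have "l2_inner \<Omega> X (\<lambda>x. of_real \<delta> * v x + Av x) = of_real \<delta> * l2_inner \<Omega> X v + l2_inner \<Omega> X Av"
      using vL2 XL2 by (simp add: l2_inner_add_right l2_inner_scale_right)
    then have "l2_inner \<Omega> X (\<lambda>x. of_real \<delta> * v x + Av x) =
        (of_real \<delta> * l2_inner \<Omega> (Gs 1) v + l2_inner \<Omega> (Gs 1) Av + 1/2 * l2_inner \<Omega> (\<lambda>x. e x * G0 x) Av)
        + 1/2 * (of_real \<delta> * l2_inner \<Omega> (\<lambda>x. e x * G0 x) v) - (of_real \<delta> * l2_inner \<Omega> W1 v + l2_inner \<Omega> W1 Av)"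
      unfolding Xw[OF vL2(1)] Xw[OF vL2(2)] by (simp add: algebra_simps)
    then show ?thesis unfolding s1 s2 by (simp add: field_simps)
  qed
  \<comment> \<open>The range of \<delta> + A is all of L2; the test pair that hits \<open>X\<close>
    itself turns orthogonality into X = 0.\<close>
  obtain v Av where v: "dirichlet_laplacian \<Omega> v Av" "AE x in ?M. of_real \<delta> * v x + Av x = X x"
    using res_ex[OF XL2] unfolding resolvent_eq_def by blast
  note vL2 = dirichlet_laplacian_L2[OF v(1)]
  have "l2_inner \<Omega> X X = l2_inner \<Omega> X (\<lambda>x. of_real \<delta> * v x + Av x)"
    using v(2) XL2 vL2 by (intro l2_inner_cong_AE) auto
  then have "l2_norm \<Omega> X = 0" using orth[OF v(1)] by (simp add: l2_inner_self)
  then have X0: "AE x in ?M. X x = 0" using XL2 by (rule l2_norm_eq_0_AE)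
  have G1W1: "AE x in ?M. Gs 1 x = W1 x - e x * G0 x / 2"
    using X0 by eventually_elim (simp add: X_def field_simps)
  define W where "W n = (if n = 1 then W1 else Gs n)" for n
  have W: "\<forall>n\<in>{1..N}. AE x in ?M. Gs n x = W n x - (if n = 1 then e x * G0 x / 2 else 0)"
    using G1W1 by (auto simp: W_def)
  have "scheme N W"
    unfolding scheme_def e_def[symmetric]
  proof
    fix n assume n: "n \<in> {1..N}"
    show "\<exists>AW. dirichlet_laplacian \<Omega> (W n) AW \<and> (AE x in ?M.
        (\<Sum>i<n. ?d i * e x ^ i * W (n - i) x) + AW x = e x ^ n * G0 x * (\<Sum>i<n. ?d i * bdf2_weight (n - i)))"
    proof (cases "n = 1")
      case True
      have "AE x in ?M. (\<Sum>i<n. ?d i * e x ^ i * W (n - i) x) + AW1 x = e x ^ n * G0 x * (\<Sum>i<n. ?d i * bdf2_weight (n - i))"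
        using W1(2) by eventually_elim (simp add: True W_def d0 bdf2_weight_def mult_ac)
      with W1(1) True show ?thesis by (auto simp: W_def)
    next
      case False
      then obtain m where m: "n = Suc (Suc m)" using n by (cases n; cases "n - 1") auto
      obtain AG where AG: "dirichlet_laplacian \<Omega> (Gs n) AG"
        "AE x in ?M. (\<Sum>i<n. ?d i * damp \<rho> U (real i * \<tau>) x * Gs (n - i) x) + AG x
           = damp \<rho> U (real n * \<tau>) x * (\<Sum>i<n. ?d i * Gs 0 x)"
        using stepn[of n] n m by auto
      have "AE x in ?M. (\<Sum>i<n. ?d i * e x ^ i * W (n - i) x) + AG x = e x ^ n * G0 x * (\<Sum>i<n. ?d i * bdf2_weight (n - i))"
        using AG(2) UV Gs0 G1W1
      proof eventually_elim
        case (elim x)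
        have damp: "damp \<rho> U (real i * \<tau>) x = e x ^ i" for i
          unfolding e_def by (rule damp_eq[where \<rho> = \<rho> and U = U, OF elim(2)])
        \<comment> \<open>Only the last summand, i = n - 1, meets the shifted first step.\<close>
        have "(\<Sum>i<n. ?d i * e x ^ i * W (n - i) x) = (\<Sum>i<Suc m. ?d i * e x ^ i * Gs (n - i) x) + ?d (Suc m) * e x ^ Suc m * W1 x"
          by (simp add: m W_def) (intro sum.cong refl, auto)
        also have "W1 x = Gs 1 x + e x * G0 x / 2" using elim(4) by simp
        finally have 1: "(\<Sum>i<n. ?d i * e x ^ i * W (n - i) x) = (\<Sum>i<n. ?d i * e x ^ i * Gs (n - i) x) + ?d (Suc m) * e x ^ n * G0 x / 2"
          by (simp add: m algebra_simps)
        have 2: "(\<Sum>i<n. ?d i * bdf2_weight (n - i)) = (\<Sum>i<n. ?d i) + ?d (Suc m) / 2"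
        proof -
          have "(\<Sum>i<Suc m. ?d i * bdf2_weight (n - i)) = (\<Sum>i<Suc m. ?d i)"
            by (intro sum.cong refl) (auto simp: m bdf2_weight_def)
          then show ?thesis by (simp add: m bdf2_weight_def field_simps)
        qed
        have "(\<Sum>i<n. ?d i * e x ^ i * Gs (n - i) x) + AG x = e x ^ n * (\<Sum>i<n. ?d i) * G0 x"
          using elim(1) unfolding damp elim(3) sum_distrib_right[symmetric] by (simp add: mult.assoc)
        then show ?case unfolding 1 2 by (simp add: algebra_simps)
      qed
      with AG(1) show ?thesis using m by (auto simp: W_def)
    qed
  qed
  then show ?thesis using W unfolding e_def by blast
qed

lemma admissible_mono: "admissible a z \<Longrightarrow> b \<le> a \<Longrightarrow> admissible b z"
  unfolding admissible_def by (meson order_trans)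

text \<open>Stability without smallness of \<tau>, by integrating over one period of the line Re z =
  M + 1. The bound degenerates as \<open>a\<close>, and with it \<tau>, tends to 0, so it serves
  only step sizes bounded below.\<close>

lemma scheme_bound:
  assumes W: "scheme N W" and n: "n \<in> {1..N}" and \<phi>: "\<phi> \<in> L2 \<Omega>"
    and a: "0 < a" "a \<le> 1 - exp (- (\<tau> / 2))"
  shows "norm (2 * of_real pi * \<i> * l2_inner \<Omega> (W n) \<phi>)
    \<le> 2 * pi * exp ((M + 1) * (real n * \<tau>)) * ((8 / a) powr \<alpha> * (2 / a + 1) / c) * (l2_norm \<Omega> G0 * l2_norm \<Omega> \<phi>)"
proof -
  define S where "S = {z. M + 1/2 < Re z}"
  have S: "open S" "convex S" unfolding S_def by (simp_all add: open_halfspace_Re_gt convex_halfspace_Re_gt)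
  have adm: "admissible a z" if "z \<in> S" for z
  proof -
    have "M + 1/2 \<le> Re z" using that by (simp add: S_def)
    from halfplane_admissible(2)[OF this] show ?thesis
      using a(2) by (simp add: admissible_mono)
  qed
  define f where "f z = exp (of_nat n * of_real \<tau> * z) * l2_inner \<Omega> (sol z) \<phi>" for z
  have "f holomorphic_on S"
    unfolding f_def by (intro holomorphic_intros sol_holomorphic[OF S(1) adm a(1) \<phi>])
  then obtain g where "\<And>z. z \<in> S \<Longrightarrow> (g has_field_derivative f z) (at z within S)"
    using holomorphic_convex_primitive'[OF S(2,1)] by blast
  then have g: "(g has_field_derivative f z) (at z)" if "z \<in> S" for z
    using that at_within_open[OF that S(1)] by metis
  define B where "B = exp ((M + 1) * (real n * \<tau>)) * (\<tau> * ((8 / a) powr \<alpha> * (2 / a + 1) / c) * (l2_norm \<Omega> G0 * l2_norm \<Omega> \<phi>))"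
  have p: "0 < pi / \<tau>" using \<tau> by simp
  have eq: "g (Complex (M + 1) (pi / \<tau>)) - g (Complex (M + 1) (- (pi / \<tau>))) = 2 * of_real pi * \<i> * l2_inner \<Omega> (W n) \<phi>"
    by (rule scheme_increment[OF W n \<phi>, where S = S and \<sigma> = "M + 1"])
       (use g in \<open>auto simp: f_def S_def\<close>)
  have "norm (g (Complex (M + 1) (pi / \<tau>)) - g (Complex (M + 1) (- (pi / \<tau>)))) \<le> B * norm (Complex (M + 1) (pi / \<tau>) - Complex (M + 1) (- (pi / \<tau>)))"
  proof (rule field_differentiable_bound[where S = "{z. Re z = M + 1}"])
    fix z assume "z \<in> {z. Re z = M + 1}"
    then have z: "Re z = M + 1" "z \<in> S" by (auto simp: S_def)
    show "(g has_field_derivative f z) (at z within {z. Re z = M + 1})"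
      by (rule has_field_derivative_at_within[OF g[OF z(2)]])
    have "norm (l2_inner \<Omega> (sol z) \<phi>) \<le> l2_norm \<Omega> (sol z) * l2_norm \<Omega> \<phi>"
      by (rule l2_Cauchy_Schwarz[OF sol_L2[OF adm[OF z(2)] a(1)] \<phi>])
    also have "\<dots> \<le> \<tau> * (8 / a) powr \<alpha> * (2 / a + 1) / c * l2_norm \<Omega> G0 * l2_norm \<Omega> \<phi>"
      by (intro mult_right_mono sol_bound[OF adm[OF z(2)] a(1)]) auto
    finally have "norm (f z) \<le> exp ((M + 1) * (real n * \<tau>)) * (\<tau> * (8 / a) powr \<alpha> * (2 / a + 1) / c * l2_norm \<Omega> G0 * l2_norm \<Omega> \<phi>)"
      unfolding f_def norm_mult using z by (intro mult_mono) (auto simp: mult_ac)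
    then show "norm (f z) \<le> B" by (simp add: B_def mult_ac)
  qed (use convex_hyperplane[of "1::complex" "M + 1"] in auto)
  moreover have "norm (Complex (M + 1) (pi / \<tau>) - Complex (M + 1) (- (pi / \<tau>))) = 2 * (pi / \<tau>)"
    using p \<tau> by (simp add: cmod_def)
  ultimately have "norm (2 * of_real pi * \<i> * l2_inner \<Omega> (W n) \<phi>) \<le> B * (2 * (pi / \<tau>))"
    unfolding eq by simp
  also have "\<dots> = 2 * pi * exp ((M + 1) * (real n * \<tau>)) * ((8 / a) powr \<alpha> * (2 / a + 1) / c) * (l2_norm \<Omega> G0 * l2_norm \<Omega> \<phi>)"
  proof -
    have "E * (\<tau> * K * X) * (2 * (pi / \<tau>)) = 2 * pi * E * K * X" for E K X
      using \<tau> by (simp add: field_simps)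
    then show ?thesis unfolding B_def .
  qed
  finally show ?thesis .
qed

end

text \<open>Ensures Re z + \<eta> |Im z| \<ge> |z| \<eta> / 2 on all of Gamma. Up to pi/2 it follows
  from cos + sin \<ge> 1; beyond, cosine and sine both decrease, so the end angle \<theta> is the
  worst case.\<close>

lemma sector_arc_bound:
  assumes "0 < \<eta>" "\<eta> \<le> 1" "pi / 2 < \<theta>" "\<theta> < pi" "\<eta> / 2 \<le> cos \<theta> + \<eta> * sin \<theta>" "\<bar>b\<bar> \<le> \<theta>"
  shows "\<eta> / 2 \<le> cos b + \<eta> * \<bar>sin b\<bar>"
proof -
  define x where "x = \<bar>b\<bar>"
  have x: "0 \<le> x" "x \<le> \<theta>" "x \<le> pi" using assms by (auto simp: x_def)
  have sx: "0 \<le> sin x" using x by (intro sin_ge_zero) auto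
  have "cos b = cos x" "\<bar>sin b\<bar> = sin x"
    using sx by (auto simp: x_def abs_if split: if_splits)
  moreover have "\<eta> / 2 \<le> cos x + \<eta> * sin x"
  proof (cases "x \<le> pi / 2")
    case True
    have cx: "0 \<le> cos x" using True x by (intro cos_ge_zero) auto
    have "(cos x)\<^sup>2 \<le> cos x" "(sin x)\<^sup>2 \<le> sin x"
      using cx sx mult_left_mono[OF cos_le_one, of "cos x" x] mult_left_mono[OF sin_le_one, of "sin x" x]
      by (simp_all add: power2_eq_square)
    then have 1: "1 \<le> cos x + sin x" using sin_cos_squared_add[of x] by linarith
    have "\<eta> / 2 \<le> \<eta> * 1" using assms by simp
    also have "\<dots> \<le> \<eta> * (cos x + sin x)" using 1 assms by (intro mult_left_mono) auto
    also have "\<dots> \<le> cos x + \<eta> * sin x" using mult_right_mono[OF assms(2) cx] by (simp add: distrib_left)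
    finally show ?thesis .
  next
    case False
    have "cos \<theta> \<le> cos x" using x assms by (subst cos_mono_le_eq) auto
    moreover have "cos (\<theta> - pi / 2) \<le> cos (x - pi / 2)"
      using x assms False by (subst cos_mono_le_eq) auto
    then have "sin \<theta> \<le> sin x" by (simp add: cos_diff)
    then have "\<eta> * sin \<theta> \<le> \<eta> * sin x" using assms by simp
    ultimately show ?thesis using assms by linarith
  qed
  ultimately show ?thesis by simp
qed

lemma rcis_in_Gamma_set:
  assumes "0 < \<kappa>" "0 < \<theta>" "\<theta> < pi"
  shows "\<bar>b\<bar> \<le> \<theta> \<Longrightarrow> rcis \<kappa> b \<in> Gamma_set \<theta> \<kappa>"
    and "\<kappa> \<le> r \<Longrightarrow> \<bar>b\<bar> = \<theta> \<Longrightarrow> rcis r b \<in> Gamma_set \<theta> \<kappa>"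
proof -
  show "rcis \<kappa> b \<in> Gamma_set \<theta> \<kappa>" if "\<bar>b\<bar> \<le> \<theta>"
    using that assms by (auto simp: Gamma_set_def Arg_rcis abs_if split: if_splits)
  show "rcis r b \<in> Gamma_set \<theta> \<kappa>" if "\<kappa> \<le> r" "\<bar>b\<bar> = \<theta>"
    using that unfolding Gamma_set_def by (auto simp: abs_if split: if_splits)
qed

section \<open>Continuous and discrete resolvents on the contour\<close>

context bdf2_setting
begin

text \<open>The shift by \<open>V\<close> costs at most M in the real part and \<eta> M \<le> M in
  the imaginary part; the remaining margin 1 excludes the branch cut.\<close>

lemma shifted_sector:
  assumes "0 < \<eta>" "\<eta> \<le> 1" "2 * M + 1 < Re z + \<eta> * \<bar>Im z\<bar>"
  shows "1 \<le> Re (z + V x) + \<eta> * \<bar>Im (z + V x)\<bar>"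
proof -
  have "\<bar>Re (V x)\<bar> \<le> M" "\<bar>Im (V x)\<bar> \<le> M"
    using abs_Re_le_cmod[of "V x"] abs_Im_le_cmod[of "V x"] V_le[of x] by auto
  moreover have "\<eta> * (\<bar>Im z\<bar> - \<bar>Im (V x)\<bar>) \<le> \<eta> * \<bar>Im (z + V x)\<bar>"
    using assms(1) by (intro mult_left_mono) auto
  moreover have "\<eta> * \<bar>Im (V x)\<bar> \<le> 1 * M"
    using assms calculation(2) M_nonneg by (intro mult_mono) auto
  ultimately show ?thesis using assms(3) by (simp add: right_diff_distrib)
qed

text \<open>For |z| \<ge> 2 M the shift keeps |z + V| between |z|/2 and 2 |z|; data of order
  |z|^(\<alpha>-1) over a multiplier of order |z|^\<alpha> leave 1/|z|.\<close>

lemma continuous_resolvent_bound: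
  assumes \<eta>: "0 < \<eta>" "\<eta> \<le> \<epsilon>" and z: "2 * M + 1 < Re z + \<eta> * \<bar>Im z\<bar>" "2 * M \<le> norm z" "z \<noteq> 0"
    and u: "resolvent_eq \<Omega> (\<lambda>x. (z + V x) powr of_real \<alpha>) (\<lambda>x. (z + V x) powr of_real (\<alpha> - 1) * G0 x) u"
  shows "l2_norm \<Omega> u \<le> 2 / c / norm z * l2_norm \<Omega> G0"
proof -
  have nz: "0 < norm z" using z by simp
  have Vz: "norm z / 2 \<le> norm (z + V x)" "norm (z + V x) \<le> 2 * norm z" for x
    using norm_triangle_ineq2[of z "- V x"] norm_triangle_ineq[of z "V x"] V_le[of x] z(2) M_nonneg by auto
  have sec: "- \<epsilon> * norm (z + V x) \<le> Re (z + V x)" for x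
  proof -
    have "\<eta> * \<bar>Im (z + V x)\<bar> \<le> \<epsilon> * norm (z + V x)"
      using \<eta> abs_Im_le_cmod[of "z + V x"] by (intro mult_mono) auto
    then show ?thesis using shifted_sector[OF \<eta>(1) _ z(1), of x] \<eta> \<epsilon> by simp
  qed
  have np: "z + V x \<notin> \<real>\<^sub>\<le>\<^sub>0" for x
  proof
    assume "z + V x \<in> \<real>\<^sub>\<le>\<^sub>0"
    then have "Im (z + V x) = 0" "Re (z + V x) \<le> 0" by (auto simp: complex_nonpos_Reals_iff)
    then show False using shifted_sector[OF \<eta>(1) _ z(1), of x] \<eta> \<epsilon> by simp
  qed
  have meas: "(\<lambda>x. (z + V x) powr of_real a) \<in> borel_measurable (lebesgue_on \<Omega>)" for a
    by (rule borel_measurable_powr_complex[OF _ np]) measurable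
  have up: "norm ((z + V x) powr of_real \<alpha>) \<le> (2 * norm z) powr \<alpha>" for x
    unfolding norm_powr_of_real using \<alpha> Vz(2)[of x] by (intro powr_mono2) auto
  have low: "c * (norm z / 2) powr \<alpha> \<le> Re ((z + V x) powr of_real \<alpha>)" for x
  proof -
    have "c * (norm z / 2) powr \<alpha> \<le> c * norm (z + V x) powr \<alpha>"
      using c \<alpha> Vz(1)[of x] by (intro mult_left_mono powr_mono2) auto
    also have "\<dots> \<le> Re ((z + V x) powr of_real \<alpha>)"
      using np[of x] by (intro sector[OF _ sec]) auto
    finally show ?thesis .
  qed
  have rhs: "norm ((z + V x) powr of_real (\<alpha> - 1)) \<le> (norm z / 2) powr (\<alpha> - 1)" for x
    unfolding norm_powr_of_real using \<alpha> Vz(1)[of x] nz by (intro powr_mono2') auto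
  have c0: "0 < c * (norm z / 2) powr \<alpha>" using c nz by simp
  have "l2_norm \<Omega> u \<le> l2_norm \<Omega> (\<lambda>x. (z + V x) powr of_real (\<alpha> - 1) * G0 x) / (c * (norm z / 2) powr \<alpha>)"
    by (rule resolvent_eq_bound[OF \<Omega> meas up low L2_mult[OF meas rhs G0] u c0])
  also have "\<dots> \<le> ((norm z / 2) powr (\<alpha> - 1) * l2_norm \<Omega> G0) / (c * (norm z / 2) powr \<alpha>)"
    using c0 by (intro divide_right_mono l2_norm_mult_le[OF meas rhs G0]) auto
  also have "\<dots> = 2 / c / norm z * l2_norm \<Omega> G0"
    using nz c by (simp add: powr_diff field_simps)
  finally show ?thesis .
qed

text \<open>One summand comes from the consistency of the source, the other from that of the
  multiplier times the bound 2/(c |z|) of the continuous solution. The powers of 2 and the half of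
  \<open>c1\<close> reflect |z|/2 \<le> |z + V| \<le> 2 |z|.\<close>

definition err_const :: "real \<Rightarrow> real \<Rightarrow> real" where
  "err_const C1 c1 = C1 * (2 powr (\<alpha> + 1) + 2 powr (\<alpha> + 2) * (2 / c)) / (c * (c1 / 2) powr \<alpha>)"

text \<open>Rewriting the continuous equation with the discrete multiplier makes the error a
  solution of the discrete resolvent problem with data of order \<tau>^2 |z|^(\<alpha>+1); inverting
  a multiplier of size |z|^\<alpha> leaves \<tau>^2 |z|.\<close>

lemma resolvent_difference:
  assumes \<eta>: "0 < \<eta>" "\<eta> \<le> \<epsilon>" "\<eta> \<le> 1/10" and z: "2 * M + 1 < Re z + \<eta> * \<bar>Im z\<bar>" "2 * M \<le> norm z" "z \<noteq> 0"
    and adm: "admissible a z" "0 < a"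
    and s: "\<tau> * norm z + \<tau> * M \<le> 6" "\<tau> * \<bar>Im z\<bar> + \<tau> * M \<le> 4"
    and C1: "0 < C1"
      "\<And>s. s \<noteq> 0 \<Longrightarrow> norm s \<le> 6 \<Longrightarrow> \<bar>Im s\<bar> \<le> 4 \<Longrightarrow> - (1/10) * \<bar>Im s\<bar> \<le> Re s \<Longrightarrow>
        norm (bdf2_delta (exp (- s)) powr of_real \<alpha> - s powr of_real \<alpha>) \<le> C1 * norm s powr (\<alpha> + 2)"
      "\<And>s. s \<noteq> 0 \<Longrightarrow> norm s \<le> 6 \<Longrightarrow> \<bar>Im s\<bar> \<le> 4 \<Longrightarrow> - (1/10) * \<bar>Im s\<bar> \<le> Re s \<Longrightarrow>
        norm (s powr of_real (\<alpha> - 1) - bdf2_delta (exp (- s)) powr of_real \<alpha> * bdf2_source (exp (- s)))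
          \<le> C1 * norm s powr (\<alpha> + 1)"
    and c1: "0 < c1"
      "\<And>s. \<bar>Im s\<bar> \<le> 4 \<Longrightarrow> norm s \<le> 6 \<Longrightarrow> - (1/10) * \<bar>Im s\<bar> \<le> Re s \<Longrightarrow> c1 * norm s \<le> norm (bdf2_delta (exp (- s)))"
    and u: "resolvent_eq \<Omega> (\<lambda>x. (z + V x) powr of_real \<alpha>) (\<lambda>x. (z + V x) powr of_real (\<alpha> - 1) * G0 x) u"
  shows "l2_norm \<Omega> (\<lambda>x. u x - sol z x) \<le> err_const C1 c1 * \<tau>\<^sup>2 * norm z * l2_norm \<Omega> G0"
proof -
  have nz: "0 < norm z" using z by simp
  define b where "b x = z + V x" for x
  define s where "s x = of_real \<tau> * b x" for x
  have b1: "norm z / 2 \<le> norm (b x)" "norm (b x) \<le> 2 * norm z" for x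
    using norm_triangle_ineq2[of z "- V x"] norm_triangle_ineq[of z "V x"] V_le[of x] z(2) M_nonneg by (auto simp: b_def)
  have b0: "b x \<noteq> 0" for x using b1(1)[of x] nz by auto
  have np: "b x \<notin> \<real>\<^sub>\<le>\<^sub>0" for x
  proof
    assume "b x \<in> \<real>\<^sub>\<le>\<^sub>0"
    then have "Im (b x) = 0" "Re (b x) \<le> 0" by (auto simp: complex_nonpos_Reals_iff)
    then show False using shifted_sector[OF \<eta>(1) _ z(1), of x] \<eta> by (simp add: b_def)
  qed
  have ns: "norm (s x) = \<tau> * norm (b x)" for x using \<tau> by (simp add: s_def norm_mult)
  have s_ok: "s x \<noteq> 0" "norm (s x) \<le> 6" "\<bar>Im (s x)\<bar> \<le> 4" "- (1/10) * \<bar>Im (s x)\<bar> \<le> Re (s x)" for x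
  proof -
    show "s x \<noteq> 0" using b0[of x] \<tau> by (simp add: s_def)
    have "norm (b x) \<le> norm z + M" using norm_triangle_ineq[of z "V x"] V_le[of x] by (simp add: b_def)
    then have "\<tau> * norm (b x) \<le> \<tau> * (norm z + M)" using \<tau> by (intro mult_left_mono) auto
    then show "norm (s x) \<le> 6" using s(1) unfolding ns by (simp add: distrib_left)
    have "\<bar>Im (b x)\<bar> \<le> \<bar>Im z\<bar> + M" using abs_Im_le_cmod[of "V x"] V_le[of x] by (auto simp: b_def)
    then have "\<tau> * \<bar>Im (b x)\<bar> \<le> \<tau> * (\<bar>Im z\<bar> + M)" using \<tau> by (intro mult_left_mono) auto
    then show "\<bar>Im (s x)\<bar> \<le> 4" using s(2) \<tau> by (simp add: s_def abs_mult distrib_left)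
    have "- (1/10) * \<bar>Im (b x)\<bar> \<le> - \<eta> * \<bar>Im (b x)\<bar>" using \<eta> by (intro mult_right_mono) auto
    also have "\<dots> \<le> Re (b x)" using shifted_sector[OF \<eta>(1) _ z(1), of x] \<eta> by (simp add: b_def)
    finally have "\<tau> * (- (1/10) * \<bar>Im (b x)\<bar>) \<le> \<tau> * Re (b x)" using \<tau> by (intro mult_left_mono) auto
    then show "- (1/10) * \<bar>Im (s x)\<bar> \<le> Re (s x)" using \<tau> by (simp add: s_def abs_mult)
  qed
  have pt: "pt z x = exp (- s x)" for x by (simp add: pt_def s_def b_def)
  have b_s: "b x = s x / of_real \<tau>" for x using \<tau> by (simp add: s_def)
  have mul: "mul z x = bdf2_delta (exp (- s x)) powr of_real \<alpha> / of_real (\<tau> powr \<alpha>)" for x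
    unfolding mul_eq pt by (rule powr_divide_of_real[OF \<tau>])
  have bp: "b x powr of_real p = s x powr of_real p / of_real (\<tau> powr p)" for x p
    unfolding b_s by (rule powr_divide_of_real[OF \<tau>])
  \<comment> \<open>Consistency is stated in s = \<tau> b, while the symbols carry \<tau>^(-p); two
    powers of \<tau> remain.\<close>
  have pw: "(\<tau> * y) powr (p + 2) / \<tau> powr p = \<tau>\<^sup>2 * y powr (p + 2)" if "0 \<le> y" for y p
    using \<tau> that by (simp add: powr_mult powr_add field_simps)
  have m_diff: "norm (mul z x - b x powr of_real \<alpha>) \<le> C1 * \<tau>\<^sup>2 * (2 * norm z) powr (\<alpha> + 2)" for x
  proof -
    have "mul z x - b x powr of_real \<alpha> = (bdf2_delta (exp (- s x)) powr of_real \<alpha> - s x powr of_real \<alpha>) / of_real (\<tau> powr \<alpha>)"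
      unfolding mul bp by (simp add: diff_divide_distrib)
    then have "norm (mul z x - b x powr of_real \<alpha>) = norm (bdf2_delta (exp (- s x)) powr of_real \<alpha> - s x powr of_real \<alpha>) / \<tau> powr \<alpha>"
      by (simp add: norm_divide)
    also have "\<dots> \<le> C1 * norm (s x) powr (\<alpha> + 2) / \<tau> powr \<alpha>"
      by (intro divide_right_mono C1(2)[OF s_ok]) auto
    also have "\<dots> = C1 * (\<tau>\<^sup>2 * norm (b x) powr (\<alpha> + 2))"
      using pw[of "norm (b x)" \<alpha>] unfolding ns by (metis norm_ge_zero times_divide_eq_right)
    also have "\<dots> \<le> C1 * (\<tau>\<^sup>2 * (2 * norm z) powr (\<alpha> + 2))"
      using C1(1) b1(2)[of x] \<alpha> by (intro mult_left_mono powr_mono2) auto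
    finally show ?thesis by (simp add: mult_ac)
  qed
  have k_diff: "norm (b x powr of_real (\<alpha> - 1) - src z x) \<le> C1 * \<tau>\<^sup>2 * (2 * norm z) powr (\<alpha> + 1)" for x
  proof -
    have t: "of_real \<tau> / complex_of_real (\<tau> powr \<alpha>) = 1 / of_real (\<tau> powr (\<alpha> - 1))"
      using \<tau> by (simp add: powr_diff)
    have "src z x = of_real \<tau> / complex_of_real (\<tau> powr \<alpha>) * (bdf2_delta (exp (- s x)) powr of_real \<alpha> * bdf2_source (exp (- s x)))"
      unfolding src_def mul pt by simp
    then have "b x powr of_real (\<alpha> - 1) - src z x
        = (s x powr of_real (\<alpha> - 1) - bdf2_delta (exp (- s x)) powr of_real \<alpha> * bdf2_source (exp (- s x))) / of_real (\<tau> powr (\<alpha> - 1))"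
      unfolding t bp by (simp add: diff_divide_distrib)
    then have "norm (b x powr of_real (\<alpha> - 1) - src z x)
        = norm (s x powr of_real (\<alpha> - 1) - bdf2_delta (exp (- s x)) powr of_real \<alpha> * bdf2_source (exp (- s x))) / \<tau> powr (\<alpha> - 1)"
      by (simp add: norm_divide)
    also have "\<dots> \<le> C1 * norm (s x) powr (\<alpha> + 1) / \<tau> powr (\<alpha> - 1)"
      by (intro divide_right_mono C1(3)[OF s_ok]) auto
    also have "\<dots> = C1 * (\<tau>\<^sup>2 * norm (b x) powr (\<alpha> + 1))"
    proof -
      have e: "\<alpha> - 1 + 2 = \<alpha> + 1" by simp
      show ?thesis using pw[of "norm (b x)" "\<alpha> - 1"] unfolding ns e by (metis norm_ge_zero times_divide_eq_right)
    qed
    also have "\<dots> \<le> C1 * (\<tau>\<^sup>2 * (2 * norm z) powr (\<alpha> + 1))"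
      using C1(1) b1(2)[of x] \<alpha> by (intro mult_left_mono powr_mono2) auto
    finally show ?thesis by (simp add: mult_ac)
  qed
  \<comment> \<open>The constant \<open>c1\<close> gives a lower bound proportional to |z|^\<alpha>
    and free of \<tau>, unlike the one obtained from \<open>a\<close>.\<close>
  have low: "c * (c1 * norm z / 2) powr \<alpha> \<le> Re (mul z x)" for x
  proof -
    have "c1 * norm z / 2 \<le> c1 * norm (b x)" using b1(1)[of x] c1(1) by simp
    also have "\<dots> = c1 * norm (s x) / \<tau>" using \<tau> by (simp add: ns)
    also have "\<dots> \<le> norm (bdf2_delta (pt z x)) / \<tau>"
      unfolding pt using \<tau> by (intro divide_right_mono c1(2) s_ok) auto
    finally have "c * (c1 * norm z / 2) powr \<alpha> \<le> c * norm (mul z x)"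
      unfolding norm_mul using c c1 \<alpha> nz by (intro mult_left_mono powr_mono2) auto
    also have "\<dots> \<le> Re (mul z x)" by (rule mul_bounds(1)[OF adm])
    finally show ?thesis .
  qed
  have c0: "0 < c * (c1 * norm z / 2) powr \<alpha>" using c c1 nz by simp
  have uL2: "u \<in> L2 \<Omega>" by (rule resolvent_eq_L2[OF u])
  have b_meas: "(\<lambda>x. b x powr of_real p) \<in> borel_measurable (lebesgue_on \<Omega>)" for p
    by (rule borel_measurable_powr_complex[OF _ np]) (unfold b_def, measurable)
  have m_meas: "(\<lambda>x. mul z x - b x powr of_real \<alpha>) \<in> borel_measurable (lebesgue_on \<Omega>)"
    using b_meas[of \<alpha>] mul_meas[OF adm] by measurable
  have k_meas: "(\<lambda>x. b x powr of_real (\<alpha> - 1) - src z x) \<in> borel_measurable (lebesgue_on \<Omega>)"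
    using b_meas[of "\<alpha> - 1"] src_meas[OF adm] by (rule borel_measurable_diff)
  have "resolvent_eq \<Omega> (mul z) (\<lambda>x. (b x powr of_real (\<alpha> - 1) * G0 x + (mul z x - b x powr of_real \<alpha>) * u x) - src z x * G0 x) (\<lambda>x. u x - sol z x)"
    using resolvent_eq_diff[OF \<Omega> resolvent_eq_change_mult[OF u, of "mul z"] sol[OF adm]] by (simp add: b_def)
  also have "(\<lambda>x. (b x powr of_real (\<alpha> - 1) * G0 x + (mul z x - b x powr of_real \<alpha>) * u x) - src z x * G0 x)
      = (\<lambda>x. (b x powr of_real (\<alpha> - 1) - src z x) * G0 x + (mul z x - b x powr of_real \<alpha>) * u x)"
    by (simp add: algebra_simps)
  finally have res: "resolvent_eq \<Omega> (mul z) (\<lambda>x. (b x powr of_real (\<alpha> - 1) - src z x) * G0 x + (mul z x - b x powr of_real \<alpha>) * u x) (\<lambda>x. u x - sol z x)" .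
  have L2s: "(\<lambda>x. (b x powr of_real (\<alpha> - 1) - src z x) * G0 x) \<in> L2 \<Omega>" "(\<lambda>x. (mul z x - b x powr of_real \<alpha>) * u x) \<in> L2 \<Omega>"
    using L2_mult[OF k_meas k_diff G0] L2_mult[OF m_meas m_diff uL2] .
  have "l2_norm \<Omega> (\<lambda>x. u x - sol z x) \<le> l2_norm \<Omega> (\<lambda>x. (b x powr of_real (\<alpha> - 1) - src z x) * G0 x + (mul z x - b x powr of_real \<alpha>) * u x) / (c * (c1 * norm z / 2) powr \<alpha>)"
    by (rule resolvent_eq_bound[OF \<Omega> mul_meas[OF adm] mul_bounds(3)[OF adm] low L2_add[OF L2s] res c0])
  also have "\<dots> \<le> (C1 * \<tau>\<^sup>2 * (2 * norm z) powr (\<alpha> + 1) * l2_norm \<Omega> G0 + C1 * \<tau>\<^sup>2 * (2 * norm z) powr (\<alpha> + 2) * (2 / c / norm z * l2_norm \<Omega> G0)) / (c * (c1 * norm z / 2) powr \<alpha>)"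
  proof (rule divide_right_mono)
    have "l2_norm \<Omega> (\<lambda>x. (mul z x - b x powr of_real \<alpha>) * u x) \<le> C1 * \<tau>\<^sup>2 * (2 * norm z) powr (\<alpha> + 2) * l2_norm \<Omega> u"
      by (rule l2_norm_mult_le[OF m_meas m_diff uL2])
    also have "\<dots> \<le> C1 * \<tau>\<^sup>2 * (2 * norm z) powr (\<alpha> + 2) * (2 / c / norm z * l2_norm \<Omega> G0)"
      using C1(1) by (intro mult_left_mono continuous_resolvent_bound[OF \<eta>(1,2) z u]) auto
    finally show "l2_norm \<Omega> (\<lambda>x. (b x powr of_real (\<alpha> - 1) - src z x) * G0 x + (mul z x - b x powr of_real \<alpha>) * u x)
      \<le> C1 * \<tau>\<^sup>2 * (2 * norm z) powr (\<alpha> + 1) * l2_norm \<Omega> G0 + C1 * \<tau>\<^sup>2 * (2 * norm z) powr (\<alpha> + 2) * (2 / c / norm z * l2_norm \<Omega> G0)"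
      by (intro order_trans[OF l2_norm_triangle[OF L2s]] add_mono l2_norm_mult_le[OF k_meas k_diff G0])
  qed (use c0 in simp)
  also have "\<dots> = err_const C1 c1 * \<tau>\<^sup>2 * norm z * l2_norm \<Omega> G0"
  proof -
    have p: "(2 * norm z) powr (\<alpha> + 1) = 2 powr (\<alpha> + 1) * (norm z powr \<alpha> * norm z)"
      "(2 * norm z) powr (\<alpha> + 2) = 2 powr (\<alpha> + 2) * (norm z powr \<alpha> * norm z * norm z)"
      "(c1 * norm z / 2) powr \<alpha> = (c1 / 2) powr \<alpha> * norm z powr \<alpha>"
      using nz c1(1) by (simp_all add: powr_mult powr_add powr_divide power2_eq_square)
    have "0 < norm z powr \<alpha>" "0 < (c1 / 2) powr \<alpha>" using nz c1(1) by simp_all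
    then show ?thesis unfolding p err_const_def using nz c by (simp add: field_simps)
  qed
  finally show ?thesis .
qed

end

section \<open>The error estimate\<close>

context bdf2_setting
begin

text \<open>The contour is cut at \<open>R = \<pi> / (\<tau> sin \<theta>)\<close>, where its endpoints differ by the period \<open>2 \<pi> \<i> / \<tau>\<close>.\<close>
lemma error_small_steps:
  assumes \<eta>: "0 < \<eta>" "\<eta> \<le> \<epsilon>" "\<eta> \<le> 1/10"
    and sec: "\<And>s. \<bar>Im s\<bar> \<le> 4 \<Longrightarrow> - \<eta> * \<bar>Im s\<bar> \<le> Re s \<Longrightarrow>
      - \<epsilon> * norm (bdf2_delta (exp (- s))) \<le> Re (bdf2_delta (exp (- s)))"
    and C1: "0 < C1"
      "\<And>s. s \<noteq> 0 \<Longrightarrow> norm s \<le> 6 \<Longrightarrow> \<bar>Im s\<bar> \<le> 4 \<Longrightarrow> - (1/10) * \<bar>Im s\<bar> \<le> Re s \<Longrightarrow>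
        norm (bdf2_delta (exp (- s)) powr of_real \<alpha> - s powr of_real \<alpha>) \<le> C1 * norm s powr (\<alpha> + 2)"
      "\<And>s. s \<noteq> 0 \<Longrightarrow> norm s \<le> 6 \<Longrightarrow> \<bar>Im s\<bar> \<le> 4 \<Longrightarrow> - (1/10) * \<bar>Im s\<bar> \<le> Re s \<Longrightarrow>
        norm (s powr of_real (\<alpha> - 1) - bdf2_delta (exp (- s)) powr of_real \<alpha> * bdf2_source (exp (- s)))
          \<le> C1 * norm s powr (\<alpha> + 1)"
    and c1: "0 < c1"
      "\<And>s. \<bar>Im s\<bar> \<le> 4 \<Longrightarrow> norm s \<le> 6 \<Longrightarrow> - (1/10) * \<bar>Im s\<bar> \<le> Re s \<Longrightarrow> c1 * norm s \<le> norm (bdf2_delta (exp (- s)))"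
    and \<theta>: "pi / 2 < \<theta>" "\<theta> < pi" "\<eta> / 2 \<le> cos \<theta> + \<eta> * sin \<theta>" "4/5 \<le> sin \<theta>"
    and \<kappa>: "0 < \<kappa>" "2 * M + 1 < \<kappa> * (\<eta> / 2)" "\<tau> * \<kappa> \<le> 1" "\<tau> * M \<le> (4 - pi) / 2"
    and W: "scheme N W" and n: "n \<in> {1..N}" and \<phi>: "\<phi> \<in> L2 \<Omega>"
    and Gt: "\<And>z. z \<in> Gamma_set \<theta> \<kappa> \<Longrightarrow>
      resolvent_eq \<Omega> (\<lambda>x. (z + V x) powr of_real \<alpha>) (\<lambda>x. (z + V x) powr of_real (\<alpha> - 1) * G0 x) (Gt z)"
    and I: "has_Gamma_integral \<theta> \<kappa> (\<lambda>z. exp (z * of_real (real n * \<tau>)) * l2_inner \<Omega> (Gt z) \<phi>) I"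
  defines "B \<equiv> (err_const C1 c1 + 2 / c) * \<tau>\<^sup>2 * (l2_norm \<Omega> G0 * l2_norm \<Omega> \<phi>)"
  shows "norm (I - 2 * of_real pi * \<i> * l2_inner \<Omega> (W n) \<phi>)
    \<le> 2 * B / (real n * \<tau> * (- cos \<theta>))\<^sup>2 + (exp (\<kappa> * (real n * \<tau>)) * (B * \<kappa>)) * \<kappa> * (2 * \<theta>)"
proof -
  define R where "R = pi / (\<tau> * sin \<theta>)"
  define t where "t = real n * \<tau>"
  define X where "X = l2_norm \<Omega> G0 * l2_norm \<Omega> \<phi>"
  have X: "0 \<le> X" by (simp add: X_def)
  have t: "0 < t" using n \<tau> by (simp add: t_def)
  have sin: "0 < sin \<theta>" using \<theta> by simp
  have Rs: "R * sin \<theta> = pi / \<tau>" using sin by (simp add: R_def)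
  have R\<tau>: "\<tau> * R = pi / sin \<theta>" using \<tau> by (simp add: R_def)
  \<comment> \<open>The condition sin \<theta> \<ge> 4/5 keeps the cut contour within |\<tau> z|
    \<le> 5; with \<tau> M \<le> (4 - pi)/2 the shifted points stay within |s| \<le> 6, where the
    Taylor estimates hold.\<close>
  have "pi / sin \<theta> \<le> pi / (4/5)" using \<theta> by (intro divide_left_mono) auto
  also have "pi / (4/5) \<le> 5" using pi_less_4 by simp
  finally have R5: "\<tau> * R \<le> 5" unfolding R\<tau> .
  have "pi / 1 \<le> pi / sin \<theta>" using sin by (intro divide_left_mono) auto
  then have R3: "3 \<le> \<tau> * R" using pi_gt3 unfolding R\<tau> by simp
  have \<kappa>R: "\<kappa> \<le> R"
  proof -
    have "\<tau> * \<kappa> \<le> \<tau> * R" using R3 \<kappa>(3) by simp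
    then show ?thesis using \<tau> by simp
  qed
  have cos: "cos \<theta> < 0"
    using cos_mono_less_eq[of \<theta> "pi / 2"] \<theta> pi_gt_zero by auto
  \<comment> \<open>An open neighbourhood of the cut contour and of the half-strip to its right. The
    scaled half-height (4 + pi)/2 lies above pi, and the remaining (4 - pi)/2 up to 4 is reserved
    for \<tau> V.\<close>
  define S where "S = {z. \<tau> * \<bar>Im z\<bar> < (4 + pi) / 2 \<and> 2 * M + 1 < Re z + \<eta> * \<bar>Im z\<bar>}"
  have S_open: "open S"
    unfolding S_def by (intro open_Collect_conj open_Collect_less continuous_intros)
  \<comment> \<open>The condition Re z + \<eta> |Im z| > 2 M + 1 cuts out a nonconvex set, but one
    that is starlike about 2 M + 2, which suffices for a primitive.\<close>
  have S_star: "starlike S"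
    unfolding starlike_def
  proof (intro bexI[of _ "of_real (2 * M + 2)"] ballI subsetI)
    show "complex_of_real (2 * M + 2) \<in> S" unfolding S_def using pi_gt3 by simp
    fix z w assume z: "z \<in> S" and "w \<in> closed_segment (complex_of_real (2 * M + 2)) z"
    then obtain u where u: "0 \<le> u" "u \<le> 1" "w = (1 - u) *\<^sub>R complex_of_real (2 * M + 2) + u *\<^sub>R z"
      unfolding closed_segment_def by blast
    have Im: "\<bar>Im w\<bar> = u * \<bar>Im z\<bar>" using u by (simp add: abs_mult)
    have Re: "Re w = (1 - u) * (2 * M + 2) + u * Re z" using u by simp
    have "\<tau> * \<bar>Im w\<bar> \<le> \<tau> * \<bar>Im z\<bar>"
      unfolding Im using u \<tau> mult_left_le_one_le[of "\<bar>Im z\<bar>" u] by (intro mult_left_mono) auto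
    moreover have "2 * M + 1 < Re w + \<eta> * \<bar>Im w\<bar>"
    proof -
      have "(1 - u) * (2 * M + 1) + u * (2 * M + 1) < (1 - u) * (2 * M + 2) + u * (Re z + \<eta> * \<bar>Im z\<bar>)"
      proof (cases "u = 0")
        case False
        then have "u * (2 * M + 1) < u * (Re z + \<eta> * \<bar>Im z\<bar>)"
          using z u by (intro mult_strict_left_mono) (auto simp: S_def)
        moreover have "(1 - u) * (2 * M + 1) \<le> (1 - u) * (2 * M + 2)"
          using u by (intro mult_left_mono) auto
        ultimately show ?thesis by linarith
      qed simp
      then show ?thesis unfolding Re Im by (simp add: algebra_simps)
    qed
    ultimately show "w \<in> S" using z unfolding S_def by auto
  qed
  \<comment> \<open>This bound depends on \<tau>; it secures existence and holomorphy of
    \<open>sol\<close> on \<open>S\<close> and stays out of the final estimate.\<close>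
  obtain a where a: "0 < a" "a \<le> 1"
    "\<And>s. \<bar>Im s\<bar> \<le> 4 \<Longrightarrow> - (1/10) * \<bar>Im s\<bar> \<le> Re s \<Longrightarrow> \<tau> / 2 \<le> norm s \<Longrightarrow>
      a \<le> norm (1 - exp (- s)) \<and> a \<le> norm (bdf2_delta (exp (- s)))"
    using one_minus_exp_lower_far[of "\<tau> / 2"] \<tau> by (metis half_gt_zero)
  have adm: "admissible a z" if z: "z \<in> S" for z
    unfolding admissible_def
  proof
    fix x
    define s where "s = of_real \<tau> * (z + V x)"
    have pt: "pt z x = exp (- s)" by (simp add: pt_def s_def)
    have sh: "1 \<le> Re (z + V x) + \<eta> * \<bar>Im (z + V x)\<bar>"
      using z \<eta> by (intro shifted_sector) (auto simp: S_def)
    have "\<bar>Im (z + V x)\<bar> \<le> \<bar>Im z\<bar> + M" using abs_Im_le_cmod[of "V x"] V_le[of x] by auto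
    then have "\<tau> * \<bar>Im (z + V x)\<bar> \<le> \<tau> * (\<bar>Im z\<bar> + M)" using \<tau> by (intro mult_left_mono) auto
    also have "\<dots> = \<tau> * \<bar>Im z\<bar> + \<tau> * M" by (rule distrib_left)
    also have "\<dots> \<le> (4 + pi) / 2 + (4 - pi) / 2" using z \<kappa>(4) by (intro add_mono) (auto simp: S_def)
    also have "\<dots> = 4" by (simp add: field_simps)
    finally have s4: "\<bar>Im s\<bar> \<le> 4" using \<tau> by (simp add: s_def abs_mult)
    have "- \<eta> * \<bar>Im (z + V x)\<bar> \<le> Re (z + V x)" using sh by simp
    from mult_left_mono[OF this, of \<tau>] have s\<eta>: "- \<eta> * \<bar>Im s\<bar> \<le> Re s"
      using \<tau> by (simp add: s_def abs_mult mult_ac)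
    have s10: "- (1/10) * \<bar>Im s\<bar> \<le> Re s"
      by (rule order_trans[OF _ s\<eta>]) (use \<eta> in \<open>intro mult_right_mono, auto\<close>)
    have "1 \<le> norm (z + V x) + 1 * norm (z + V x)"
      using sh \<eta> abs_Im_le_cmod[of "z + V x"] complex_Re_le_cmod[of "z + V x"]
      by (intro order_trans[OF sh] add_mono mult_mono) auto
    then have "1/2 \<le> norm (z + V x)" by simp
    then have "\<tau> * (1/2) \<le> \<tau> * norm (z + V x)" using \<tau> by (intro mult_left_mono) auto
    then have far: "\<tau> / 2 \<le> norm s" using \<tau> by (simp add: s_def norm_mult)
    show "- \<epsilon> * norm (bdf2_delta (pt z x)) \<le> Re (bdf2_delta (pt z x)) \<and>
     a \<le> norm (bdf2_delta (pt z x)) \<and> a \<le> norm (1 - pt z x) \<and> norm (pt z x) \<le> 2"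
      unfolding pt using sec[OF s4 s\<eta>] a(3)[OF s4 s10 far] norm_exp_neg_le[OF s4 s10] by simp
  qed
  define f where "f z = exp (of_nat n * of_real \<tau> * z) * l2_inner \<Omega> (sol z) \<phi>" for z
  have hol: "f holomorphic_on S"
    unfolding f_def by (intro holomorphic_intros sol_holomorphic[OF S_open adm a(1) \<phi>])
  then have f_cont: "continuous_on S f" by (rule holomorphic_on_imp_continuous_on)
  have "\<exists>g. \<forall>z\<in>S. (g has_field_derivative f z) (at z)"
    by (rule holomorphic_starlike_primitive[OF f_cont S_star S_open, of "{}"])
       (use hol S_open in \<open>auto simp: holomorphic_on_open field_differentiable_def\<close>)
  then obtain g where g: "\<And>z. z \<in> S \<Longrightarrow> (g has_field_derivative f z) (at z)" by blast
  have incr: "g (Complex (R * cos \<theta>) (pi / \<tau>)) - g (Complex (R * cos \<theta>) (- (pi / \<tau>))) = 2 * of_real pi * \<i> * l2_inner \<Omega> (W n) \<phi>"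
  proof (rule scheme_increment[OF W n \<phi>, where S = S and \<sigma> = "2 * M + 2"])
    fix x assume x: "R * cos \<theta> \<le> x"
    have "2 * M + 1 < \<kappa> * (\<eta> / 2)" by (rule \<kappa>(2))
    also have "\<dots> \<le> R * (cos \<theta> + \<eta> * sin \<theta>)"
      using \<kappa>R \<theta>(3) \<kappa>(1) \<eta> by (intro mult_mono) auto
    also have "\<dots> = R * cos \<theta> + \<eta> * (pi / \<tau>)" unfolding Rs[symmetric] by (simp add: algebra_simps)
    finally have "2 * M + 1 < x + \<eta> * (pi / \<tau>)" using x by linarith
    then show "Complex x (pi / \<tau>) \<in> S \<and> Complex x (- (pi / \<tau>)) \<in> S"
      using \<tau> pi_less_4 by (simp add: S_def)
  next
    fix z assume z: "2 * M + 2 \<le> Re z" "\<bar>Im z\<bar> \<le> pi / \<tau>"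
    have "\<tau> * \<bar>Im z\<bar> \<le> pi" using z(2) \<tau> by (simp add: field_simps)
    moreover have "0 \<le> \<eta> * \<bar>Im z\<bar>" using \<eta> by simp
    ultimately show "z \<in> S" using z(1) pi_less_4 by (auto simp: S_def)
  qed (use g in \<open>simp add: f_def\<close>)
  have ends: "rcis R \<theta> = Complex (R * cos \<theta>) (pi / \<tau>)" "rcis R (- \<theta>) = Complex (R * cos \<theta>) (- (pi / \<tau>))"
    using Rs by (auto simp: complex_eq_iff)
  have sect: "2 * M + 1 < Re (rcis r b) + \<eta> * \<bar>Im (rcis r b)\<bar>" if "\<kappa> \<le> r" "\<bar>b\<bar> \<le> \<theta>" for r b
  proof -
    have "\<eta> / 2 \<le> cos b + \<eta> * \<bar>sin b\<bar>"
      by (rule sector_arc_bound[OF \<eta>(1) _ \<theta>(1,2,3) that(2)]) (use \<eta> in simp)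
    then have "\<kappa> * (\<eta> / 2) \<le> r * (cos b + \<eta> * \<bar>sin b\<bar>)"
      using that \<kappa>(1) \<eta> by (intro mult_mono) auto
    then show ?thesis using \<kappa> that by (simp add: abs_mult algebra_simps)
  qed
  have r2M: "2 * M \<le> norm (rcis r b)" "rcis r b \<noteq> 0" "norm (rcis r b) = r" if "\<kappa> \<le> r" for r b
  proof -
    have "\<kappa> * (\<eta> / 2) \<le> \<kappa> * 1" using \<kappa>(1) \<eta> by (intro mult_left_mono) auto
    from less_le_trans[OF \<kappa>(2) this] have "2 * M \<le> r" using that by linarith
    then show "2 * M \<le> norm (rcis r b)" using \<kappa>(1) that by simp
  qed (use \<kappa>(1) that in auto)
  have ray_Im: "\<tau> * \<bar>Im (rcis r b)\<bar> \<le> pi" if "\<kappa> \<le> r" "r \<le> R" "\<bar>b\<bar> = \<theta>" for r b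
  proof -
    have "\<bar>sin b\<bar> = sin \<theta>" using that(3) sin by (auto simp: abs_if split: if_splits)
    then have "\<tau> * \<bar>Im (rcis r b)\<bar> = \<tau> * (r * sin \<theta>)" using \<kappa> that by (simp add: abs_mult)
    also have "\<dots> \<le> \<tau> * (R * sin \<theta>)" using that \<tau> sin by (intro mult_left_mono mult_right_mono) auto
    also have "\<dots> = pi" unfolding Rs using \<tau> by simp
    finally show ?thesis .
  qed
  have arc_Im: "\<tau> * \<bar>Im (rcis \<kappa> b)\<bar> \<le> pi" for b
  proof -
    have "\<tau> * \<bar>Im (rcis \<kappa> b)\<bar> \<le> \<tau> * \<kappa>"
      using abs_Im_le_cmod[of "rcis \<kappa> b"] \<kappa> \<tau> by (intro mult_left_mono) auto
    then show ?thesis using \<kappa>(3) pi_gt3 by linarith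
  qed
  have point: "rcis r b \<in> S \<and> norm (l2_inner \<Omega> (Gt (rcis r b)) \<phi> - l2_inner \<Omega> (sol (rcis r b)) \<phi>) \<le> err_const C1 c1 * \<tau>\<^sup>2 * r * X"
    if r: "\<kappa> \<le> r" "r \<le> R" and b: "\<bar>b\<bar> \<le> \<theta>" and Im: "\<tau> * \<bar>Im (rcis r b)\<bar> \<le> pi" and G: "rcis r b \<in> Gamma_set \<theta> \<kappa>" for r b
  proof -
    have zS: "rcis r b \<in> S" using sect[OF r(1) b] Im pi_less_4 by (simp add: S_def)
    have "\<tau> * norm (rcis r b) \<le> \<tau> * R" using r r2M(3)[OF r(1)] \<tau> by simp
    then have s1: "\<tau> * norm (rcis r b) + \<tau> * M \<le> 6" using R5 \<kappa>(4) pi_gt3 by (simp add: field_simps)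
    have s2: "\<tau> * \<bar>Im (rcis r b)\<bar> + \<tau> * M \<le> 4" using Im \<kappa>(4) pi_less_4 by (simp add: field_simps)
    have "l2_norm \<Omega> (\<lambda>x. Gt (rcis r b) x - sol (rcis r b) x) \<le> err_const C1 c1 * \<tau>\<^sup>2 * norm (rcis r b) * l2_norm \<Omega> G0"
      by (rule resolvent_difference[OF \<eta> sect[OF r(1) b] r2M(1,2)[OF r(1)] adm[OF zS] a(1) s1 s2 C1 c1 Gt[OF G]])
    then have le: "l2_norm \<Omega> (\<lambda>x. Gt (rcis r b) x - sol (rcis r b) x) \<le> err_const C1 c1 * \<tau>\<^sup>2 * r * l2_norm \<Omega> G0"
      unfolding r2M(3)[OF r(1)] .
    have L2: "Gt (rcis r b) \<in> L2 \<Omega>" "sol (rcis r b) \<in> L2 \<Omega>"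
      using resolvent_eq_L2[OF Gt[OF G]] sol_L2[OF adm[OF zS] a(1)] .
    have "norm (l2_inner \<Omega> (Gt (rcis r b)) \<phi> - l2_inner \<Omega> (sol (rcis r b)) \<phi>) = norm (l2_inner \<Omega> (\<lambda>x. Gt (rcis r b) x - sol (rcis r b) x) \<phi>)"
      using L2 \<phi> by (simp add: l2_inner_diff_left)
    also have "\<dots> \<le> l2_norm \<Omega> (\<lambda>x. Gt (rcis r b) x - sol (rcis r b) x) * l2_norm \<Omega> \<phi>"
      using L2 \<phi> by (intro l2_Cauchy_Schwarz) auto
    also have "\<dots> \<le> err_const C1 c1 * \<tau>\<^sup>2 * r * l2_norm \<Omega> G0 * l2_norm \<Omega> \<phi>"
      using le by (intro mult_right_mono) auto
    finally show ?thesis using zS by (simp add: X_def mult_ac)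
  qed
  have E0: "0 \<le> err_const C1 c1"
    unfolding err_const_def using C1(1) c c1(1) by (intro divide_nonneg_nonneg mult_nonneg_nonneg add_nonneg_nonneg) auto
  have EB: "err_const C1 c1 * \<tau>\<^sup>2 * X \<le> B" "2 / c * \<tau>\<^sup>2 * X \<le> B"
  proof -
    have "0 \<le> 2 / c" using c by simp
    then show "err_const C1 c1 * \<tau>\<^sup>2 * X \<le> B" "2 / c * \<tau>\<^sup>2 * X \<le> B"
      unfolding B_def X_def[symmetric] atomize_conj using E0 X
      by (intro conjI mult_right_mono) simp_all
  qed
  have nexp: "norm (exp (rcis r b * of_real (real n * \<tau>))) = exp (r * cos b * t)" for r b
    by (simp add: t_def mult_ac)
  have cosb: "cos b = cos \<theta>" if "\<bar>b\<bar> = \<theta>" for b using that by (auto simp: abs_if split: if_splits)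
  have f_eq: "exp (rcis r b * of_real (real n * \<tau>)) * w - f (rcis r b)
      = exp (rcis r b * of_real (real n * \<tau>)) * (w - l2_inner \<Omega> (sol (rcis r b)) \<phi>)" for r b w
    unfolding f_def right_diff_distrib by (simp add: mult_ac)
  \<comment> \<open>On the rays the exponential has modulus e^(-q r), since cos \<theta> <
    0.\<close>
  define q where "q = t * (- cos \<theta>)"
  have q: "0 < q" using t cos by (simp add: q_def mult_pos_neg)
  have \<theta>0: "0 < \<theta>" using \<theta>(1) pi_gt_zero by linarith
  have "norm (I - (g (rcis R \<theta>) - g (rcis R (- \<theta>)))) \<le> 2 * B / q\<^sup>2 + (exp (\<kappa> * t) * (B * \<kappa>)) * \<kappa> * (2 * \<theta>)"
  proof (rule Gamma_integral_bound[OF I _ \<kappa>(1) \<kappa>R q _ _ g f_cont])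
    show "0 \<le> \<theta>" using \<theta>0 by simp
    show "rcis r \<theta> \<in> S \<and> rcis r (- \<theta>) \<in> S" if r: "\<kappa> \<le> r" "r \<le> R" for r
      using sect[OF r(1), of \<theta>] sect[OF r(1), of "- \<theta>"] ray_Im[OF r, of \<theta>] ray_Im[OF r, of "- \<theta>"] \<theta>0 pi_less_4
      by (simp add: S_def)
    show "rcis \<kappa> b \<in> S" if "\<bar>b\<bar> \<le> \<theta>" for b
      using sect[OF order_refl that] arc_Im[of b] pi_less_4 by (simp add: S_def)
  next
    fix r b assume r: "\<kappa> \<le> r" "r \<le> R" and b: "\<bar>b\<bar> = \<theta>"
    have "norm (exp (rcis r b * of_real (real n * \<tau>)) * l2_inner \<Omega> (Gt (rcis r b)) \<phi> - f (rcis r b))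
        = exp (r * cos b * t) * norm (l2_inner \<Omega> (Gt (rcis r b)) \<phi> - l2_inner \<Omega> (sol (rcis r b)) \<phi>)"
      unfolding f_eq norm_mult nexp ..
    also have "\<dots> \<le> exp (r * cos b * t) * (err_const C1 c1 * \<tau>\<^sup>2 * r * X)"
      using point[OF r _ ray_Im[OF r b] rcis_in_Gamma_set(2)[OF \<kappa>(1) \<theta>0 \<theta>(2) r(1) b]] b by (intro mult_left_mono) auto
    also have "\<dots> = (err_const C1 c1 * \<tau>\<^sup>2 * X) * (r * exp (- (q * r)))"
      by (simp add: cosb[OF b] q_def mult_ac)
    also have "\<dots> \<le> B * (r * exp (- (q * r)))"
      using EB(1) r \<kappa>(1) by (intro mult_right_mono) auto
    finally show "norm (exp (rcis r b * of_real (real n * \<tau>)) * l2_inner \<Omega> (Gt (rcis r b)) \<phi> - f (rcis r b)) \<le> B * (r * exp (- (q * r)))" .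
  next
    fix r b assume r: "R < r" and b: "\<bar>b\<bar> = \<theta>"
    then have r\<kappa>: "\<kappa> \<le> r" using \<kappa>R by simp
    then have r0: "0 < r" using \<kappa>(1) by simp
    have G: "rcis r b \<in> Gamma_set \<theta> \<kappa>" by (rule rcis_in_Gamma_set(2)[OF \<kappa>(1) \<theta>0 \<theta>(2) r\<kappa> b])
    have "\<tau> * R \<le> \<tau> * r" using r \<tau> by simp
    then have "1 \<le> \<tau> * r" using R3 by simp
    then have "1 * 1 \<le> (\<tau> * r) * (\<tau> * r)" by (intro mult_mono) auto
    \<comment> \<open>Beyond the cut \<tau> r \<ge> 1, so the decay 1/r of the continuous transform
      is absorbed in \<tau>^2 r, and the tail obeys the same majorant as the difference.\<close>
    then have r1: "1 / r \<le> \<tau>\<^sup>2 * r" using r0 by (simp add: divide_le_eq power2_eq_square mult_ac)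
    have bs: "\<bar>b\<bar> \<le> \<theta>" using b by simp
    have "norm (l2_inner \<Omega> (Gt (rcis r b)) \<phi>) \<le> l2_norm \<Omega> (Gt (rcis r b)) * l2_norm \<Omega> \<phi>"
      by (rule l2_Cauchy_Schwarz[OF resolvent_eq_L2[OF Gt[OF G]] \<phi>])
    also have "\<dots> \<le> 2 / c / norm (rcis r b) * l2_norm \<Omega> G0 * l2_norm \<Omega> \<phi>"
      by (intro mult_right_mono continuous_resolvent_bound[OF \<eta>(1,2) sect[OF r\<kappa> bs] r2M(1,2)[OF r\<kappa>] Gt[OF G]]) auto
    also have "\<dots> = 2 / c * (1 / r) * X" using r2M(3)[OF r\<kappa>] by (simp add: X_def)
    also have "\<dots> \<le> 2 / c * (\<tau>\<^sup>2 * r) * X"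
      using r1 c X by (intro mult_right_mono mult_left_mono) auto
    finally have le: "norm (l2_inner \<Omega> (Gt (rcis r b)) \<phi>) \<le> 2 / c * (\<tau>\<^sup>2 * r) * X" .
    have "norm (exp (rcis r b * of_real (real n * \<tau>)) * l2_inner \<Omega> (Gt (rcis r b)) \<phi>)
        \<le> exp (r * cos b * t) * (2 / c * (\<tau>\<^sup>2 * r) * X)"
      unfolding norm_mult nexp using le by (intro mult_left_mono) auto
    also have "\<dots> = (2 / c * \<tau>\<^sup>2 * X) * (r * exp (- (q * r)))"
      by (simp add: cosb[OF b] q_def mult_ac)
    also have "\<dots> \<le> B * (r * exp (- (q * r)))"
      using EB(2) r0 by (intro mult_right_mono) auto
    finally show "norm (exp (rcis r b * of_real (real n * \<tau>)) * l2_inner \<Omega> (Gt (rcis r b)) \<phi>) \<le> B * (r * exp (- (q * r)))" .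
  next
    fix b assume b: "\<bar>b\<bar> \<le> \<theta>"
    have "norm (exp (rcis \<kappa> b * of_real (real n * \<tau>)) * l2_inner \<Omega> (Gt (rcis \<kappa> b)) \<phi> - f (rcis \<kappa> b))
        = exp (\<kappa> * cos b * t) * norm (l2_inner \<Omega> (Gt (rcis \<kappa> b)) \<phi> - l2_inner \<Omega> (sol (rcis \<kappa> b)) \<phi>)"
      unfolding f_eq norm_mult nexp ..
    also have "\<dots> \<le> exp (\<kappa> * t) * (err_const C1 c1 * \<tau>\<^sup>2 * \<kappa> * X)"
    proof (rule mult_mono)
      have "\<kappa> * t * cos b \<le> \<kappa> * t * 1" using \<kappa>(1) t by (intro mult_left_mono) auto
      then show "exp (\<kappa> * cos b * t) \<le> exp (\<kappa> * t)" by (simp add: mult_ac)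
      show "norm (l2_inner \<Omega> (Gt (rcis \<kappa> b)) \<phi> - l2_inner \<Omega> (sol (rcis \<kappa> b)) \<phi>) \<le> err_const C1 c1 * \<tau>\<^sup>2 * \<kappa> * X"
        using point[OF order_refl \<kappa>R b arc_Im rcis_in_Gamma_set(1)[OF \<kappa>(1) \<theta>0 \<theta>(2) b]] by simp
    qed auto
    also have "\<dots> = exp (\<kappa> * t) * ((err_const C1 c1 * \<tau>\<^sup>2 * X) * \<kappa>)" by (simp add: mult_ac)
    also have "\<dots> \<le> exp (\<kappa> * t) * (B * \<kappa>)"
      using EB(1) \<kappa>(1) by (intro mult_left_mono mult_right_mono) auto
    finally show "norm (exp (rcis \<kappa> b * of_real (real n * \<tau>)) * l2_inner \<Omega> (Gt (rcis \<kappa> b)) \<phi> - f (rcis \<kappa> b)) \<le> exp (\<kappa> * t) * (B * \<kappa>)" .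
  qed
  then show ?thesis unfolding ends incr by (simp add: q_def t_def)
qed

text \<open>Plain stability, obtained by comparing with the zero integrand. The decay 1/r is
  weakened to r / \<kappa>^2 to fit the majorant of \<open>Gamma_integral_bound\<close>; the
  resulting t^(-2) is harmless for times bounded below.\<close>

lemma solution_bound:
  assumes \<eta>: "0 < \<eta>" "\<eta> \<le> \<epsilon>" "\<eta> \<le> 1"
    and \<theta>: "pi / 2 < \<theta>" "\<theta> < pi" "\<eta> / 2 \<le> cos \<theta> + \<eta> * sin \<theta>"
    and \<kappa>: "0 < \<kappa>" "2 * M + 1 < \<kappa> * (\<eta> / 2)" and t: "0 < t" and \<phi>: "\<phi> \<in> L2 \<Omega>"
    and Gt: "\<And>z. z \<in> Gamma_set \<theta> \<kappa> \<Longrightarrow>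
      resolvent_eq \<Omega> (\<lambda>x. (z + V x) powr of_real \<alpha>) (\<lambda>x. (z + V x) powr of_real (\<alpha> - 1) * G0 x) (Gt z)"
    and I: "has_Gamma_integral \<theta> \<kappa> (\<lambda>z. exp (z * of_real t) * l2_inner \<Omega> (Gt z) \<phi>) I"
  defines "X \<equiv> l2_norm \<Omega> G0 * l2_norm \<Omega> \<phi>"
  shows "norm I \<le> 2 * (2 / (c * \<kappa>\<^sup>2) * X) / (t * (- cos \<theta>))\<^sup>2 + (exp (\<kappa> * t) * (2 / (c * \<kappa>) * X)) * \<kappa> * (2 * \<theta>)"
proof -
  have X: "0 \<le> X" by (simp add: X_def)
  have cos: "cos \<theta> < 0"
    using cos_mono_less_eq[of \<theta> "pi / 2"] \<theta> pi_gt_zero by auto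
  have \<theta>0: "0 < \<theta>" using \<theta>(1) pi_gt_zero by linarith
  define q where "q = t * (- cos \<theta>)"
  have q: "0 < q" using t cos by (simp add: q_def mult_pos_neg)
  have le: "norm (l2_inner \<Omega> (Gt (rcis r b)) \<phi>) \<le> 2 / c / r * X"
    if r: "\<kappa> \<le> r" and b: "\<bar>b\<bar> \<le> \<theta>" and G: "rcis r b \<in> Gamma_set \<theta> \<kappa>" for r b
  proof -
    have "\<eta> / 2 \<le> cos b + \<eta> * \<bar>sin b\<bar>" by (rule sector_arc_bound[OF \<eta>(1,3) \<theta> b])
    then have "\<kappa> * (\<eta> / 2) \<le> r * (cos b + \<eta> * \<bar>sin b\<bar>)"
      using r \<kappa>(1) \<eta> by (intro mult_mono) auto
    then have s: "2 * M + 1 < Re (rcis r b) + \<eta> * \<bar>Im (rcis r b)\<bar>"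
      using \<kappa> r by (simp add: abs_mult algebra_simps)
    have "\<kappa> * (\<eta> / 2) \<le> \<kappa> * 1" using \<kappa>(1) \<eta> by (intro mult_left_mono) auto
    from less_le_trans[OF \<kappa>(2) this] have "2 * M \<le> r" using r by linarith
    then have n: "2 * M \<le> norm (rcis r b)" "rcis r b \<noteq> 0" "norm (rcis r b) = r" using \<kappa>(1) r by auto
    have "norm (l2_inner \<Omega> (Gt (rcis r b)) \<phi>) \<le> l2_norm \<Omega> (Gt (rcis r b)) * l2_norm \<Omega> \<phi>"
      by (rule l2_Cauchy_Schwarz[OF resolvent_eq_L2[OF Gt[OF G]] \<phi>])
    also have "\<dots> \<le> 2 / c / norm (rcis r b) * l2_norm \<Omega> G0 * l2_norm \<Omega> \<phi>"
      by (intro mult_right_mono continuous_resolvent_bound[OF \<eta>(1,2) s n(1,2) Gt[OF G]]) auto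
    finally show ?thesis unfolding n(3) X_def by (simp add: mult_ac)
  qed
  have nexp: "norm (exp (rcis r b * of_real t)) = exp (r * cos b * t)" for r b
    by (simp add: mult_ac)
  have cosb: "cos b = cos \<theta>" if "\<bar>b\<bar> = \<theta>" for b using that by (auto simp: abs_if split: if_splits)
  have ray: "norm (exp (rcis r b * of_real t) * l2_inner \<Omega> (Gt (rcis r b)) \<phi>) \<le> (2 / (c * \<kappa>\<^sup>2) * X) * (r * exp (- (q * r)))"
    if r: "\<kappa> \<le> r" and b: "\<bar>b\<bar> = \<theta>" for r b
  proof -
    have r0: "0 < r" using r \<kappa>(1) by simp
    have "\<kappa>\<^sup>2 \<le> r * r" unfolding power2_eq_square using r \<kappa>(1) by (intro mult_mono) auto
    then have r1: "1 / r \<le> r / \<kappa>\<^sup>2" using r0 \<kappa>(1) by (simp add: field_simps)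
    have "norm (l2_inner \<Omega> (Gt (rcis r b)) \<phi>) \<le> 2 / c / r * X"
      by (rule le[OF r _ rcis_in_Gamma_set(2)[OF \<kappa>(1) \<theta>0 \<theta>(2) r b]]) (use b in simp)
    also have "\<dots> = 2 / c * (1 / r) * X" by simp
    also have "\<dots> \<le> 2 / c * (r / \<kappa>\<^sup>2) * X" using r1 c X by (intro mult_right_mono mult_left_mono) auto
    finally have "norm (exp (rcis r b * of_real t) * l2_inner \<Omega> (Gt (rcis r b)) \<phi>) \<le> exp (r * cos b * t) * (2 / c * (r / \<kappa>\<^sup>2) * X)"
      unfolding norm_mult nexp by (intro mult_left_mono) auto
    also have "\<dots> = (2 / (c * \<kappa>\<^sup>2) * X) * (r * exp (- (q * r)))"
      by (simp add: cosb[OF b] q_def mult_ac)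
    finally show ?thesis .
  qed
  have "norm (I - ((\<lambda>z. 0) (rcis \<kappa> \<theta>) - (\<lambda>z. 0) (rcis \<kappa> (- \<theta>)))) \<le> 2 * (2 / (c * \<kappa>\<^sup>2) * X) / q\<^sup>2 + (exp (\<kappa> * t) * (2 / (c * \<kappa>) * X)) * \<kappa> * (2 * \<theta>)"
  proof (rule Gamma_integral_bound[OF I _ \<kappa>(1) order_refl q, where S = UNIV and H = "\<lambda>z. 0"])
    fix b assume b: "\<bar>b\<bar> \<le> \<theta>"
    have "\<kappa> * t * cos b \<le> \<kappa> * t * 1" using \<kappa>(1) t by (intro mult_left_mono) auto
    then have "exp (\<kappa> * cos b * t) \<le> exp (\<kappa> * t)" by (simp add: mult_ac)
    moreover have "norm (l2_inner \<Omega> (Gt (rcis \<kappa> b)) \<phi>) \<le> 2 / (c * \<kappa>) * X"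
      using le[OF order_refl b rcis_in_Gamma_set(1)[OF \<kappa>(1) \<theta>0 \<theta>(2) b]] by simp
    ultimately show "norm (exp (rcis \<kappa> b * of_real t) * l2_inner \<Omega> (Gt (rcis \<kappa> b)) \<phi> - 0) \<le> exp (\<kappa> * t) * (2 / (c * \<kappa>) * X)"
      unfolding norm_mult nexp diff_zero by (intro mult_mono) auto
  qed (use ray \<theta>0 in auto)
  then show ?thesis by (simp add: q_def)
qed

end

text \<open>Turns a weak estimate tested with \<open>f\<close> itself into a norm estimate. The
  maximum with 0 covers a vanishing norm, where \<open>D\<close> is unconstrained.\<close>

lemma l2_norm_le_of_inner:
  assumes f: "f \<in> L2 \<Omega>" and D: "norm (l2_inner \<Omega> f f) \<le> D * l2_norm \<Omega> f"
  shows "l2_norm \<Omega> f \<le> max D 0"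
proof (cases "l2_norm \<Omega> f = 0")
  case False
  then have pos: "0 < l2_norm \<Omega> f" using l2_norm_nonneg[of \<Omega> f] by linarith
  have "norm (l2_inner \<Omega> f f) = l2_norm \<Omega> f * l2_norm \<Omega> f"
    unfolding l2_inner_self norm_of_real by (simp add: power2_eq_square)
  then have "l2_norm \<Omega> f * l2_norm \<Omega> f \<le> D * l2_norm \<Omega> f" using D by simp
  then have "l2_norm \<Omega> f \<le> D" using pos by simp
  then show ?thesis by simp
qed simp

theorem theorem3p2:
  fixes \<alpha> :: real
  assumes "0 < \<alpha>" and "\<alpha> < 1"
  shows "\<forall>\<^sub>F \<theta> in at_right (pi / 2). \<forall>M. \<forall>\<^sub>F \<kappa> in at_top.
    \<forall>(\<Omega> :: 'a::euclidean_space set) (\<rho> :: complex) (U :: 'a \<Rightarrow> complex) (T :: real).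
      bounded_domain \<Omega> \<longrightarrow> T > 0 \<longrightarrow>
      U \<in> borel_measurable (lebesgue_on \<Omega>) \<longrightarrow> bounded (U ` closure \<Omega>) \<longrightarrow>
      (AE x in lebesgue_on \<Omega>. norm \<rho> * norm (U x) \<le> M) \<longrightarrow>
      (\<exists>C>0. \<forall>G0 G (N :: nat) \<tau> Gs n.
         G0 \<in> L2 \<Omega> \<longrightarrow>
         substantial_solution \<Omega> \<alpha> \<rho> U T \<theta> \<kappa> G0 G \<longrightarrow>
         N \<ge> 1 \<longrightarrow> \<tau> = T / real N \<longrightarrow>
         bdf2_solution \<Omega> \<alpha> \<rho> U \<tau> N G0 Gs \<longrightarrow>
         n \<in> {1..N} \<longrightarrow>
         l2_norm \<Omega> (\<lambda>x. G (real n * \<tau>) x - Gs n x)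
           \<le> C * (real n * \<tau>) powi (-2) * \<tau>\<^sup>2 * l2_norm \<Omega> G0)"
proof -
  obtain \<epsilon> c where \<epsilon>: "0 < \<epsilon>" "\<epsilon> \<le> 1/2" and c: "0 < c"
    and sector: "\<And>b. b \<noteq> 0 \<Longrightarrow> - \<epsilon> * norm b \<le> Re b \<Longrightarrow> c * norm b powr \<alpha> \<le> Re (b powr of_real \<alpha>)"
    using Re_powr_sector[OF assms] by metis
  obtain \<eta>1 where \<eta>1: "0 < \<eta>1" "\<eta>1 \<le> 1/10"
    "\<And>s. \<bar>Im s\<bar> \<le> 4 \<Longrightarrow> - \<eta>1 * \<bar>Im s\<bar> \<le> Re s \<Longrightarrow> - \<epsilon> * norm (bdf2_delta (exp (- s))) \<le> Re (bdf2_delta (exp (- s)))"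
    using bdf2_delta_sector[OF \<epsilon>(1)] by metis
  \<comment> \<open>It must serve both sector conditions, that of the discrete symbol and that of z
    + V. It depends on \<alpha> alone, so \<theta> can be fixed before M and \<kappa>.\<close>
  define \<eta> where "\<eta> = min \<eta>1 \<epsilon>"
  have \<eta>: "0 < \<eta>" "\<eta> \<le> \<epsilon>" "\<eta> \<le> 1/10" using \<eta>1 \<epsilon> by (auto simp: \<eta>_def)
  have sec: "- \<epsilon> * norm (bdf2_delta (exp (- s))) \<le> Re (bdf2_delta (exp (- s)))"
    if "\<bar>Im s\<bar> \<le> 4" "- \<eta> * \<bar>Im s\<bar> \<le> Re s" for s
  proof -
    have "- \<eta>1 * \<bar>Im s\<bar> \<le> - \<eta> * \<bar>Im s\<bar>" by (intro mult_right_mono) (auto simp: \<eta>_def)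
    with that \<eta>1(3)[of s] show ?thesis by linarith
  qed
  obtain C1 where C1: "0 < C1"
    "\<And>s. s \<noteq> 0 \<Longrightarrow> norm s \<le> 6 \<Longrightarrow> \<bar>Im s\<bar> \<le> 4 \<Longrightarrow> - (1/10) * \<bar>Im s\<bar> \<le> Re s \<Longrightarrow>
      norm (bdf2_delta (exp (- s)) powr of_real \<alpha> - s powr of_real \<alpha>) \<le> C1 * norm s powr (\<alpha> + 2)"
    "\<And>s. s \<noteq> 0 \<Longrightarrow> norm s \<le> 6 \<Longrightarrow> \<bar>Im s\<bar> \<le> 4 \<Longrightarrow> - (1/10) * \<bar>Im s\<bar> \<le> Re s \<Longrightarrow>
      norm (s powr of_real (\<alpha> - 1) - bdf2_delta (exp (- s)) powr of_real \<alpha> * bdf2_source (exp (- s)))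
        \<le> C1 * norm s powr (\<alpha> + 1)"
    using bdf2_powr_approx[OF assms] by metis
  obtain c1 where c1: "0 < c1"
    "\<And>s. \<bar>Im s\<bar> \<le> 4 \<Longrightarrow> norm s \<le> 6 \<Longrightarrow> - (1/10) * \<bar>Im s\<bar> \<le> Re s \<Longrightarrow> c1 * norm s \<le> norm (bdf2_delta (exp (- s)))"
    using bdf2_delta_lower by metis
  have lim1: "((\<lambda>\<theta>. cos \<theta> + \<eta> * sin \<theta>) \<longlongrightarrow> cos (pi / 2) + \<eta> * sin (pi / 2)) (at_right (pi / 2))"
    by (intro tendsto_intros)
  have lim2: "(sin \<longlongrightarrow> sin (pi / 2)) (at_right (pi / 2))"
    by (intro tendsto_intros)
  have "\<forall>\<^sub>F \<theta> in at_right (pi / 2). pi / 2 < \<theta> \<and> \<theta> < pi"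
    by (rule eventually_at_rightI[of _ pi]) auto
  moreover have "\<forall>\<^sub>F \<theta> in at_right (pi / 2). \<eta> / 2 < cos \<theta> + \<eta> * sin \<theta>"
    by (rule order_tendstoD(1)[OF lim1]) (use \<eta> in simp)
  moreover have "\<forall>\<^sub>F \<theta> in at_right (pi / 2). 4/5 < sin \<theta>"
    by (rule order_tendstoD(1)[OF lim2]) simp
  ultimately show ?thesis
  proof eventually_elim
    fix \<theta> :: real
    assume "pi / 2 < \<theta> \<and> \<theta> < pi" "\<eta> / 2 < cos \<theta> + \<eta> * sin \<theta>" "4/5 < sin \<theta>"
    then have \<theta>: "pi / 2 < \<theta>" "\<theta> < pi" "\<eta> / 2 \<le> cos \<theta> + \<eta> * sin \<theta>" "4/5 \<le> sin \<theta>" by auto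
    have \<theta>0: "0 < \<theta>" using \<theta>(1) pi_gt_zero by linarith
    have cos: "cos \<theta> < 0"
      using cos_mono_less_eq[of \<theta> "pi / 2"] \<theta> pi_gt_zero by auto
    show "\<forall>M. \<forall>\<^sub>F \<kappa> in at_top. \<forall>(\<Omega> :: 'a set) (\<rho> :: complex) (U :: 'a \<Rightarrow> complex) (T :: real).
      bounded_domain \<Omega> \<longrightarrow> T > 0 \<longrightarrow>
      U \<in> borel_measurable (lebesgue_on \<Omega>) \<longrightarrow> bounded (U ` closure \<Omega>) \<longrightarrow>
      (AE x in lebesgue_on \<Omega>. norm \<rho> * norm (U x) \<le> M) \<longrightarrow>
      (\<exists>C>0. \<forall>G0 G (N :: nat) \<tau> Gs n.
         G0 \<in> L2 \<Omega> \<longrightarrow>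
         substantial_solution \<Omega> \<alpha> \<rho> U T \<theta> \<kappa> G0 G \<longrightarrow>
         N \<ge> 1 \<longrightarrow> \<tau> = T / real N \<longrightarrow>
         bdf2_solution \<Omega> \<alpha> \<rho> U \<tau> N G0 Gs \<longrightarrow>
         n \<in> {1..N} \<longrightarrow>
         l2_norm \<Omega> (\<lambda>x. G (real n * \<tau>) x - Gs n x)
           \<le> C * (real n * \<tau>) powi (-2) * \<tau>\<^sup>2 * l2_norm \<Omega> G0)"
    proof
      fix M0 :: real
      define M where "M = \<bar>M0\<bar>"
      have M: "0 \<le> M" "M0 \<le> M" by (auto simp: M_def)
      have ev: "\<forall>\<^sub>F \<kappa> in at_top. max 0 (2 / \<eta> * (2 * M + 1)) < \<kappa>"
        by (rule eventually_gt_at_top)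
      show "\<forall>\<^sub>F \<kappa> in at_top. \<forall>(\<Omega> :: 'a set) (\<rho> :: complex) (U :: 'a \<Rightarrow> complex) (T :: real).
      bounded_domain \<Omega> \<longrightarrow> T > 0 \<longrightarrow>
      U \<in> borel_measurable (lebesgue_on \<Omega>) \<longrightarrow> bounded (U ` closure \<Omega>) \<longrightarrow>
      (AE x in lebesgue_on \<Omega>. norm \<rho> * norm (U x) \<le> M0) \<longrightarrow>
      (\<exists>C>0. \<forall>G0 G (N :: nat) \<tau> Gs n.
         G0 \<in> L2 \<Omega> \<longrightarrow>
         substantial_solution \<Omega> \<alpha> \<rho> U T \<theta> \<kappa> G0 G \<longrightarrow>
         N \<ge> 1 \<longrightarrow> \<tau> = T / real N \<longrightarrow>
         bdf2_solution \<Omega> \<alpha> \<rho> U \<tau> N G0 Gs \<longrightarrow>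
         n \<in> {1..N} \<longrightarrow>
         l2_norm \<Omega> (\<lambda>x. G (real n * \<tau>) x - Gs n x)
           \<le> C * (real n * \<tau>) powi (-2) * \<tau>\<^sup>2 * l2_norm \<Omega> G0)"
        using ev
      proof (eventually_elim, intro allI impI)
        fix \<kappa> T :: real and \<Omega> :: "'a set" and \<rho> :: complex and U :: "'a \<Rightarrow> complex"
        assume \<kappa>': "max 0 (2 / \<eta> * (2 * M + 1)) < \<kappa>" and dom: "bounded_domain \<Omega>" and T: "0 < T"
          and U [measurable]: "U \<in> borel_measurable (lebesgue_on \<Omega>)"
          and UM: "AE x in lebesgue_on \<Omega>. norm \<rho> * norm (U x) \<le> M0"
        have \<Omega>: "open \<Omega>" using dom by (simp add: bounded_domain_def)
        have \<kappa>: "0 < \<kappa>" "2 * M + 1 < \<kappa> * (\<eta> / 2)"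
          using \<kappa>' \<eta>(1) by (auto simp: field_simps)
        \<comment> \<open>\<rho> U altered on a null set, so that the bound holds at every point, as
          the resolvent lemmas ask; \<open>M\<close> is taken nonnegative for the value 0.\<close>
        define V where "V x = (if norm (\<rho> * U x) \<le> M then \<rho> * U x else 0)" for x
        have V_meas: "V \<in> borel_measurable (lebesgue_on \<Omega>)" unfolding V_def[abs_def] by measurable
        have V_le: "norm (V x) \<le> M" for x using M by (simp add: V_def)
        have UV: "AE x in lebesgue_on \<Omega>. \<rho> * U x = V x"
          using UM by eventually_elim (use M in \<open>auto simp: V_def norm_mult\<close>)
        \<comment> \<open>The threshold encodes the two smallness conditions \<tau> \<kappa> \<le> 1
          and \<tau> M \<le> (4 - pi)/2 of \<open>error_small_steps\<close>; M + 1 avoids a division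
          by zero.\<close>
        define \<tau>0 where "\<tau>0 = min (1 / \<kappa>) ((4 - pi) / (2 * (M + 1)))"
        have \<tau>0: "0 < \<tau>0" using \<kappa> M pi_less_4 by (simp add: \<tau>0_def)
        define E where "E = bdf2_setting.err_const \<alpha> c C1 c1 + 2 / c"
        \<comment> \<open>\<open>D1\<close> serves steps below the threshold, \<open>D2\<close> the
          others. The factor T^2 converts the arc contribution, which carries no t^(-2), to the
          required form.\<close>
        define D1 where "D1 = 2 * E / (cos \<theta>)\<^sup>2 + exp (\<kappa> * T) * (E * \<kappa>) * \<kappa> * (2 * \<theta>) * T\<^sup>2"
        define a where "a = 1 - exp (- (\<tau>0 / 2))"
        have a: "0 < a" using \<tau>0 by (simp add: a_def)
        define A2 where "A2 = 2 * pi * exp ((M + 1) * T) * ((8 / a) powr \<alpha> * (2 / a + 1) / c)"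
        define A3 where "A3 = 2 * (2 / (c * \<kappa>\<^sup>2)) / (\<tau>0 * (- cos \<theta>))\<^sup>2 + (exp (\<kappa> * T) * (2 / (c * \<kappa>))) * \<kappa> * (2 * \<theta>)"
        define D2 where "D2 = (A2 + A3) * (T / \<tau>0)\<^sup>2"
        define C where "C = max (max D1 D2) 0 / (2 * pi) + exp (M * T) + 1"
        have A2: "0 \<le> A2" unfolding A2_def using a c by simp
        have A3: "0 \<le> A3" unfolding A3_def using c \<kappa> \<theta>0 by simp
        show "\<exists>C>0. \<forall>G0 G (N :: nat) \<tau> Gs n.
           G0 \<in> L2 \<Omega> \<longrightarrow>
           substantial_solution \<Omega> \<alpha> \<rho> U T \<theta> \<kappa> G0 G \<longrightarrow>
           N \<ge> 1 \<longrightarrow> \<tau> = T / real N \<longrightarrow>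
           bdf2_solution \<Omega> \<alpha> \<rho> U \<tau> N G0 Gs \<longrightarrow>
           n \<in> {1..N} \<longrightarrow>
           l2_norm \<Omega> (\<lambda>x. G (real n * \<tau>) x - Gs n x)
             \<le> C * (real n * \<tau>) powi (-2) * \<tau>\<^sup>2 * l2_norm \<Omega> G0"
        proof (intro exI[of _ C] conjI allI impI)
          have "0 \<le> max (max D1 D2) 0 / (2 * pi)" by (intro divide_nonneg_nonneg) auto
          then show "0 < C" unfolding C_def using exp_gt_zero[of "M * T"] by linarith
        next
          fix G0 :: "'a \<Rightarrow> complex" and G :: "real \<Rightarrow> 'a \<Rightarrow> complex" and N n :: nat and \<tau> :: real and Gs :: "nat \<Rightarrow> 'a \<Rightarrow> complex"
          assume G0: "G0 \<in> L2 \<Omega>" and cont: "substantial_solution \<Omega> \<alpha> \<rho> U T \<theta> \<kappa> G0 G"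
            and N: "1 \<le> N" and \<tau>_eq: "\<tau> = T / real N" and bdf: "bdf2_solution \<Omega> \<alpha> \<rho> U \<tau> N G0 Gs" and n: "n \<in> {1..N}"
          have \<tau>: "0 < \<tau>" using T N by (simp add: \<tau>_eq)
          interpret bdf2_setting \<Omega> \<alpha> \<tau> M \<epsilon> c V G0
            by unfold_locales (use \<Omega> assms \<tau> V_meas V_le G0 \<epsilon> c sector in auto)
          define t where "t = real n * \<tau>"
          have t: "0 < t" "\<tau> \<le> t" "t \<le> T"
          proof -
            show "0 < t" using n \<tau> by (simp add: t_def)
            show "\<tau> \<le> t" using n \<tau> by (simp add: t_def)
            have "real n * \<tau> \<le> real N * \<tau>" using n \<tau> by (intro mult_right_mono) auto
            also have "\<dots> = T" using N by (simp add: \<tau>_eq)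
            finally show "t \<le> T" by (simp add: t_def)
          qed
          obtain W where W: "scheme N W" and WG: "AE x in lebesgue_on \<Omega>.
              Gs n x = W n x - (if n = 1 then exp (- (of_real \<tau> * V x)) * G0 x / 2 else 0)"
            using bdf2_solution_scheme[OF UV bdf N] n by blast
          have W_L2: "W n \<in> L2 \<Omega>"
            using W n dirichlet_laplacian_L2(1) unfolding scheme_def by blast
          obtain Gt where Gt0: "\<And>z. z \<in> Gamma_set \<theta> \<kappa> \<Longrightarrow> resolvent_eq \<Omega> (\<lambda>x. beta \<rho> U z x powr of_real \<alpha>)
             (\<lambda>x. beta \<rho> U z x powr of_real (\<alpha> - 1) * G0 x) (Gt z)"
            and Gt1: "\<And>t. t \<in> {0<..T} \<Longrightarrow> G t \<in> L2 \<Omega> \<and> (\<forall>\<phi>\<in>L2 \<Omega>. has_Gamma_integral \<theta> \<kappa>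
              (\<lambda>z. exp (z * of_real t) * l2_inner \<Omega> (Gt z) \<phi>) (2 * of_real pi * \<i> * l2_inner \<Omega> (G t) \<phi>))"
            using cont unfolding substantial_solution_def by blast
          have Gt: "resolvent_eq \<Omega> (\<lambda>x. (z + V x) powr of_real \<alpha>) (\<lambda>x. (z + V x) powr of_real (\<alpha> - 1) * G0 x) (Gt z)"
            if "z \<in> Gamma_set \<theta> \<kappa>" for z
          proof (rule resolvent_eq_cong_AE[OF Gt0[OF that]])
            show "AE x in lebesgue_on \<Omega>. beta \<rho> U z x powr of_real \<alpha> = (z + V x) powr of_real \<alpha>"
              using UV by eventually_elim (simp add: beta_def)
            show "AE x in lebesgue_on \<Omega>. beta \<rho> U z x powr of_real (\<alpha> - 1) * G0 x = (z + V x) powr of_real (\<alpha> - 1) * G0 x"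
              using UV by eventually_elim (simp add: beta_def)
          qed
          have G_L2: "G t \<in> L2 \<Omega>" and I: "has_Gamma_integral \<theta> \<kappa>
              (\<lambda>z. exp (z * of_real t) * l2_inner \<Omega> (Gt z) \<phi>) (2 * of_real pi * \<i> * l2_inner \<Omega> (G t) \<phi>)" if "\<phi> \<in> L2 \<Omega>" for \<phi>
            using Gt1[of t] t that by auto
          have G_L2: "G t \<in> L2 \<Omega>" using G_L2[OF L2_zero] .
          \<comment> \<open>All estimates are uniform in the test function, so the error against
            \<open>W n\<close> itself may be inserted.\<close>
          define \<phi> where "\<phi> x = G t x - W n x" for x
          have \<phi>: "\<phi> \<in> L2 \<Omega>" unfolding \<phi>_def[abs_def] using G_L2 W_L2 by simp
          define X where "X = l2_norm \<Omega> G0 * l2_norm \<Omega> \<phi>"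
          have X: "0 \<le> X" by (simp add: X_def)
          define J where "J = 2 * of_real pi * \<i> * l2_inner \<Omega> (G t) \<phi> - 2 * of_real pi * \<i> * l2_inner \<Omega> (W n) \<phi>"
          define r where "r = \<tau>\<^sup>2 / t\<^sup>2"
          have r: "0 < r" using t \<tau> by (simp add: r_def)
          have J: "norm J \<le> max D1 D2 * r * X"
          proof (cases "\<tau> \<le> \<tau>0")
            case True
            have \<tau>\<kappa>: "\<tau> * \<kappa> \<le> 1" using True \<kappa>(1) by (simp add: \<tau>0_def field_simps)
            have "\<tau> * M \<le> \<tau> * (M + 1)" using \<tau> by simp
            also have "\<dots> \<le> (4 - pi) / 2" using True M by (simp add: \<tau>0_def field_simps)
            finally have \<tau>M: "\<tau> * M \<le> (4 - pi) / 2" .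
            have E: "0 \<le> E" unfolding E_def err_const_def using C1(1) c c1(1)
              by (intro add_nonneg_nonneg divide_nonneg_nonneg mult_nonneg_nonneg) auto
            have "norm J \<le> 2 * (E * \<tau>\<^sup>2 * X) / (t * (- cos \<theta>))\<^sup>2 + (exp (\<kappa> * t) * (E * \<tau>\<^sup>2 * X * \<kappa>)) * \<kappa> * (2 * \<theta>)"
              unfolding J_def E_def X_def t_def
              by (rule error_small_steps[OF \<eta> sec C1 c1 \<theta> \<kappa> \<tau>\<kappa> \<tau>M W n \<phi> Gt I[OF \<phi>, unfolded t_def]])
            also have "\<dots> \<le> D1 * r * X"
            proof -
              have "2 * (E * \<tau>\<^sup>2 * X) / (t * (- cos \<theta>))\<^sup>2 = 2 * E / (cos \<theta>)\<^sup>2 * r * X"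
                by (simp add: r_def power_mult_distrib mult_ac)
              moreover have "(exp (\<kappa> * t) * (E * \<tau>\<^sup>2 * X * \<kappa>)) * \<kappa> * (2 * \<theta>) \<le> (exp (\<kappa> * T) * (E * \<kappa>) * \<kappa> * (2 * \<theta>) * T\<^sup>2) * r * X"
              proof -
                have "\<tau>\<^sup>2 = t\<^sup>2 * r" using t by (simp add: r_def)
                also have "\<dots> \<le> T\<^sup>2 * r" using t r by (intro mult_right_mono power_mono) auto
                finally have "exp (\<kappa> * t) * \<tau>\<^sup>2 \<le> exp (\<kappa> * T) * (T\<^sup>2 * r)"
                  using t \<kappa>(1) by (intro mult_mono) auto
                then have "(exp (\<kappa> * t) * \<tau>\<^sup>2) * (E * X * \<kappa> * \<kappa> * (2 * \<theta>)) \<le> (exp (\<kappa> * T) * (T\<^sup>2 * r)) * (E * X * \<kappa> * \<kappa> * (2 * \<theta>))"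
                  using E X \<kappa>(1) \<theta>0 by (intro mult_right_mono) auto
                then show ?thesis by (simp only: mult_ac)
              qed
              ultimately show ?thesis unfolding D1_def by (simp only: distrib_right add_mono)
            qed
            also have "\<dots> \<le> max D1 D2 * r * X" using r X by (intro mult_right_mono) auto
            finally show ?thesis .
          next
            case False
            then have \<tau>0\<tau>: "\<tau>0 \<le> \<tau>" by simp
            have ale: "a \<le> 1 - exp (- (\<tau> / 2))" using \<tau>0\<tau> by (simp add: a_def)
            have "norm (2 * of_real pi * \<i> * l2_inner \<Omega> (W n) \<phi>) \<le> 2 * pi * exp ((M + 1) * t) * ((8 / a) powr \<alpha> * (2 / a + 1) / c) * X"
              unfolding t_def X_def by (rule scheme_bound[OF W n \<phi> a ale])
            also have "\<dots> \<le> A2 * X"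
              unfolding A2_def using X a c t M by (intro mult_right_mono mult_left_mono) auto
            finally have 1: "norm (2 * of_real pi * \<i> * l2_inner \<Omega> (W n) \<phi>) \<le> A2 * X" .
            have \<eta>': "\<eta> \<le> 1" using \<eta> by simp
            have "norm (2 * of_real pi * \<i> * l2_inner \<Omega> (G t) \<phi>) \<le> 2 * (2 / (c * \<kappa>\<^sup>2) * X) / (t * (- cos \<theta>))\<^sup>2 + (exp (\<kappa> * t) * (2 / (c * \<kappa>) * X)) * \<kappa> * (2 * \<theta>)"
              unfolding X_def by (rule solution_bound[OF \<eta>(1,2) \<eta>' \<theta>(1,2,3) \<kappa> t(1) \<phi> Gt I[OF \<phi>]])
            also have "\<dots> \<le> 2 * (2 / (c * \<kappa>\<^sup>2) * X) / (\<tau>0 * (- cos \<theta>))\<^sup>2 + (exp (\<kappa> * T) * (2 / (c * \<kappa>) * X)) * \<kappa> * (2 * \<theta>)"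
            proof (intro add_mono divide_left_mono mult_right_mono)
              show "(\<tau>0 * (- cos \<theta>))\<^sup>2 \<le> (t * (- cos \<theta>))\<^sup>2"
                using \<tau>0\<tau> t cos \<tau>0 by (intro power_mono mult_right_mono) (auto simp: mult_nonneg_nonpos)
              show "0 < (t * (- cos \<theta>))\<^sup>2 * (\<tau>0 * (- cos \<theta>))\<^sup>2" using t cos \<tau>0 by simp
              show "exp (\<kappa> * t) \<le> exp (\<kappa> * T)" using t \<kappa>(1) by simp
            qed (use c X \<kappa>(1) \<theta>0 in auto)
            also have "\<dots> = A3 * X" unfolding A3_def by (simp add: field_simps)
            finally have 2: "norm (2 * of_real pi * \<i> * l2_inner \<Omega> (G t) \<phi>) \<le> A3 * X" .
            have "norm J \<le> (A2 + A3) * X"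
              unfolding J_def using norm_triangle_ineq4 1 2 by (smt (verit) distrib_right)
            also have "\<dots> \<le> (A2 + A3) * ((T / \<tau>0)\<^sup>2 * r) * X"
            proof -
              \<comment> \<open>For large steps \<tau> \<ge> \<tau>0 and t \<le> T bound \<tau> / t
                below, so an estimate of order one already has the required form.\<close>
              have "1 \<le> (T / \<tau>0) * (\<tau> / t)"
              proof -
                have "\<tau>0 * t \<le> T * \<tau>" using \<tau>0\<tau> t \<tau>0 T by (subst mult.commute) (intro mult_mono, auto)
                then show ?thesis using \<tau>0 t by (simp add: field_simps)
              qed
              then have "1 \<le> ((T / \<tau>0) * (\<tau> / t))\<^sup>2" by (rule one_le_power)
              also have "\<dots> = (T / \<tau>0)\<^sup>2 * r" by (simp add: r_def power_mult_distrib power_divide)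
              finally have "(A2 + A3) * 1 \<le> (A2 + A3) * ((T / \<tau>0)\<^sup>2 * r)"
                using A2 A3 by (intro mult_left_mono) auto
              then show ?thesis using X by (intro mult_right_mono) auto
            qed
            also have "\<dots> = D2 * r * X" by (simp add: D2_def)
            also have "\<dots> \<le> max D1 D2 * r * X" using r X by (intro mult_right_mono) auto
            finally show ?thesis .
          qed
          have "J = 2 * of_real pi * \<i> * l2_inner \<Omega> \<phi> \<phi>"
          proof -
            have "l2_inner \<Omega> \<phi> \<phi> = l2_inner \<Omega> (\<lambda>x. G t x - W n x) \<phi>" by (simp only: \<phi>_def[abs_def])
            also have "\<dots> = l2_inner \<Omega> (G t) \<phi> - l2_inner \<Omega> (W n) \<phi>" by (rule l2_inner_diff_left[OF G_L2 W_L2 \<phi>])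
            finally show ?thesis unfolding J_def by (simp only: right_diff_distrib)
          qed
          then have "norm J = 2 * pi * norm (l2_inner \<Omega> \<phi> \<phi>)" by (simp add: norm_mult)
          then have "norm (l2_inner \<Omega> \<phi> \<phi>) \<le> (max D1 D2 / (2 * pi) * r * l2_norm \<Omega> G0) * l2_norm \<Omega> \<phi>"
            using J unfolding X_def by (simp add: field_simps)
          then have "l2_norm \<Omega> \<phi> \<le> max (max D1 D2 / (2 * pi) * r * l2_norm \<Omega> G0) 0"
            by (rule l2_norm_le_of_inner[OF \<phi>])
          also have "\<dots> \<le> max (max D1 D2) 0 / (2 * pi) * r * l2_norm \<Omega> G0"
          proof (rule max.boundedI)
            show "max D1 D2 / (2 * pi) * r * l2_norm \<Omega> G0 \<le> max (max D1 D2) 0 / (2 * pi) * r * l2_norm \<Omega> G0"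
              using r by (intro mult_right_mono divide_right_mono) auto
            show "0 \<le> max (max D1 D2) 0 / (2 * pi) * r * l2_norm \<Omega> G0"
              using r by (intro mult_nonneg_nonneg divide_nonneg_nonneg) auto
          qed
          finally have \<phi>_le: "l2_norm \<Omega> \<phi> \<le> max (max D1 D2) 0 / (2 * pi) * r * l2_norm \<Omega> G0" .
          \<comment> \<open>The factor that undoes the shift; it is nonzero only at n = 1, where
            \<open>r = 1\<close>.\<close>
          define e where "e x = (if n = 1 then exp (- (of_real \<tau> * V x)) / 2 else 0)" for x
          have e_meas: "e \<in> borel_measurable (lebesgue_on \<Omega>)"
            unfolding e_def[abs_def] using V_meas by measurable
          have e_le: "norm (e x) \<le> exp (M * T) * r" for x
          proof (cases "n = 1")
            case True
            then have r1: "r = 1" using \<tau> by (simp add: r_def t_def)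
            have "- Re (V x) \<le> M" using abs_Re_le_cmod[of "V x"] V_le[of x] by linarith
            then have "\<tau> * (- Re (V x)) \<le> \<tau> * M" using \<tau> by (intro mult_left_mono) auto
            also have "\<dots> \<le> T * M" using t M by (intro mult_right_mono) auto
            finally have "exp (\<tau> * (- Re (V x))) \<le> exp (M * T)" by (simp add: mult.commute)
            moreover have "norm (e x) = exp (\<tau> * (- Re (V x))) / 2" using True by (simp add: e_def norm_divide)
            ultimately show ?thesis unfolding r1 mult_1_right using exp_ge_zero[of "\<tau> * (- Re (V x))"] by linarith
          next
            case False
            then show ?thesis using r by (simp add: e_def)
          qed
          have eG: "(\<lambda>x. e x * G0 x) \<in> L2 \<Omega>" by (rule L2_mult[OF e_meas e_le G0])
          have Gs_L2: "Gs n \<in> L2 \<Omega>" using bdf n by (simp add: bdf2_solution_def)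
          have "l2_norm \<Omega> (\<lambda>x. G t x - Gs n x) = l2_norm \<Omega> (\<lambda>x. \<phi> x + e x * G0 x)"
          proof (rule l2_norm_cong_AE)
            show "AE x in lebesgue_on \<Omega>. G t x - Gs n x = \<phi> x + e x * G0 x"
              using WG by eventually_elim (simp add: \<phi>_def e_def)
          qed (use G_L2 Gs_L2 \<phi> eG in auto)
          also have "\<dots> \<le> l2_norm \<Omega> \<phi> + l2_norm \<Omega> (\<lambda>x. e x * G0 x)" by (rule l2_norm_triangle[OF \<phi> eG])
          also have "\<dots> \<le> max (max D1 D2) 0 / (2 * pi) * r * l2_norm \<Omega> G0 + exp (M * T) * r * l2_norm \<Omega> G0"
            by (intro add_mono \<phi>_le l2_norm_mult_le[OF e_meas e_le G0])
          also have "\<dots> = (max (max D1 D2) 0 / (2 * pi) + exp (M * T)) * (r * l2_norm \<Omega> G0)"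
            by (simp only: distrib_right mult.assoc)
          also have "\<dots> \<le> C * (r * l2_norm \<Omega> G0)"
            unfolding C_def using r by (intro mult_right_mono) auto
          also have "\<dots> = C * (real n * \<tau>) powi (-2) * \<tau>\<^sup>2 * l2_norm \<Omega> G0"
            using t by (simp add: r_def t_def power_int_minus field_simps)
          finally show "l2_norm \<Omega> (\<lambda>x. G (real n * \<tau>) x - Gs n x) \<le> C * (real n * \<tau>) powi (-2) * \<tau>\<^sup>2 * l2_norm \<Omega> G0"
            by (simp add: t_def)
        qed
      qed
    qed
  qed
qed

end
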